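(* There is a unique constant $\alpha^*>\eta$ solving $$c-\lambda\mu=(\alpha-\eta)\left\{\lambda\int_0^\infty\Big(\frac{\theta+\eta y}{\alpha}\wedge y\Big)S_Y(y)\,dy+\frac{\beta^2}{2}\right\}.$$ The optimal retention strategy for the diffusion approximation risk model, that is, the strategy attaining the infimum defining $\psi_D$, is time-homogeneous, state-independent and admissible, and it is determined by the retention function $$R_D(y)=\frac{\theta+\eta y}{\alpha^*}\wedge y,\qquad y\ge 0$$ (that is, $R_t(\omega,y)=R_D(y)$ for all $t,\omega,y$). The minimum probability of ruin equals $$\psi_D(x)=e^{-(\alpha^*-\eta)x}=e^{-\rho_D x},\qquad x\ge 0,$$ in which $\rho_D=\alpha^*-\eta$.
   Context: Data: $\lambda>0$, $\beta>0$, $c$, $\theta\ge0$, $\eta\ge0$ are constants. $Y$ is a positive random variable with cumulative distribution function $F_Y$ such that $F_Y(0)=0$ and $0<F_Y(y)<1$ for $y>0$; $S_Y=1-F_Y$; the moment generating function of $Y$ is finite in a neighborhood of $0$; $\mu=\mathbb{E}Y$ and $\sigma^2=\mathbb{E}(Y^2)$ (the second moment). It is assumed that $c>\lambda\mu$ and that $\kappa:=(1+\theta)\lambda\mu+\frac{\eta}{2}\lambda\sigma^2-c>0$. We write $a\wedge b=\min(a,b)$. Strategies: on a filtered probability space $(\Omega,\mathcal F,\mathbb F=\{\mathcal F_t\}_{t\ge0},\mathbb P)$, a retention strategy $\mathcal R=\{R_t\}_{t\ge 0}$, $R_t=R_t(\omega,y)$, is admissible if (i) for each $y\ge0$, $(t,\omega)\mapsto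 R_t(\omega,y)$ is $\mathbb F$-predictable; (ii) for each $(t,\omega)$, $y\mapsto R_t(\omega,y)$ is Borel measurable on $\mathbb R^+$; (iii) $0\le R_t(\omega,y)\le y$; (iv) with probability one, for all $t\ge 0$, $c-c(R_t)>\lambda\,\mathbb{E}R_t$, where $c(R)=(1+\theta)\lambda\,\mathbb{E}(Y-R)+\frac{\eta}{2}\lambda\,\mathbb{E}((Y-R)^2)$. Here and below $\mathbb E R_t$, $\mathbb E(YR_t)$, $\mathbb E(R_t^2)$ denote integrals with respect to $dF_Y(y)$ of $R_t(\omega,y)$, $yR_t(\omega,y)$, $R_t(\omega,y)^2$ with $\omega$ fixed. Let $\mathfrak R$ be the set of admissible strategies. Diffusion approximation: for $\mathcal R\in\mathfrak R$, $$d\widehat X_t=\Big[-\kappa+\theta\lambda\mathbb{E}R_t+\eta\lambda\mathbb{E}(YR_t)-\frac{\eta}{2}\lambda\mathbb{E}(R_t^2)\Big]dt+\sqrt{\lambda\mathbb{E}(R_t^2)}\,dB_t+\beta\,dW_t,$$ with $B,W$ independent standard Brownian motions. $\tau_D=\inf\{t\ge0:\widehat X_t<0\}$ and $\psi_D(x)=\inf_{\mathcal R\in\mathfrak R}\mathbb P(\tau_D<\infty\mid\widehat X_0=x)$. *)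

theory Defs
  imports "HOL-Probability.Probability"
begin

text \<open>Processes are indexed by \<^typ>\<open>real\<close>; only the times \<open>t \<ge> 0\<close> matter. The usual
  conditions are not imposed on filtrations.\<close>

definition filtered_space :: "'a measure \<Rightarrow> (real \<Rightarrow> 'a measure) \<Rightarrow> bool" where
  "filtered_space M F \<longleftrightarrow> prob_space M \<and> (\<forall>t\<ge>0. subalgebra M (F t)) \<and>
     (\<forall>s t. 0 \<le> s \<and> s \<le> t \<longrightarrow> sets (F s) \<subseteq> sets (F t))"

definition predictable_sigma :: "'a measure \<Rightarrow> (real \<Rightarrow> 'a measure) \<Rightarrow> (real \<times> 'a) measure" where
  "predictable_sigma M F = sigma ({0..} \<times> space M)
     ({{0} \<times> A |A. A \<in> sets (F 0)} \<union>
      {{s<..t} \<times> A |s t A. 0 \<le> s \<and> s \<le> t \<and> A \<in> sets (F s)})"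

definition predictable_process ::
    "'a measure \<Rightarrow> (real \<Rightarrow> 'a measure) \<Rightarrow> (real \<Rightarrow> 'a \<Rightarrow> real) \<Rightarrow> bool" where
  "predictable_process M F H \<longleftrightarrow>
     (\<lambda>(t, \<omega>). H t \<omega>) \<in> borel_measurable (predictable_sigma M F)"

definition standard_BM ::
    "'a measure \<Rightarrow> (real \<Rightarrow> 'a measure) \<Rightarrow> (real \<Rightarrow> 'a \<Rightarrow> real) \<Rightarrow> bool" where
  "standard_BM M F B \<longleftrightarrow>
     (\<forall>t\<ge>0. B t \<in> borel_measurable (F t)) \<and>
     (AE \<omega> in M. B 0 \<omega> = 0 \<and> continuous_on {0..} (\<lambda>t. B t \<omega>)) \<and>
     (\<forall>s t. 0 \<le> s \<and> s < t \<longrightarrow>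
        distributed M lborel (\<lambda>\<omega>. B t \<omega> - B s \<omega>) (normal_density 0 (sqrt (t - s))) \<and>
        prob_space.indep_set M (sets (F s))
          (sets (vimage_algebra (space M) (\<lambda>\<omega>. B t \<omega> - B s \<omega>) borel)))"

text \<open>Independent Brownian motions on a common filtered space: besides the independence of
  the two processes, the increments of the pair after time \<open>s\<close> are independent of \<open>F s\<close>,
  i.e. \<open>(B, W)\<close> is a two-dimensional Brownian motion relative to \<open>F\<close>.\<close>

definition independent_BMs ::
    "'a measure \<Rightarrow> (real \<Rightarrow> 'a measure) \<Rightarrow> (real \<Rightarrow> 'a \<Rightarrow> real) \<Rightarrow> (real \<Rightarrow> 'a \<Rightarrow> real) \<Rightarrow> bool"
  where
  "independent_BMs M F B W \<longleftrightarrow>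
     standard_BM M F B \<and> standard_BM M F W \<and>
     prob_space.indep_var M
       (PiM {0..} (\<lambda>_. borel)) (\<lambda>\<omega>. \<lambda>t\<in>{0..}. B t \<omega>)
       (PiM {0..} (\<lambda>_. borel)) (\<lambda>\<omega>. \<lambda>t\<in>{0..}. W t \<omega>) \<and>
     (\<forall>s t. 0 \<le> s \<and> s < t \<longrightarrow>
        prob_space.indep_set M (sets (F s))
          (sets (vimage_algebra (space M)
             (\<lambda>\<omega>. (B t \<omega> - B s \<omega>, W t \<omega> - W s \<omega>)) (borel :: (real \<times> real) measure))))"

text \<open>A simple integrand is given by \<open>(n, \<tau>, \<xi>)\<close>: the value is \<open>\<xi> i\<close> on \<open>(\<tau> i, \<tau> (i + 1)]\<close>
  for \<open>i < n\<close>.\<close>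

type_synonym 'a simple_integrand = "nat \<times> (nat \<Rightarrow> real) \<times> (nat \<Rightarrow> 'a \<Rightarrow> real)"

definition simple_integrand ::
    "(real \<Rightarrow> 'a measure) \<Rightarrow> 'a simple_integrand \<Rightarrow> bool" where
  "simple_integrand F = (\<lambda>(n, \<tau>, \<xi>). 0 \<le> \<tau> 0 \<and> (\<forall>i<n. \<tau> i \<le> \<tau> (Suc i)) \<and>
     (\<forall>i<n. \<xi> i \<in> borel_measurable (F (\<tau> i)) \<and>
        (\<exists>K. \<forall>\<omega>\<in>space (F (\<tau> i)). \<bar>\<xi> i \<omega>\<bar> \<le> K)))"

definition simple_value :: "'a simple_integrand \<Rightarrow> real \<Rightarrow> 'a \<Rightarrow> real" where
  "simple_value = (\<lambda>(n, \<tau>, \<xi>) t \<omega>. \<Sum>i<n. \<xi> i \<omega> * indicator {\<tau> i<..\<tau> (Suc i)} t)"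

definition simple_integral ::
    "'a simple_integrand \<Rightarrow> (real \<Rightarrow> 'a \<Rightarrow> real) \<Rightarrow> real \<Rightarrow> 'a \<Rightarrow> real" where
  "simple_integral = (\<lambda>(n, \<tau>, \<xi>) B t \<omega>.
     \<Sum>i<n. \<xi> i \<omega> * (B (min t (\<tau> (Suc i))) \<omega> - B (min t (\<tau> i)) \<omega>))"

text \<open>\<open>I\<close> is (a version, continuous almost surely, of) the Ito integral of \<open>H\<close> with respect to
  \<open>B\<close>, for predictable \<open>H\<close> square integrable on every \<open>[0, T] \<times> \<Omega>\<close>. This determines \<open>I\<close> up to
  indistinguishability. Adaptedness of \<open>I\<close> is not demanded, because a continuous version is
  in general adapted only to the completed filtration.\<close>

definition ito_integral ::
    "'a measure \<Rightarrow> (real \<Rightarrow> 'a measure) \<Rightarrow> (real \<Rightarrow> 'a \<Rightarrow> real) \<Rightarrow> (real \<Rightarrow> 'a \<Rightarrow> real) \<Rightarrow>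
     (real \<Rightarrow> 'a \<Rightarrow> real) \<Rightarrow> bool" where
  "ito_integral M F B H I \<longleftrightarrow>
     predictable_process M F H \<and>
     (\<forall>T\<ge>0. (\<integral>\<^sup>+\<omega>. (\<integral>\<^sup>+s\<in>{0..T}. ennreal ((H s \<omega>)\<^sup>2) \<partial>lborel) \<partial>M) < \<infinity>) \<and>
     (\<forall>t\<ge>0. I t \<in> borel_measurable M) \<and>
     (AE \<omega> in M. continuous_on {0..} (\<lambda>t. I t \<omega>)) \<and>
     (\<exists>S :: nat \<Rightarrow> 'a simple_integrand. (\<forall>k. simple_integrand F (S k)) \<and>
        (\<forall>T\<ge>0. (\<lambda>k. \<integral>\<^sup>+\<omega>. (\<integral>\<^sup>+s\<in>{0..T}.
              ennreal ((simple_value (S k) s \<omega> - H s \<omega>)\<^sup>2) \<partial>lborel) \<partial>M) \<longlonglongrightarrow> 0) \<and>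
        (\<forall>t\<ge>0. (\<lambda>k. \<integral>\<^sup>+\<omega>.
              ennreal ((simple_integral (S k) B t \<omega> - I t \<omega>)\<^sup>2) \<partial>M) \<longlonglongrightarrow> 0))"

text \<open>\<open>D\<close> is the law of the claim size \<open>Y\<close> and \<open>claim_mean D f\<close> is the integral of \<open>f\<close> with
  respect to \<open>dF\<^sub>Y\<close>. The law is carried by the positive half-line; integrating over \<open>{0..}\<close>
  only makes the values of a retention function at negative claims irrelevant, also for
  measurability. A strategy \<open>R t \<omega> y\<close> is the amount retained of a claim \<open>y\<close> at time \<open>t\<close>.\<close>

definition claim_mean :: "real measure \<Rightarrow> (real \<Rightarrow> real) \<Rightarrow> real" where
  "claim_mean D f = (LINT y:{0..}|D. f y)"

definition reins_premium ::
    "real measure \<Rightarrow> real \<Rightarrow> real \<Rightarrow> real \<Rightarrow> (real \<Rightarrow> real) \<Rightarrow> real" where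
  "reins_premium D l \<theta> \<eta> r =
     (1 + \<theta>) * l * claim_mean D (\<lambda>y. y - r y) + \<eta> / 2 * l * claim_mean D (\<lambda>y. (y - r y)\<^sup>2)"

definition admissible ::
    "'a measure \<Rightarrow> (real \<Rightarrow> 'a measure) \<Rightarrow> real measure \<Rightarrow> real \<Rightarrow> real \<Rightarrow> real \<Rightarrow> real \<Rightarrow>
     (real \<Rightarrow> 'a \<Rightarrow> real \<Rightarrow> real) \<Rightarrow> bool" where
  "admissible M F D l c \<theta> \<eta> R \<longleftrightarrow>
     (\<forall>y\<ge>0. predictable_process M F (\<lambda>t \<omega>. R t \<omega> y)) \<and>
     (\<forall>t\<ge>0. \<forall>\<omega>\<in>space M. R t \<omega> \<in> borel_measurable (restrict_space borel {0..})) \<and>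
     (\<forall>t\<ge>0. \<forall>\<omega>\<in>space M. \<forall>y\<ge>0. 0 \<le> R t \<omega> y \<and> R t \<omega> y \<le> y) \<and>
     (AE \<omega> in M. \<forall>t\<ge>0. c - reins_premium D l \<theta> \<eta> (R t \<omega>) > l * claim_mean D (R t \<omega>))"

definition drift ::
    "real measure \<Rightarrow> real \<Rightarrow> real \<Rightarrow> real \<Rightarrow> real \<Rightarrow> (real \<Rightarrow> real) \<Rightarrow> real" where
  "drift D l \<kappa> \<theta> \<eta> r =
     - \<kappa> + \<theta> * l * claim_mean D r + \<eta> * l * claim_mean D (\<lambda>y. y * r y)
         - \<eta> / 2 * l * claim_mean D (\<lambda>y. (r y)\<^sup>2)"

definition volatility :: "real measure \<Rightarrow> real \<Rightarrow> (real \<Rightarrow> real) \<Rightarrow> real" where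
  "volatility D l r = sqrt (l * claim_mean D (\<lambda>y. (r y)\<^sup>2))"

text \<open>\<open>X\<close> is the surplus under strategy \<open>R\<close> started at \<open>x\<close>. Measurability of \<open>R\<close> separately in
  \<open>(t, \<omega>)\<close> and in \<open>y\<close> does not make the coefficients, which are integrals over \<open>y\<close>,
  predictable; as the stochastic differential equation is meaningless otherwise, this is part
  of the definition (for the volatility within \<^const>\<open>ito_integral\<close>). For admissible \<open>R\<close> the
  volatility is bounded, so the square integrability required there is no restriction. The
  paths of \<open>X\<close> are continuous for all \<open>\<omega>\<close>, which makes ruin a measurable event without
  completeness of \<open>M\<close>.\<close>

definition controlled_surplus ::
    "'a measure \<Rightarrow> (real \<Rightarrow> 'a measure) \<Rightarrow> (real \<Rightarrow> 'a \<Rightarrow> real) \<Rightarrow> (real \<Rightarrow> 'a \<Rightarrow> real) \<Rightarrow>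
     real measure \<Rightarrow> real \<Rightarrow> real \<Rightarrow> real \<Rightarrow> real \<Rightarrow> real \<Rightarrow>
     (real \<Rightarrow> 'a \<Rightarrow> real \<Rightarrow> real) \<Rightarrow> real \<Rightarrow> (real \<Rightarrow> 'a \<Rightarrow> real) \<Rightarrow> bool" where
  "controlled_surplus M F B W D l \<beta> \<kappa> \<theta> \<eta> R x X \<longleftrightarrow>
     (\<forall>t\<ge>0. X t \<in> borel_measurable M) \<and>
     (\<forall>\<omega>\<in>space M. continuous_on {0..} (\<lambda>t. X t \<omega>)) \<and>
     predictable_process M F (\<lambda>t \<omega>. drift D l \<kappa> \<theta> \<eta> (R t \<omega>)) \<and>
     (\<exists>I. ito_integral M F B (\<lambda>t \<omega>. volatility D l (R t \<omega>)) I \<and>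
        (AE \<omega> in M. \<forall>t\<ge>0.
           X t \<omega> = x + (LBINT s:{0..t}. drift D l \<kappa> \<theta> \<eta> (R s \<omega>)) + I t \<omega> + \<beta> * W t \<omega>))"

definition ruin_time :: "(real \<Rightarrow> 'a \<Rightarrow> real) \<Rightarrow> 'a \<Rightarrow> ereal" where
  "ruin_time X \<omega> = (INF t\<in>{t. 0 \<le> t \<and> X t \<omega> < 0}. ereal t)"

definition ruin_prob :: "'a measure \<Rightarrow> (real \<Rightarrow> 'a \<Rightarrow> real) \<Rightarrow> real" where
  "ruin_prob M X = measure M {\<omega>\<in>space M. ruin_time X \<omega> < \<infinity>}"

definition min_ruin_prob ::
    "'a measure \<Rightarrow> (real \<Rightarrow> 'a measure) \<Rightarrow> (real \<Rightarrow> 'a \<Rightarrow> real) \<Rightarrow> (real \<Rightarrow> 'a \<Rightarrow> real) \<Rightarrow>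
     real measure \<Rightarrow> real \<Rightarrow> real \<Rightarrow> real \<Rightarrow> real \<Rightarrow> real \<Rightarrow> real \<Rightarrow> real \<Rightarrow> real" where
  "min_ruin_prob M F B W D l \<beta> c \<kappa> \<theta> \<eta> x =
     Inf {ruin_prob M X |R X. admissible M F D l c \<theta> \<eta> R \<and>
            controlled_surplus M F B W D l \<beta> \<kappa> \<theta> \<eta> R x X}"

definition adjustment_eq ::
    "real measure \<Rightarrow> real \<Rightarrow> real \<Rightarrow> real \<Rightarrow> real \<Rightarrow> real \<Rightarrow> real \<Rightarrow> real \<Rightarrow> bool" where
  "adjustment_eq D l \<beta> c \<theta> \<eta> \<mu> \<alpha> \<longleftrightarrow>
     c - l * \<mu> = (\<alpha> - \<eta>) *
       (l * (LBINT y:{0..}. min ((\<theta> + \<eta> * y) / \<alpha>) y * (1 - cdf D y)) + \<beta>\<^sup>2 / 2)"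

definition R_D :: "real \<Rightarrow> real \<Rightarrow> real \<Rightarrow> real \<Rightarrow> real" where
  "R_D \<theta> \<eta> \<alpha> y = min ((\<theta> + \<eta> * y) / \<alpha>) y"

end

theory Submission
  imports Defs
begin

text \<open>Write \<open>\<rho> = \<alpha> - \<eta>\<close>. Maximizing \<open>(\<theta> + \<eta> * y) * r - \<alpha> / 2 * r\<^sup>2\<close> pointwise over \<open>0 \<le> r \<le> y\<close>
  gives \<open>R_D\<close>, and the adjustment equation turns this into
  \<open>drift \<le> \<rho> / 2 * (volatility\<^sup>2 + \<beta>\<^sup>2)\<close> for every retention, with equality for \<open>R_D\<close>. If \<open>N\<close> is the
  martingale part of the surplus \<open>X\<close> and \<open>Q\<close> its quadratic variation, then
  \<open>Z = exp (- \<rho> * N - \<rho>\<^sup>2 / 2 * Q)\<close> is a martingale, as follows from the Gaussian case through simple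
  integrands, and the inequality becomes \<open>Z \<le> exp (\<rho> * x) * exp (- \<rho> * X)\<close>, again with equality for
  \<open>R_D\<close>. Stopping \<open>Z\<close> at ruin gives both bounds on the ruin probability. For the lower
  bound the survivors must not contribute: on \<open>0 \<le> X\<close> the martingale \<open>Z\<close> is at most a constant times
  its square root, and the expectation of the square root decays exponentially because \<open>\<beta>\<^sup>2 * t \<le> Q\<close>.\<close>

section \<open>Claim distribution and adjustment equation\<close>

text \<open>The adjustment equation weights \<open>R_D\<close> with the tail
  \<open>1 - cdf D y\<close>, whereas the Hamilton-Jacobi-Bellman condition involves moments of the
  claim. Integration by parts joins them: the tail integral of \<open>R_D\<close> is the mean of its
  antiderivative \<open>R_D_prim\<close>, and the same antiderivative appears in the pointwise
  maximum over retentions. The filtration need not be complete, so the Ito integral at time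
  \<open>t\<close> agrees with an \<open>F t\<close>-measurable variable only almost surely. Hence
  all stopping is done on deterministic grids, with events determined up to null sets, and
  continuity of the paths carries the result over to continuous time. The passage from simple
  integrands to the Ito integral works because the volatility is bounded: approximants with the same
  bound have exponentials uniformly bounded in L2, so no mass is lost. \<open>Z\<close> equals
  \<open>exp (\<rho> * x) * exp (- \<rho> * X)\<close> times
  \<open>exp (\<rho> * (A - \<rho> / 2 * Q))\<close> with \<open>A\<close> the integrated drift; the
  drift inequality fixes the sign of the last exponent.\<close>

lemma has_real_derivative_pos_part_square:
  "((\<lambda>z::real. (max 0 z)\<^sup>2) has_real_derivative 2 * max 0 z) (at z)"
proof -
  consider "z < 0" | "z = 0" | "0 < z" by linarith
  then show ?thesis
  proof cases
    case 1
    have "((\<lambda>z::real. 0) has_real_derivative 2 * max 0 z) (at z)" using 1 by simp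
    then show ?thesis
      by (rule has_field_derivative_transform_within_open[of _ _ _ "{..<0}"]) (use 1 in auto)
  next
    case 2
    \<comment> \<open>At the kink the difference quotient is bounded by the absolute value of
      \<open>h\<close>, so the square of the positive part is differentiable where the positive part
      itself is not.\<close>
    have "((\<lambda>h::real. (max 0 h)\<^sup>2 / h) \<longlongrightarrow> 0) (at 0)"
    proof (rule Lim_null_comparison)
      show "\<forall>\<^sub>F h::real in at 0. norm ((max 0 h)\<^sup>2 / h) \<le> \<bar>h\<bar>"
        by (intro always_eventually allI) (auto simp: max_def power2_eq_square)
      show "((\<lambda>h::real. \<bar>h\<bar>) \<longlongrightarrow> 0) (at 0)" by (intro tendsto_rabs_zero tendsto_ident_at)
    qed
    then show ?thesis using 2 by (simp add: DERIV_def)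
  next
    case 3
    have "((\<lambda>z::real. z\<^sup>2) has_real_derivative 2 * max 0 z) (at z)"
      using 3 by (auto intro!: derivative_eq_intros)
    then show ?thesis
      by (rule has_field_derivative_transform_within_open[of _ _ _ "{0<..}"]) (use 3 in auto)
  qed
qed

text \<open>The two branches of the minimum cross at the deductible
  \<open>\<theta> / (\<alpha> - \<eta>)\<close>; beyond it the fixed share
  \<open>(\<alpha> - \<eta>) / \<alpha>\<close> of the excess is ceded. In this form the only kink
  is carried by a positive part.\<close>

lemma R_D_alt:
  assumes "\<eta> < \<alpha>" "0 < \<alpha>"
  shows "R_D \<theta> \<eta> \<alpha> y = y - (\<alpha> - \<eta>) / \<alpha> * max 0 (y - \<theta> / (\<alpha> - \<eta>))"
proof -
  have 1: "y - (\<theta> + \<eta> * y) / \<alpha> = (\<alpha> - \<eta>) / \<alpha> * (y - \<theta> / (\<alpha> - \<eta>))"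
    using assms by (simp add: field_simps)
  have "R_D \<theta> \<eta> \<alpha> y = y - max 0 (y - (\<theta> + \<eta> * y) / \<alpha>)"
    by (auto simp: R_D_def)
  also have "max 0 (y - (\<theta> + \<eta> * y) / \<alpha>) = (\<alpha> - \<eta>) / \<alpha> * max 0 (y - \<theta> / (\<alpha> - \<eta>))"
    unfolding 1 using assms by (simp add: max_mult_distrib_left)
  finally show ?thesis .
qed

text \<open>The antiderivative of \<open>R_D\<close> that vanishes at 0. Built on the square of a
  positive part, it is differentiable at every point, kink included, so the fundamental theorem of
  calculus applies without cases.\<close>

definition R_D_prim :: "real \<Rightarrow> real \<Rightarrow> real \<Rightarrow> real \<Rightarrow> real" where
  "R_D_prim \<theta> \<eta> \<alpha> y = y\<^sup>2 / 2 - (\<alpha> - \<eta>) / (2 * \<alpha>) * (max 0 (y - \<theta> / (\<alpha> - \<eta>)))\<^sup>2"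

lemma R_D_prim_deriv:
  assumes "\<eta> < \<alpha>" "0 < \<alpha>"
  shows "(R_D_prim \<theta> \<eta> \<alpha> has_real_derivative R_D \<theta> \<eta> \<alpha> y) (at y)"
proof -
  have "((\<lambda>y. (max 0 (y - \<theta> / (\<alpha> - \<eta>)))\<^sup>2) has_real_derivative 2 * max 0 (y - \<theta> / (\<alpha> - \<eta>)) * 1) (at y)"
    by (rule DERIV_chain2[OF has_real_derivative_pos_part_square]) (auto intro!: derivative_eq_intros)
  then have "((\<lambda>y. y\<^sup>2 / 2 - (\<alpha> - \<eta>) / (2 * \<alpha>) * (max 0 (y - \<theta> / (\<alpha> - \<eta>)))\<^sup>2) has_real_derivative
      y - (\<alpha> - \<eta>) / (2 * \<alpha>) * (2 * max 0 (y - \<theta> / (\<alpha> - \<eta>)) * 1)) (at y)"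
    by (intro DERIV_diff DERIV_cmult) (auto intro!: derivative_eq_intros)
  then show ?thesis
    unfolding R_D_prim_def[abs_def] R_D_alt[OF assms] by simp
qed

lemma R_D_prim_0: "\<eta> < \<alpha> \<Longrightarrow> 0 \<le> \<theta> \<Longrightarrow> R_D_prim \<theta> \<eta> \<alpha> 0 = 0"
  by (simp add: R_D_prim_def)

text \<open>The left-hand side is the maximum over retentions in the Hamilton-Jacobi-Bellman equation.\<close>

lemma R_D_value:
  assumes "\<eta> < \<alpha>" "0 < \<alpha>"
  shows "(\<theta> + \<eta> * y) * R_D \<theta> \<eta> \<alpha> y - \<alpha> / 2 * (R_D \<theta> \<eta> \<alpha> y)\<^sup>2
       = \<theta> * y + \<eta> / 2 * y\<^sup>2 - (\<alpha> - \<eta>) * R_D_prim \<theta> \<eta> \<alpha> y"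
proof -
  define \<rho> where "\<rho> = \<alpha> - \<eta>"
  define p where "p = max 0 (y - \<theta> / \<rho>)"
  have \<rho>: "\<rho> > 0" "\<eta> = \<alpha> - \<rho>" using assms by (auto simp: \<rho>_def)
  \<comment> \<open>Complementarity: \<open>p\<close> is either 0 or equal to the difference, so one
    factor of the square may be replaced by it.\<close>
  have sq: "p\<^sup>2 = p * (y - \<theta> / \<rho>)" by (auto simp: p_def max_def power2_eq_square)
  then have sq': "\<rho> * p\<^sup>2 = p * (\<rho> * y - \<theta>)" using \<rho> by (simp add: field_simps)
  have m: "R_D \<theta> \<eta> \<alpha> y = y - \<rho> / \<alpha> * p" "R_D_prim \<theta> \<eta> \<alpha> y = y\<^sup>2 / 2 - \<rho> / (2 * \<alpha>) * p\<^sup>2"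
    using R_D_alt[OF assms] by (simp_all add: \<rho>_def p_def R_D_prim_def)
  have "(\<theta> + \<eta> * y) * (y - \<rho> / \<alpha> * p) - \<alpha> / 2 * (y - \<rho> / \<alpha> * p)\<^sup>2
      - (\<theta> * y + \<eta> / 2 * y\<^sup>2 - \<rho> * (y\<^sup>2 / 2 - \<rho> / (2 * \<alpha>) * p\<^sup>2))
      = \<rho> / \<alpha> * (p * (\<rho> * y - \<theta>) - \<rho> * p\<^sup>2)"
    unfolding \<rho>(2) using assms by (simp add: field_simps power2_eq_square)
  also have "\<dots> = 0" by (simp add: sq')
  finally show ?thesis unfolding m \<rho>_def[symmetric] by simp
qed

text \<open>The objective is a concave quadratic in \<open>r\<close>, so a point \<open>m\<close>
  with \<open>(g - \<alpha> * m) * (m - r) \<ge> 0\<close> is at least as good as \<open>r\<close>.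
  The vertex \<open>g / \<alpha>\<close> makes the first factor 0; if it lies beyond
  \<open>y\<close>, the endpoint \<open>y\<close> makes both factors nonnegative.\<close>

lemma R_D_optimal:
  assumes "0 < \<alpha>" "0 \<le> r" "r \<le> y"
  shows "(\<theta> + \<eta> * y) * r - \<alpha> / 2 * r\<^sup>2 \<le> (\<theta> + \<eta> * y) * R_D \<theta> \<eta> \<alpha> y - \<alpha> / 2 * (R_D \<theta> \<eta> \<alpha> y)\<^sup>2"
proof -
  define g where "g = \<theta> + \<eta> * y"
  have main: "g * r - \<alpha> / 2 * r\<^sup>2 \<le> g * m - \<alpha> / 2 * m\<^sup>2" if "g * (m - r) \<ge> \<alpha> * m * (m - r)" for m
  proof -
    have "(g * m - \<alpha> / 2 * m\<^sup>2) - (g * r - \<alpha> / 2 * r\<^sup>2) = (g * (m - r) - \<alpha> * m * (m - r)) + \<alpha> / 2 * (m - r)\<^sup>2"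
      by (simp add: algebra_simps power2_eq_square)
    also have "\<dots> \<ge> 0" using that assms by simp
    finally show ?thesis by simp
  qed
  show ?thesis
  proof (cases "g / \<alpha> \<le> y")
    case True
    then have "R_D \<theta> \<eta> \<alpha> y = g / \<alpha>" by (simp add: R_D_def g_def)
    then show ?thesis using main[of "g / \<alpha>"] assms by (simp add: g_def)
  next
    case False
    then have "R_D \<theta> \<eta> \<alpha> y = y" "\<alpha> * y \<le> g" using assms by (auto simp: R_D_def g_def field_simps)
    then show ?thesis using main[of y] assms by (simp add: g_def mult_right_mono)
  qed
qed

lemma R_D_bounds:
  assumes "0 < \<alpha>" "0 \<le> \<theta>" "0 \<le> \<eta>" "0 \<le> y"
  shows "0 \<le> R_D \<theta> \<eta> \<alpha> y" "R_D \<theta> \<eta> \<alpha> y \<le> y"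
  using assms by (auto simp: R_D_def)

lemma R_D_measurable [measurable]: "R_D \<theta> \<eta> \<alpha> \<in> borel_measurable borel"
  unfolding R_D_def[abs_def] by measurable

lemma R_D_antimono:
  assumes "0 < \<alpha>" "\<alpha> \<le> \<alpha>'" "0 \<le> \<theta>" "0 \<le> \<eta>" "0 \<le> y"
  shows "R_D \<theta> \<eta> \<alpha>' y \<le> R_D \<theta> \<eta> \<alpha> y"
  unfolding R_D_def using assms by (intro min.mono divide_left_mono) auto

text \<open>\<open>R_D\<close> itself decreases in \<alpha>, but
  \<open>(\<alpha> - \<eta>) / \<alpha>\<close> and \<open>\<alpha> - \<eta>\<close>, the
  coefficients of the two branches after multiplication, both increase. This is what makes the
  right-hand side of the adjustment equation increasing.\<close>

lemma R_D_scaled_mono: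
  assumes "0 \<le> \<eta>" "\<eta> < \<alpha>" "\<alpha> \<le> \<alpha>'" "0 \<le> \<theta>" "0 \<le> y"
  shows "(\<alpha> - \<eta>) * R_D \<theta> \<eta> \<alpha> y \<le> (\<alpha>' - \<eta>) * R_D \<theta> \<eta> \<alpha>' y"
proof -
  have "(\<alpha> - \<eta>) / \<alpha> \<le> (\<alpha>' - \<eta>) / \<alpha>'"
    using assms by (simp add: field_simps mult_right_mono)
  then have 1: "(\<alpha> - \<eta>) / \<alpha> * (\<theta> + \<eta> * y) \<le> (\<alpha>' - \<eta>) / \<alpha>' * (\<theta> + \<eta> * y)"
    using assms by (intro mult_right_mono) auto
  have 2: "(\<alpha> - \<eta>) * y \<le> (\<alpha>' - \<eta>) * y" using assms by (intro mult_right_mono) auto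
  have eq: "(a - \<eta>) * R_D \<theta> \<eta> a y = min ((a - \<eta>) / a * (\<theta> + \<eta> * y)) ((a - \<eta>) * y)" if "\<eta> < a" for a
    using that by (simp add: R_D_def min_mult_distrib_left)
  have "\<eta> < \<alpha>'" using assms by simp
  then show ?thesis unfolding eq[OF \<open>\<eta> < \<alpha>\<close>] eq[OF \<open>\<eta> < \<alpha>'\<close>] by (intro min.mono 1 2)
qed

section \<open>Tail integrals and moments of retained claims\<close>

locale claim_law = real_distribution D for D +
  assumes pos: "AE y in D. 0 < y"
    and integrable_id: "integrable D (\<lambda>y. y)" and integrable_square: "integrable D (\<lambda>y. y\<^sup>2)"
begin

text \<open>Layer-cake formula: the tail at \<open>s\<close> is the \<open>D\<close>-mean of the
  indicator of \<open>s < y\<close>, and Tonelli exchanges the two integrals.\<close>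

lemma nn_integral_tail:
  assumes [measurable]: "m \<in> borel_measurable borel"
  shows "(\<integral>\<^sup>+ s. ennreal (m s) * ennreal (1 - cdf D s) * indicator {0..} s \<partial>lborel)
       = (\<integral>\<^sup>+ y. (\<integral>\<^sup>+ s. ennreal (m s) * indicator {0..y} s \<partial>lborel) \<partial>D)"
proof -
  have tail: "ennreal (1 - cdf D s) = (\<integral>\<^sup>+ y. indicator {s<..} y \<partial>D)" for s
  proof -
    have "space D - {..s} = {s<..}" by auto
    then have "1 - cdf D s = measure D {s<..}"
      using prob_compl[of "{..s}"] by (simp add: cdf_def)
    then show ?thesis by (simp add: emeasure_eq_measure)
  qed
  interpret pair_sigma_finite D lborel
    by (intro pair_sigma_finite.intro sigma_finite_lborel) (rule sigma_finite_measure_axioms)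
  have "(\<integral>\<^sup>+ s. ennreal (m s) * ennreal (1 - cdf D s) * indicator {0..} s \<partial>lborel)
      = (\<integral>\<^sup>+ s. (\<integral>\<^sup>+ y. ennreal (m s) * indicator {0..} s * indicator {s<..} y \<partial>D) \<partial>lborel)"
    unfolding tail by (intro nn_integral_cong) (subst nn_integral_cmult, auto simp: ac_simps)
  also have "\<dots> = (\<integral>\<^sup>+ s. (\<integral>\<^sup>+ y. ennreal (m s) * indicator {0..} s * (if s < y then 1 else 0) \<partial>D) \<partial>lborel)"
    by (intro nn_integral_cong) (auto simp: indicator_def)
  also have "\<dots> = (\<integral>\<^sup>+ y. (\<integral>\<^sup>+ s. ennreal (m s) * indicator {0..} s * (if s < y then 1 else 0) \<partial>lborel) \<partial>D)"
    by (rule Fubini') measurable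
  also have "\<dots> = (\<integral>\<^sup>+ y. (\<integral>\<^sup>+ s. ennreal (m s) * indicator {0..y} s \<partial>lborel) \<partial>D)"
  proof (rule nn_integral_cong)
    fix y
    show "(\<integral>\<^sup>+ s. ennreal (m s) * indicator {0..} s * (if s < y then 1 else 0) \<partial>lborel)
        = (\<integral>\<^sup>+ s. ennreal (m s) * indicator {0..y} s \<partial>lborel)"
      \<comment> \<open>The tail produces the condition \<open>s < y\<close>, the fundamental
        theorem wants the closed interval; the point \<open>s = y\<close> is null.\<close>
      by (rule nn_integral_cong_AE) (use AE_lborel_singleton[of y] in eventually_elim, auto simp: indicator_def)
  qed
  finally show ?thesis .
qed

text \<open>Integration by parts against the claim law. As \<open>m\<close> is nonnegative,
  everything can be done with nonnegative integrals, so integrability of the tail integrand comes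
  out of that of \<Gamma>.\<close>

lemma integral_tail:
  assumes [measurable]: "m \<in> borel_measurable borel" and m: "\<And>y. 0 \<le> y \<Longrightarrow> 0 \<le> m y"
    and \<Gamma>: "\<And>y. 0 \<le> y \<Longrightarrow> (\<Gamma> has_real_derivative m y) (at y)" "\<Gamma> 0 = 0" and int: "integrable D \<Gamma>"
  shows "integrable lborel (\<lambda>y. indicator {0..} y * (m y * (1 - cdf D y)))"
    and "(LBINT y:{0..}. m y * (1 - cdf D y)) = (LINT y|D. \<Gamma> y)"
proof -
  have pos': "AE y in D. 0 \<le> \<Gamma> y"
    using pos
  proof eventually_elim
    fix y :: real assume "0 < y"
    have "\<Gamma> 0 \<le> \<Gamma> y"
    proof (rule DERIV_nonneg_imp_nondecreasing[of 0 y \<Gamma>])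
      show "\<exists>d. (\<Gamma> has_real_derivative d) (at z) \<and> 0 \<le> d" if "0 \<le> z" for z
        using \<Gamma>(1)[OF that] m[OF that] by blast
    qed (use \<open>0 < y\<close> in simp)
    then show "0 \<le> \<Gamma> y" using \<Gamma>(2) by simp
  qed
  have cdf1: "0 \<le> 1 - cdf D y" for y using cdf_bounded_prob[of y] by simp
  have [measurable]: "cdf D \<in> borel_measurable borel" by (rule borel_measurable_mono) (simp add: mono_def cdf_nondecreasing)
  have "(\<integral>\<^sup>+ s. ennreal (indicator {0..} s * (m s * (1 - cdf D s))) \<partial>lborel)
     = (\<integral>\<^sup>+ s. ennreal (m s) * ennreal (1 - cdf D s) * indicator {0..} s \<partial>lborel)"
    by (intro nn_integral_cong) (auto simp: indicator_def ennreal_mult m cdf_bounded_prob)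
  also have "\<dots> = (\<integral>\<^sup>+ y. (\<integral>\<^sup>+ s. ennreal (m s) * indicator {0..y} s \<partial>lborel) \<partial>D)"
    by (rule nn_integral_tail) simp
  also have "\<dots> = (\<integral>\<^sup>+ y. ennreal (\<Gamma> y) \<partial>D)"
  proof (rule nn_integral_cong_AE, use pos in eventually_elim)
    fix y :: real assume "0 < y"
    then show "(\<integral>\<^sup>+ s. ennreal (m s) * indicator {0..y} s \<partial>lborel) = ennreal (\<Gamma> y)"
      using nn_integral_FTC_Icc[of m 0 y \<Gamma>] \<Gamma> m by (auto intro: has_field_derivative_at_within)
  qed
  also have "\<dots> = ennreal (LINT y|D. \<Gamma> y)" by (rule nn_integral_eq_integral[OF int pos'])
  finally have eq: "(\<integral>\<^sup>+ s. ennreal (indicator {0..} s * (m s * (1 - cdf D s))) \<partial>lborel) = ennreal (LINT y|D. \<Gamma> y)" .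
  have nn: "0 \<le> indicator {0..} s * (m s * (1 - cdf D s))" for s
    by (auto simp: indicator_def m cdf_bounded_prob)
  show i: "integrable lborel (\<lambda>y. indicator {0..} y * (m y * (1 - cdf D y)))"
    by (rule integrableI_nonneg) (use eq nn in auto)
  have "ennreal (LINT y|lborel. indicator {0..} y * (m y * (1 - cdf D y))) = ennreal (LINT y|D. \<Gamma> y)"
    using eq nn_integral_eq_integral[OF i] nn by simp
  moreover have "0 \<le> (LINT y|D. \<Gamma> y)" using pos' by (rule integral_nonneg_AE)
  ultimately show "(LBINT y:{0..}. m y * (1 - cdf D y)) = (LINT y|D. \<Gamma> y)"
    using nn by (simp add: set_lebesgue_integral_def)
qed

lemma AE_nonneg: "AE y in D. 0 \<le> y"
  using pos by eventually_elim simp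

lemma LINT_nonneg_part: "(LINT y|D. indicator {0..} y * f y) = (LINT y|D. f y)" if [measurable]: "f \<in> borel_measurable borel" for f :: "real \<Rightarrow> real"
  by (rule integral_cong_AE) (auto intro!: eventually_mono[OF AE_nonneg])

lemma claim_mean_eq: "claim_mean D f = (LINT y|D. indicator {0..} y * f y)"
  by (simp add: claim_mean_def set_lebesgue_integral_def)

text \<open>What admissibility says about \<open>R t \<omega>\<close> at one time and outcome, the
  premium condition apart. Measurability is on the half-line only, hence the factor
  \<open>indicator {0..} y\<close> in the integrands below.\<close>

definition retention :: "(real \<Rightarrow> real) \<Rightarrow> bool" where
  "retention r \<longleftrightarrow> r \<in> borel_measurable (restrict_space borel {0..}) \<and> (\<forall>y\<ge>0. 0 \<le> r y \<and> r y \<le> y)"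

lemma retention_integrable:
  assumes r: "retention r"
  shows "integrable D (\<lambda>y. indicator {0..} y * y)" "integrable D (\<lambda>y. indicator {0..} y * y\<^sup>2)"
    "integrable D (\<lambda>y. indicator {0..} y * r y)"
    "integrable D (\<lambda>y. indicator {0..} y * (y * r y))" "integrable D (\<lambda>y. indicator {0..} y * (r y)\<^sup>2)"
proof -
  have rm [measurable]: "(\<lambda>y. indicator {0..} y * r y) \<in> borel_measurable borel"
    using r by (simp add: retention_def borel_measurable_restrict_space_iff)
  have rb: "\<And>y. 0 \<le> y \<Longrightarrow> 0 \<le> r y" "\<And>y. 0 \<le> y \<Longrightarrow> r y \<le> y" using r by (auto simp: retention_def)
  show "integrable D (\<lambda>y. indicator {0..} y * y)"
    by (rule Bochner_Integration.integrable_bound[OF integrable_id]) (auto simp: indicator_def)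
  show "integrable D (\<lambda>y. indicator {0..} y * y\<^sup>2)"
    by (rule Bochner_Integration.integrable_bound[OF integrable_square]) (auto simp: indicator_def)
  have rD: "(\<lambda>y. indicator {0..} y * r y) \<in> borel_measurable D" using rm by simp
  show "integrable D (\<lambda>y. indicator {0..} y * r y)"
    by (rule Bochner_Integration.integrable_bound[OF integrable_id rD]) (auto simp: indicator_def rb)
  have "(\<lambda>y. y * (indicator {0..} y * r y)) \<in> borel_measurable D" by measurable
  then have "(\<lambda>y. indicator {0..} y * (y * r y)) \<in> borel_measurable D" by (simp add: ac_simps)
  then show "integrable D (\<lambda>y. indicator {0..} y * (y * r y))"
    by (rule Bochner_Integration.integrable_bound[OF integrable_square])
       (auto simp: indicator_def rb power2_eq_square abs_mult intro!: mult_left_mono)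
  have "(\<lambda>y. (indicator {0..} y * r y)\<^sup>2) \<in> borel_measurable D" by measurable
  also have "(\<lambda>y. (indicator {0..} y * r y)\<^sup>2) = (\<lambda>y. indicator {0..} y * (r y)\<^sup>2)"
    by (auto simp: indicator_def)
  finally show "integrable D (\<lambda>y. indicator {0..} y * (r y)\<^sup>2)"
    by (rule Bochner_Integration.integrable_bound[OF integrable_square])
       (auto simp: indicator_def rb intro!: power_mono)
qed

lemma retention_means:
  assumes r: "retention r"
  shows "0 \<le> claim_mean D r"
    "0 \<le> claim_mean D (\<lambda>y. (r y)\<^sup>2)" "claim_mean D (\<lambda>y. (r y)\<^sup>2) \<le> claim_mean D (\<lambda>y. y * r y)"
    "claim_mean D (\<lambda>y. (r y)\<^sup>2) \<le> (LINT y|D. y\<^sup>2)"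
proof -
  note ints = retention_integrable[OF r]
  have rb: "\<And>y. 0 \<le> y \<Longrightarrow> 0 \<le> r y" "\<And>y. 0 \<le> y \<Longrightarrow> r y \<le> y" using r by (auto simp: retention_def)
  show "0 \<le> claim_mean D r" "0 \<le> claim_mean D (\<lambda>y. (r y)\<^sup>2)"
    unfolding claim_mean_eq by (auto intro!: Bochner_Integration.integral_nonneg simp: indicator_def rb)
  show "claim_mean D (\<lambda>y. (r y)\<^sup>2) \<le> claim_mean D (\<lambda>y. y * r y)"
    unfolding claim_mean_eq
    by (rule integral_mono[OF ints(5,4)]) (auto simp: indicator_def rb power2_eq_square intro!: mult_right_mono)
  have "claim_mean D (\<lambda>y. (r y)\<^sup>2) \<le> (LINT y|D. indicator {0..} y * y\<^sup>2)"
    unfolding claim_mean_eq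
    by (rule integral_mono[OF ints(5,2)]) (auto simp: indicator_def rb intro!: power_mono)
  then show "claim_mean D (\<lambda>y. (r y)\<^sup>2) \<le> (LINT y|D. y\<^sup>2)" by (simp add: LINT_nonneg_part)
qed

lemma volatility_square: "retention r \<Longrightarrow> 0 < l \<Longrightarrow> (volatility D l r)\<^sup>2 = l * claim_mean D (\<lambda>y. (r y)\<^sup>2)"
  using retention_means(2)[of r] by (simp add: volatility_def)

lemma claim_mean_value:
  assumes "retention r"
  shows "claim_mean D (\<lambda>y. (\<theta> + \<eta> * y) * r y - \<alpha> / 2 * (r y)\<^sup>2)
    = \<theta> * claim_mean D r + \<eta> * claim_mean D (\<lambda>y. y * r y) - \<alpha> / 2 * claim_mean D (\<lambda>y. (r y)\<^sup>2)"
proof -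
  note ints = retention_integrable[OF assms]
  have "claim_mean D (\<lambda>y. (\<theta> + \<eta> * y) * r y - \<alpha> / 2 * (r y)\<^sup>2)
    = (LINT y|D. \<theta> * (indicator {0..} y * r y) + \<eta> * (indicator {0..} y * (y * r y)) - \<alpha> / 2 * (indicator {0..} y * (r y)\<^sup>2))"
    unfolding claim_mean_eq by (intro Bochner_Integration.integral_cong) (auto simp: algebra_simps)
  also have "\<dots> = \<theta> * claim_mean D r + \<eta> * claim_mean D (\<lambda>y. y * r y) - \<alpha> / 2 * claim_mean D (\<lambda>y. (r y)\<^sup>2)"
    unfolding claim_mean_eq using ints by simp
  finally show ?thesis .
qed

lemma integrable_value:
  assumes "retention r"
  shows "integrable D (\<lambda>y. indicator {0..} y * ((\<theta> + \<eta> * y) * r y - \<alpha> / 2 * (r y)\<^sup>2))"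
proof -
  note ints = retention_integrable[OF assms]
  have "integrable D (\<lambda>y. \<theta> * (indicator {0..} y * r y) + \<eta> * (indicator {0..} y * (y * r y)) - \<alpha> / 2 * (indicator {0..} y * (r y)\<^sup>2))"
    using ints by simp
  also have "(\<lambda>y. \<theta> * (indicator {0..} y * r y) + \<eta> * (indicator {0..} y * (y * r y)) - \<alpha> / 2 * (indicator {0..} y * (r y)\<^sup>2))
     = (\<lambda>y. indicator {0..} y * ((\<theta> + \<eta> * y) * r y - \<alpha> / 2 * (r y)\<^sup>2))"
    by (auto simp: algebra_simps)
  finally show ?thesis .
qed

text \<open>Valid for every \<alpha>: writing \<open>\<eta> / 2\<close> as
  \<open>\<alpha> / 2 - (\<alpha> - \<eta>) / 2\<close> separates the expression that
  \<open>R_D\<close> maximizes from a multiple of the squared volatility.\<close>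

lemma drift_eq:
  assumes "retention r" "0 < l"
  shows "drift D l \<kappa> \<theta> \<eta> r = - \<kappa> + l * claim_mean D (\<lambda>y. (\<theta> + \<eta> * y) * r y - \<alpha> / 2 * (r y)\<^sup>2)
      + (\<alpha> - \<eta>) / 2 * (volatility D l r)\<^sup>2"
  unfolding drift_def volatility_square[OF assms] claim_mean_value[OF assms(1)] by (simp add: field_simps)

text \<open>Since \<open>r^2 \<le> y * r\<close>, the positive \<eta>-term absorbs the subtracted
  one. With the upper bound of \<open>drift_hamiltonian\<close> this bounds the drift uniformly over
  retentions, so that it can be integrated along paths.\<close>

lemma drift_bounded:
  assumes "retention r" "0 < l" "0 \<le> \<theta>" "0 \<le> \<eta>"
  shows "- \<kappa> \<le> drift D l \<kappa> \<theta> \<eta> r"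
proof -
  have "0 \<le> \<theta> * l * claim_mean D r" using retention_means(1)[OF assms(1)] assms by simp
  moreover have "\<eta> * l * claim_mean D (\<lambda>y. (r y)\<^sup>2) \<le> \<eta> * l * claim_mean D (\<lambda>y. y * r y)"
    using retention_means(3)[OF assms(1)] assms by (intro mult_left_mono) auto
  moreover have "0 \<le> \<eta> * l * claim_mean D (\<lambda>y. (r y)\<^sup>2)" using retention_means(2)[OF assms(1)] assms by simp
  ultimately show ?thesis unfolding drift_def by linarith
qed

text \<open>Expanding the square in the premium shows that the margin in the admissibility condition
  is the drift of the surplus. Admissibility of \<open>R_D\<close> thereby reduces to positivity of
  its drift.\<close>

lemma premium_condition:
  assumes r: "retention r" and \<kappa>: "\<kappa> = (1 + \<theta>) * l * (LINT y|D. y) + \<eta> / 2 * l * (LINT y|D. y\<^sup>2) - c"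
  shows "c - reins_premium D l \<theta> \<eta> r - l * claim_mean D r = drift D l \<kappa> \<theta> \<eta> r"
proof -
  note ints = retention_integrable[OF r]
  have 1: "claim_mean D (\<lambda>y. y - r y) = (LINT y|D. y) - claim_mean D r"
  proof -
    have "claim_mean D (\<lambda>y. y - r y) = (LINT y|D. indicator {0..} y * y - indicator {0..} y * r y)"
      unfolding claim_mean_eq by (intro Bochner_Integration.integral_cong) (auto simp: algebra_simps)
    then show ?thesis using ints by (simp add: claim_mean_eq LINT_nonneg_part)
  qed
  have 2: "claim_mean D (\<lambda>y. (y - r y)\<^sup>2) = (LINT y|D. y\<^sup>2) - 2 * claim_mean D (\<lambda>y. y * r y) + claim_mean D (\<lambda>y. (r y)\<^sup>2)"
  proof -
    have "claim_mean D (\<lambda>y. (y - r y)\<^sup>2) = (LINT y|D. indicator {0..} y * y\<^sup>2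
        - 2 * (indicator {0..} y * (y * r y)) + indicator {0..} y * (r y)\<^sup>2)"
      unfolding claim_mean_eq by (intro Bochner_Integration.integral_cong) (auto simp: power2_eq_square algebra_simps)
    then show ?thesis using ints by (simp add: claim_mean_eq LINT_nonneg_part)
  qed
  show ?thesis unfolding reins_premium_def drift_def 1 2 \<kappa> by (simp add: algebra_simps)
qed

lemma retention_R_D:
  assumes "0 < \<alpha>" "0 \<le> \<theta>" "0 \<le> \<eta>"
  shows "retention (R_D \<theta> \<eta> \<alpha>)"
  unfolding retention_def using R_D_bounds[OF assms] by (auto intro: measurable_restrict_space1)

section \<open>Solving the adjustment equation\<close>

definition retained_tail :: "real \<Rightarrow> real \<Rightarrow> real \<Rightarrow> real" where
  "retained_tail \<theta> \<eta> \<alpha> = (LBINT y:{0..}. R_D \<theta> \<eta> \<alpha> y * (1 - cdf D y))"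

lemma adjustment_eq_retained_tail:
  "adjustment_eq D l \<beta> c \<theta> \<eta> \<mu> \<alpha> \<longleftrightarrow> c - l * \<mu> = (\<alpha> - \<eta>) * (l * retained_tail \<theta> \<eta> \<alpha> + \<beta>\<^sup>2 / 2)"
  by (simp add: adjustment_eq_def retained_tail_def R_D_def)

context
  fixes \<theta> \<eta> :: real
  assumes \<theta>: "0 \<le> \<theta>" and \<eta>: "0 \<le> \<eta>"
begin

lemma R_D_prim_measurable: "R_D_prim \<theta> \<eta> \<alpha> \<in> borel_measurable borel"
  unfolding R_D_prim_def[abs_def] by measurable

text \<open>For positive claims \<open>R_D_prim\<close> lies between 0 and \<open>y^2\<close>, so
  the second moment gives its integrability and \<open>integral_tail\<close> applies. The third part
  is the form in which the adjustment equation meets the Hamilton-Jacobi-Bellman maximum.\<close>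

lemma R_D_tail:
  assumes \<alpha>: "\<eta> < \<alpha>"
  shows "integrable D (R_D_prim \<theta> \<eta> \<alpha>)"
    and "integrable lborel (\<lambda>y. indicator {0..} y * (R_D \<theta> \<eta> \<alpha> y * (1 - cdf D y)))"
    and "retained_tail \<theta> \<eta> \<alpha> = (LINT y|D. R_D_prim \<theta> \<eta> \<alpha> y)"
proof -
  have \<alpha>0: "0 < \<alpha>" using \<alpha> \<eta> by simp
  have prim0: "0 \<le> R_D_prim \<theta> \<eta> \<alpha> y" "R_D_prim \<theta> \<eta> \<alpha> y \<le> y\<^sup>2" if "0 < y" for y
  proof -
    have "R_D_prim \<theta> \<eta> \<alpha> 0 \<le> R_D_prim \<theta> \<eta> \<alpha> y"
    proof (rule DERIV_nonneg_imp_nondecreasing[of 0 y "R_D_prim \<theta> \<eta> \<alpha>"])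
      show "\<exists>d. (R_D_prim \<theta> \<eta> \<alpha> has_real_derivative d) (at z) \<and> 0 \<le> d" if "0 \<le> z" for z
        using R_D_prim_deriv[OF \<alpha> \<alpha>0] R_D_bounds(1)[OF \<alpha>0 \<theta> \<eta> that] by blast
    qed (use that in simp)
    then show "0 \<le> R_D_prim \<theta> \<eta> \<alpha> y" by (simp add: R_D_prim_0[OF \<alpha> \<theta>])
    have "0 \<le> (\<alpha> - \<eta>) / (2 * \<alpha>) * (max 0 (y - \<theta> / (\<alpha> - \<eta>)))\<^sup>2" using \<alpha> \<alpha>0 by simp
    then show "R_D_prim \<theta> \<eta> \<alpha> y \<le> y\<^sup>2" unfolding R_D_prim_def using zero_le_power2[of y] by linarith
  qed
  show int: "integrable D (R_D_prim \<theta> \<eta> \<alpha>)"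
  proof (rule Bochner_Integration.integrable_bound[OF integrable_square])
    show "R_D_prim \<theta> \<eta> \<alpha> \<in> borel_measurable D" using R_D_prim_measurable by simp
    show "AE y in D. norm (R_D_prim \<theta> \<eta> \<alpha> y) \<le> norm (y\<^sup>2)"
      using pos by eventually_elim (use prim0 in force)
  qed
  show "integrable lborel (\<lambda>y. indicator {0..} y * (R_D \<theta> \<eta> \<alpha> y * (1 - cdf D y)))"
    by (rule integral_tail(1)[OF R_D_measurable R_D_bounds(1)[OF \<alpha>0 \<theta> \<eta>] R_D_prim_deriv[OF \<alpha> \<alpha>0] R_D_prim_0[OF \<alpha> \<theta>] int])
  show "retained_tail \<theta> \<eta> \<alpha> = (LINT y|D. R_D_prim \<theta> \<eta> \<alpha> y)"
    unfolding retained_tail_def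
    by (rule integral_tail(2)[OF R_D_measurable R_D_bounds(1)[OF \<alpha>0 \<theta> \<eta>] R_D_prim_deriv[OF \<alpha> \<alpha>0] R_D_prim_0[OF \<alpha> \<theta>] int])
qed

lemma retained_tail_nonneg: "\<eta> < \<alpha> \<Longrightarrow> 0 \<le> retained_tail \<theta> \<eta> \<alpha>"
  unfolding retained_tail_def set_lebesgue_integral_def using \<theta> \<eta>
  by (intro Bochner_Integration.integral_nonneg) (auto simp: indicator_def R_D_bounds cdf_bounded_prob)

lemma retained_tail_antimono:
  assumes "\<eta> < \<alpha>" "\<alpha> \<le> \<alpha>'"
  shows "retained_tail \<theta> \<eta> \<alpha>' \<le> retained_tail \<theta> \<eta> \<alpha>"
proof -
  have "\<eta> < \<alpha>'" using assms by simp
  then show ?thesis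
    unfolding retained_tail_def set_lebesgue_integral_def real_scaleR_def
    using \<theta> \<eta> assms
    by (intro integral_mono R_D_tail(2)) (auto simp: indicator_def cdf_bounded_prob intro!: mult_right_mono R_D_antimono)
qed

lemma retained_tail_scaled_mono:
  assumes "\<eta> < \<alpha>" "\<alpha> \<le> \<alpha>'"
  shows "(\<alpha> - \<eta>) * retained_tail \<theta> \<eta> \<alpha> \<le> (\<alpha>' - \<eta>) * retained_tail \<theta> \<eta> \<alpha>'"
proof -
  have \<alpha>': "\<eta> < \<alpha>'" using assms by simp
  have "(LINT y|lborel. (\<alpha> - \<eta>) * (indicator {0..} y * (R_D \<theta> \<eta> \<alpha> y * (1 - cdf D y))))
     \<le> (LINT y|lborel. (\<alpha>' - \<eta>) * (indicator {0..} y * (R_D \<theta> \<eta> \<alpha>' y * (1 - cdf D y))))"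
  proof (rule integral_mono)
    fix y :: real
    have "0 \<le> 1 - cdf D y" using cdf_bounded_prob[of y] by simp
    then have "(\<alpha> - \<eta>) * R_D \<theta> \<eta> \<alpha> y * (1 - cdf D y) \<le> (\<alpha>' - \<eta>) * R_D \<theta> \<eta> \<alpha>' y * (1 - cdf D y)" if "0 \<le> y"
      by (intro mult_right_mono R_D_scaled_mono \<eta> \<theta> assms that)
    then show "(\<alpha> - \<eta>) * (indicator {0..} y * (R_D \<theta> \<eta> \<alpha> y * (1 - cdf D y)))
       \<le> (\<alpha>' - \<eta>) * (indicator {0..} y * (R_D \<theta> \<eta> \<alpha>' y * (1 - cdf D y)))"
      by (auto simp: indicator_def ac_simps)
  qed (intro integrable_mult_right R_D_tail(2) assms(1) \<alpha>')+
  then show ?thesis by (simp add: retained_tail_def set_lebesgue_integral_def)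
qed

lemma retained_tail_le: "\<eta> < \<alpha> \<Longrightarrow> retained_tail \<theta> \<eta> \<alpha> \<le> (LINT y|D. y\<^sup>2)"
  unfolding R_D_tail(3)
proof (rule integral_mono[OF R_D_tail(1) integrable_square])
  fix y assume "\<eta> < \<alpha>"
  then have "0 \<le> (\<alpha> - \<eta>) / (2 * \<alpha>) * (max 0 (y - \<theta> / (\<alpha> - \<eta>)))\<^sup>2" using \<eta> by simp
  then show "R_D_prim \<theta> \<eta> \<alpha> y \<le> y\<^sup>2" unfolding R_D_prim_def using zero_le_power2[of y] by linarith
qed

text \<open>Both terms of the right-hand side increase in \<alpha>, the one with
  \<open>\<beta>^2\<close> strictly, which gives uniqueness. Existence is the intermediate value
  theorem, with continuity from a Lipschitz bound.\<close>

lemma adjustment_ex1: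
  assumes "0 < l" "0 < \<beta>" "l * \<mu> < c"
  shows "\<exists>!\<alpha>. \<alpha> > \<eta> \<and> adjustment_eq D l \<beta> c \<theta> \<eta> \<mu> \<alpha>"
proof -
  define f where "f \<alpha> = (\<alpha> - \<eta>) * (l * retained_tail \<theta> \<eta> \<alpha> + \<beta>\<^sup>2 / 2)" for \<alpha>
  define C where "C = (LINT y|D. y\<^sup>2)"
  define d where "d = c - l * \<mu>"
  have d: "d > 0" using assms by (simp add: d_def)
  have C: "C \<ge> 0" unfolding C_def by (intro Bochner_Integration.integral_nonneg) auto
  have f_eq: "f \<alpha> = l * ((\<alpha> - \<eta>) * retained_tail \<theta> \<eta> \<alpha>) + \<beta>\<^sup>2 / 2 * (\<alpha> - \<eta>)" for \<alpha> by (simp add: f_def algebra_simps)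
  have strict: "f \<alpha> < f \<alpha>'" if "\<eta> < \<alpha>" "\<alpha> < \<alpha>'" for \<alpha> \<alpha>'
    unfolding f_eq using assms that retained_tail_scaled_mono[of \<alpha> \<alpha>']
    by (intro add_le_less_mono mult_left_mono mult_strict_left_mono) auto
  \<comment> \<open>\<open>retained_tail\<close> decreases, so replacing its value at
    \<open>\<alpha>'\<close> by the one at \<alpha> leaves only the increment of the factor
    \<open>\<alpha> - \<eta>\<close>, weighted by at most \<open>C\<close>.\<close>
  have lip: "f \<alpha>' - f \<alpha> \<le> (l * C + \<beta>\<^sup>2 / 2) * (\<alpha>' - \<alpha>)" if "\<eta> < \<alpha>" "\<alpha> \<le> \<alpha>'" for \<alpha> \<alpha>'
  proof -
    have "(\<alpha>' - \<eta>) * retained_tail \<theta> \<eta> \<alpha>' \<le> (\<alpha>' - \<eta>) * retained_tail \<theta> \<eta> \<alpha>" using that retained_tail_antimono by (intro mult_left_mono) auto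
    then have "(\<alpha>' - \<eta>) * retained_tail \<theta> \<eta> \<alpha>' - (\<alpha> - \<eta>) * retained_tail \<theta> \<eta> \<alpha> \<le> (\<alpha>' - \<alpha>) * retained_tail \<theta> \<eta> \<alpha>" by (simp add: algebra_simps)
    also have "\<dots> \<le> (\<alpha>' - \<alpha>) * C" using that retained_tail_le by (intro mult_left_mono) (auto simp: C_def)
    finally have "l * ((\<alpha>' - \<eta>) * retained_tail \<theta> \<eta> \<alpha>' - (\<alpha> - \<eta>) * retained_tail \<theta> \<eta> \<alpha>) \<le> l * ((\<alpha>' - \<alpha>) * C)"
      using assms by (intro mult_left_mono) auto
    then show ?thesis unfolding f_eq by (simp add: field_simps)
  qed
  define L where "L = l * C + \<beta>\<^sup>2 / 2"
  have L: "L > 0" using assms C by (auto simp: L_def intro!: add_nonneg_pos)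
  \<comment> \<open>\<open>f\<close> lies between
    \<open>(\<alpha> - \<eta>) * (\<beta>^2 / 2)\<close> and \<open>(\<alpha> - \<eta>) * L\<close>;
    solving each linear bound for the value \<open>d\<close> brackets the root.\<close>
  define a where "a = \<eta> + d / L"
  define b where "b = max a (\<eta> + d / (\<beta>\<^sup>2 / 2))"
  have ab: "\<eta> < a" "a \<le> b" using d L by (auto simp: a_def b_def)
  have "f a \<le> d"
  proof -
    have "f a \<le> (a - \<eta>) * L" unfolding f_def L_def
      using ab retained_tail_le[of a] assms by (intro mult_left_mono add_right_mono) (auto simp: C_def)
    then show ?thesis using L by (simp add: a_def)
  qed
  moreover have "d \<le> f b"
  proof -
    have "d = d / (\<beta>\<^sup>2 / 2) * (\<beta>\<^sup>2 / 2)" using assms by simp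
    also have "\<dots> \<le> (b - \<eta>) * (\<beta>\<^sup>2 / 2)" by (intro mult_right_mono) (auto simp: b_def)
    also have "\<dots> \<le> f b" unfolding f_def using ab retained_tail_nonneg[of b] assms by (intro mult_left_mono) auto
    finally show ?thesis .
  qed
  moreover have "continuous_on {a..b} f"
  proof (rule continuous_onI)
    fix x e :: real assume "x \<in> {a..b}" "0 < e"
    have "dist (f y) (f x) \<le> e" if "y \<in> {a..b}" "dist y x < e / L" for y
    proof -
      have "dist (f y) (f x) \<le> L * dist y x"
      proof (cases "x \<le> y")
        case True
        then show ?thesis using lip[of x y] strict[of x y] \<open>x \<in> {a..b}\<close> ab
          by (cases "x = y") (auto simp: dist_real_def L_def)
      next
        case False
        then show ?thesis using lip[of y x] strict[of y x] that ab
          by (auto simp: dist_real_def L_def)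
      qed
      also have "\<dots> \<le> e" using that L by (simp add: field_simps)
      finally show ?thesis .
    qed
    then show "\<exists>d>0. \<forall>y\<in>{a..b}. dist y x < d \<longrightarrow> dist (f y) (f x) \<le> e"
      using \<open>0 < e\<close> L by (intro exI[of _ "e / L"]) auto
  qed
  ultimately obtain \<alpha> where \<alpha>: "a \<le> \<alpha>" "f \<alpha> = d"
    using IVT'[of f a d b] ab by auto
  show ?thesis
  proof (rule ex1I[of _ \<alpha>])
    show "\<alpha> > \<eta> \<and> adjustment_eq D l \<beta> c \<theta> \<eta> \<mu> \<alpha>"
      using \<alpha> ab by (auto simp: adjustment_eq_retained_tail f_def d_def)
    fix \<alpha>' assume "\<alpha>' > \<eta> \<and> adjustment_eq D l \<beta> c \<theta> \<eta> \<mu> \<alpha>'"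
    then have "\<eta> < \<alpha>'" "f \<alpha>' = f \<alpha>" using \<alpha> by (auto simp: adjustment_eq_retained_tail f_def d_def)
    then show "\<alpha>' = \<alpha>" using strict[of \<alpha> \<alpha>'] strict[of \<alpha>' \<alpha>] \<alpha> ab by (cases \<alpha> \<alpha>' rule: linorder_cases) auto
  qed
qed

text \<open>The adjustment equation says that the Hamilton-Jacobi-Bellman maximum vanishes.\<close>

lemma drift_hamiltonian:
  assumes "0 < l" and \<alpha>: "\<eta> < \<alpha>" and adj: "adjustment_eq D l \<beta> c \<theta> \<eta> (LINT y|D. y) \<alpha>"
    and \<kappa>: "\<kappa> = (1 + \<theta>) * l * (LINT y|D. y) + \<eta> / 2 * l * (LINT y|D. y\<^sup>2) - c"
  shows "drift D l \<kappa> \<theta> \<eta> (R_D \<theta> \<eta> \<alpha>) = (\<alpha> - \<eta>) / 2 * ((volatility D l (R_D \<theta> \<eta> \<alpha>))\<^sup>2 + \<beta>\<^sup>2)"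
    and "retention r \<Longrightarrow> drift D l \<kappa> \<theta> \<eta> r \<le> (\<alpha> - \<eta>) / 2 * ((volatility D l r)\<^sup>2 + \<beta>\<^sup>2)"
proof -
  have \<alpha>0: "0 < \<alpha>" using \<alpha> \<eta> by simp
  note ret = retention_R_D[OF \<alpha>0 \<theta> \<eta>]
  let ?v = "\<lambda>r. claim_mean D (\<lambda>y. (\<theta> + \<eta> * y) * r y - \<alpha> / 2 * (r y)\<^sup>2)"
  have "?v (R_D \<theta> \<eta> \<alpha>) = (LINT y|D. (\<theta> + \<eta> * y) * R_D \<theta> \<eta> \<alpha> y - \<alpha> / 2 * (R_D \<theta> \<eta> \<alpha> y)\<^sup>2)"
    unfolding claim_mean_eq by (rule LINT_nonneg_part) measurable
  also have "\<dots> = (LINT y|D. \<theta> * y + \<eta> / 2 * y\<^sup>2 - (\<alpha> - \<eta>) * R_D_prim \<theta> \<eta> \<alpha> y)"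
    unfolding R_D_value[OF \<alpha> \<alpha>0] ..
  also have "\<dots> = \<theta> * (LINT y|D. y) + \<eta> / 2 * (LINT y|D. y\<^sup>2) - (\<alpha> - \<eta>) * retained_tail \<theta> \<eta> \<alpha>"
    using integrable_id integrable_square R_D_tail(1)[OF \<alpha>] by (simp add: R_D_tail(3)[OF \<alpha>])
  finally have "l * ?v (R_D \<theta> \<eta> \<alpha>) = l * (\<theta> * (LINT y|D. y) + \<eta> / 2 * (LINT y|D. y\<^sup>2) - (\<alpha> - \<eta>) * retained_tail \<theta> \<eta> \<alpha>)"
    by simp
  \<comment> \<open>The adjustment equation replaces
    \<open>l * (\<alpha> - \<eta>) * retained_tail\<close> by \<open>c\<close> minus
    \<open>l\<close> times the mean claim minus \<open>(\<alpha> - \<eta>) * \<beta>^2 / 2\<close>;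
    the remaining moments combine to \<kappa>.\<close>
  then have v: "l * ?v (R_D \<theta> \<eta> \<alpha>) = \<kappa> + (\<alpha> - \<eta>) / 2 * \<beta>\<^sup>2"
    using adj unfolding adjustment_eq_retained_tail \<kappa> by (simp add: algebra_simps)
  show "drift D l \<kappa> \<theta> \<eta> (R_D \<theta> \<eta> \<alpha>) = (\<alpha> - \<eta>) / 2 * ((volatility D l (R_D \<theta> \<eta> \<alpha>))\<^sup>2 + \<beta>\<^sup>2)"
    unfolding drift_eq[OF ret \<open>0 < l\<close>, of \<kappa> \<theta> \<eta> \<alpha>] v by (simp add: algebra_simps)
  assume r: "retention r"
  have "?v r \<le> ?v (R_D \<theta> \<eta> \<alpha>)"
    unfolding claim_mean_eq
  proof (rule integral_mono[OF integrable_value[OF r] integrable_value[OF ret]])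
    fix y :: real
    show "indicator {0..} y * ((\<theta> + \<eta> * y) * r y - \<alpha> / 2 * (r y)\<^sup>2)
      \<le> indicator {0..} y * ((\<theta> + \<eta> * y) * R_D \<theta> \<eta> \<alpha> y - \<alpha> / 2 * (R_D \<theta> \<eta> \<alpha> y)\<^sup>2)"
      using R_D_optimal[OF \<alpha>0, of "r y" y \<theta> \<eta>] r by (auto simp: indicator_def retention_def)
  qed
  then have "l * ?v r \<le> \<kappa> + (\<alpha> - \<eta>) / 2 * \<beta>\<^sup>2" unfolding v[symmetric] using \<open>0 < l\<close> by (intro mult_left_mono) auto
  then show "drift D l \<kappa> \<theta> \<eta> r \<le> (\<alpha> - \<eta>) / 2 * ((volatility D l r)\<^sup>2 + \<beta>\<^sup>2)"
    unfolding drift_eq[OF r \<open>0 < l\<close>, of \<kappa> \<theta> \<eta> \<alpha>] by (simp add: algebra_simps)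
qed

end

end

section \<open>Increments of the Brownian pair\<close>

definition gaussian :: "real \<Rightarrow> real measure" where
  "gaussian v = density lborel (normal_density 0 (sqrt v))"

lemma sets_gaussian [measurable_cong, simp]: "sets (gaussian v) = sets borel"
  by (simp add: gaussian_def)

lemma space_gaussian [simp]: "space (gaussian v) = UNIV"
  by (simp add: gaussian_def)

lemma prob_space_gaussian: "v > 0 \<Longrightarrow> prob_space (gaussian v)"
  unfolding gaussian_def by (rule prob_space_normal_density) simp

text \<open>Exponential tilting: completing the square turns the weighted density into the normal
  density with mean \<open>q * v\<close> and the same variance, which has mass 1.\<close>

lemma nn_integral_gaussian_exp:
  assumes "v > 0"
  shows "(\<integral>\<^sup>+ b. ennreal (exp (q * b - q\<^sup>2 / 2 * v)) \<partial>gaussian v) = 1"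
proof -
  have *: "normal_density 0 (sqrt v) b * exp (q * b - q\<^sup>2 / 2 * v) = normal_density (q * v) (sqrt v) b" for b
  proof -
    have "- (b - 0)\<^sup>2 / (2 * (sqrt v)\<^sup>2) + (q * b - q\<^sup>2 / 2 * v) = - (b - q * v)\<^sup>2 / (2 * (sqrt v)\<^sup>2)"
      using assms by (simp add: field_simps power2_eq_square)
    then show ?thesis
      by (simp add: normal_density_def exp_add[symmetric])
  qed
  have "(\<integral>\<^sup>+ b. ennreal (exp (q * b - q\<^sup>2 / 2 * v)) \<partial>gaussian v)
      = (\<integral>\<^sup>+ b. ennreal (normal_density (q * v) (sqrt v) b) \<partial>lborel)"
    unfolding gaussian_def
    by (subst nn_integral_density) (auto simp: ennreal_mult[symmetric] * simp del: times_divide_eq_left)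
  also have "\<dots> = 1"
    using prob_space.emeasure_space_1[OF prob_space_normal_density[of "sqrt v" "q * v"]] assms
    by (simp add: emeasure_density)
  finally show ?thesis .
qed

text \<open>The cross term drops out with the first moment; this is one step of the Ito
  isometry.\<close>

lemma nn_integral_gaussian_square:
  assumes "v > 0"
  shows "(\<integral>\<^sup>+ b. ennreal ((m + z * b)\<^sup>2) \<partial>gaussian v) = ennreal (m\<^sup>2 + z\<^sup>2 * v)"
proof -
  have s: "sqrt v > 0" using assms by simp
  have 0: "has_bochner_integral lborel (\<lambda>x. normal_density 0 (sqrt v) x) 1"
    using normal_moment_even[OF s, of 0 0] by simp
  have 1: "has_bochner_integral lborel (\<lambda>x. normal_density 0 (sqrt v) x * x) 0"
    using normal_moment_nz_1[OF s, of 0] .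
  have 2: "has_bochner_integral lborel (\<lambda>x. normal_density 0 (sqrt v) x * x\<^sup>2) v"
    using normal_moment_even[OF s, of 0 1] assms by (simp add: fact_numeral)
  have "has_bochner_integral lborel
     (\<lambda>x. m\<^sup>2 * normal_density 0 (sqrt v) x + (2 * m * z) * (normal_density 0 (sqrt v) x * x)
        + z\<^sup>2 * (normal_density 0 (sqrt v) x * x\<^sup>2)) (m\<^sup>2 * 1 + (2 * m * z) * 0 + z\<^sup>2 * v)"
    by (intro has_bochner_integral_add has_bochner_integral_mult_right 0 1 2)
  then have "has_bochner_integral lborel (\<lambda>x. normal_density 0 (sqrt v) x * (m + z * x)\<^sup>2) (m\<^sup>2 + z\<^sup>2 * v)"
    by (simp add: algebra_simps power2_eq_square)
  then have "(\<integral>\<^sup>+ b. ennreal (normal_density 0 (sqrt v) b * (m + z * b)\<^sup>2) \<partial>lborel) = ennreal (m\<^sup>2 + z\<^sup>2 * v)"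
    by (subst nn_integral_eq_integral) (auto simp: has_bochner_integral_iff)
  then show ?thesis
    unfolding gaussian_def by (subst nn_integral_density) (auto simp: ennreal_mult[symmetric])
qed

lemma measurable_mono_sigma:
  assumes "f \<in> measurable A C" "sets A \<subseteq> sets B" "space A = space B"
  shows "f \<in> measurable B C"
  using assms measurable_mono[of C C A B] by blast

locale two_BMs = prob_space M for M :: "'a measure" +
  fixes F :: "real \<Rightarrow> 'a measure" and B W :: "real \<Rightarrow> 'a \<Rightarrow> real"
  assumes filt: "filtered_space M F" and bms: "independent_BMs M F B W"
begin

lemma space_F: "t \<ge> 0 \<Longrightarrow> space (F t) = space M"
  using filt by (auto simp: filtered_space_def subalgebra_def)

lemma sets_F: "t \<ge> 0 \<Longrightarrow> sets (F t) \<subseteq> sets M"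
  using filt by (auto simp: filtered_space_def subalgebra_def)

lemma sets_F_mono: "0 \<le> s \<Longrightarrow> s \<le> t \<Longrightarrow> sets (F s) \<subseteq> sets (F t)"
  using filt by (auto simp: filtered_space_def)

lemma measurable_F_M: "t \<ge> 0 \<Longrightarrow> f \<in> measurable (F t) C \<Longrightarrow> f \<in> measurable M C"
  by (rule measurable_mono_sigma[of f "F t" C M]) (auto simp: space_F sets_F)

lemma measurable_F_mono: "0 \<le> s \<Longrightarrow> s \<le> t \<Longrightarrow> f \<in> measurable (F s) C \<Longrightarrow> f \<in> measurable (F t) C"
  by (rule measurable_mono_sigma[of f "F s" C "F t"]) (auto simp: space_F sets_F_mono)

lemma measurable_B: "t \<ge> 0 \<Longrightarrow> B t \<in> borel_measurable (F t)"
  and measurable_W: "t \<ge> 0 \<Longrightarrow> W t \<in> borel_measurable (F t)"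
  using bms by (auto simp: independent_BMs_def standard_BM_def)

lemma measurable_B_M: "t \<ge> 0 \<Longrightarrow> B t \<in> borel_measurable M"
  and measurable_W_M: "t \<ge> 0 \<Longrightarrow> W t \<in> borel_measurable M"
  using measurable_B measurable_W measurable_F_M by blast+

lemma AE_B: "AE \<omega> in M. B 0 \<omega> = 0 \<and> continuous_on {0..} (\<lambda>t. B t \<omega>)"
  and AE_W: "AE \<omega> in M. W 0 \<omega> = 0 \<and> continuous_on {0..} (\<lambda>t. W t \<omega>)"
  using bms by (auto simp: independent_BMs_def standard_BM_def)

text \<open>An increment is a measurable functional on path space, so independence of the two
  processes passes to their increments and the joint law is the product of the marginals.\<close>

lemma distr_increment_pair:
  assumes "0 \<le> s" "s < t"
  shows "distr M (borel \<Otimes>\<^sub>M borel) (\<lambda>\<omega>. (B t \<omega> - B s \<omega>, W t \<omega> - W s \<omega>)) = gaussian (t - s) \<Otimes>\<^sub>M gaussian (t - s)"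
proof -
  have ev: "(\<lambda>f. f t - f s) \<in> borel_measurable (PiM {0..} (\<lambda>_. borel :: real measure))"
    using assms by (intro borel_measurable_diff measurable_component_singleton) auto
  have "indep_var borel ((\<lambda>f. f t - f s) \<circ> (\<lambda>\<omega>. \<lambda>t\<in>{0..}. B t \<omega>)) borel ((\<lambda>f. f t - f s) \<circ> (\<lambda>\<omega>. \<lambda>t\<in>{0..}. W t \<omega>))"
    using bms by (intro indep_var_compose[OF _ ev ev]) (auto simp: independent_BMs_def)
  then have "indep_var borel (\<lambda>\<omega>. B t \<omega> - B s \<omega>) borel (\<lambda>\<omega>. W t \<omega> - W s \<omega>)"
    using assms by (simp add: comp_def)
  moreover have "distr M borel (\<lambda>\<omega>. B t \<omega> - B s \<omega>) = gaussian (t - s)"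
      "distr M borel (\<lambda>\<omega>. W t \<omega> - W s \<omega>) = gaussian (t - s)"
    using bms assms unfolding independent_BMs_def standard_BM_def distributed_def gaussian_def
    by (auto cong: distr_cong)
  ultimately show ?thesis
    unfolding indep_var_distribution_eq by metis
qed

text \<open>The joint law of the past and of the increments is a product, so the increments may be
  integrated out first.\<close>

lemma nn_integral_increments:
  assumes "0 \<le> s" "s < t" and h: "h \<in> borel_measurable (F s \<Otimes>\<^sub>M (borel \<Otimes>\<^sub>M borel))"
  shows "(\<integral>\<^sup>+ \<omega>. h (\<omega>, (B t \<omega> - B s \<omega>, W t \<omega> - W s \<omega>)) \<partial>M)
       = (\<integral>\<^sup>+ \<omega>. (\<integral>\<^sup>+ b. \<integral>\<^sup>+ w. h (\<omega>, (b, w)) \<partial>gaussian (t - s) \<partial>gaussian (t - s)) \<partial>M)"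
proof -
  let ?Z = "\<lambda>\<omega>. (B t \<omega> - B s \<omega>, W t \<omega> - W s \<omega>)"
  have [measurable]: "B t \<in> borel_measurable M" "B s \<in> borel_measurable M"
     "W t \<in> borel_measurable M" "W s \<in> borel_measurable M"
    using assms by (auto intro!: measurable_B_M measurable_W_M)
  \<comment> \<open>The identity seen as a map into the coarser sigma-algebra; its image measure is
    \<open>M\<close> restricted to \<open>F s\<close>.\<close>
  have id: "(\<lambda>\<omega>. \<omega>) \<in> measurable M (F s)"
    using assms by (intro measurableI) (auto simp: space_F dest: sets.sets_into_space intro: sets_F[THEN subsetD])
  have Z: "?Z \<in> measurable M (borel \<Otimes>\<^sub>M borel)" by measurable
  have d: "distr M (F s) (\<lambda>\<omega>. \<omega>) \<Otimes>\<^sub>M distr M (borel \<Otimes>\<^sub>M borel) ?Z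
      = distr M (F s \<Otimes>\<^sub>M (borel \<Otimes>\<^sub>M borel)) (\<lambda>\<omega>. (\<omega>, ?Z \<omega>))"
  \<comment> \<open>On a rectangle \<open>A \<times> C\<close> the claimed equality is exactly the
    independence of \<open>F s\<close> from the pair of increments.\<close>
  proof (rule pair_measure_eqI)
    show "sigma_finite_measure (distr M (F s) (\<lambda>\<omega>. \<omega>))" "sigma_finite_measure (distr M (borel \<Otimes>\<^sub>M borel) ?Z)"
      using prob_space_distr[OF id] prob_space_distr[OF Z] by (auto simp: prob_space_imp_sigma_finite)
    show "sets (distr M (F s) (\<lambda>\<omega>. \<omega>) \<Otimes>\<^sub>M distr M (borel \<Otimes>\<^sub>M borel) ?Z)
        = sets (distr M (F s \<Otimes>\<^sub>M (borel \<Otimes>\<^sub>M borel)) (\<lambda>\<omega>. (\<omega>, ?Z \<omega>)))"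
      unfolding sets_distr by (intro sets_pair_measure_cong) auto
    fix A C assume A: "A \<in> sets (distr M (F s) (\<lambda>\<omega>. \<omega>))" and C: "C \<in> sets (distr M (borel \<Otimes>\<^sub>M borel) ?Z)"
    have A': "A \<in> sets (F s)" "A \<inter> space M = A" and C': "C \<in> sets (borel \<Otimes>\<^sub>M borel)"
      using A C sets.sets_into_space[of A "F s"] assms by (auto simp: space_F)
    have "?Z -` C \<inter> space M \<in> sets (vimage_algebra (space M) ?Z (borel :: (real \<times> real) measure))"
      using C' unfolding borel_prod by (rule in_vimage_algebra)
    moreover have "indep_set (sets (F s)) (sets (vimage_algebra (space M) ?Z (borel :: (real \<times> real) measure)))"
      using bms assms by (auto simp: independent_BMs_def)
    ultimately have "prob (A \<inter> (?Z -` C \<inter> space M)) = prob A * prob (?Z -` C \<inter> space M)"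
      using A' by (intro indep_setD)
    moreover have "(\<lambda>\<omega>. (\<omega>, ?Z \<omega>)) -` (A \<times> C) \<inter> space M = A \<inter> (?Z -` C \<inter> space M)"
      using A' by auto
    ultimately show "emeasure (distr M (F s) (\<lambda>\<omega>. \<omega>)) A * emeasure (distr M (borel \<Otimes>\<^sub>M borel) ?Z) C
        = emeasure (distr M (F s \<Otimes>\<^sub>M (borel \<Otimes>\<^sub>M borel)) (\<lambda>\<omega>. (\<omega>, ?Z \<omega>))) (A \<times> C)"
      using A' C' id Z by (subst (1 2 3) emeasure_distr)
        (auto simp: emeasure_eq_measure ennreal_mult[symmetric] intro!: measurable_Pair)
  qed
  interpret G: prob_space "gaussian (t - s)" using assms by (intro prob_space_gaussian) simp
  interpret GG: pair_prob_space "gaussian (t - s)" "gaussian (t - s)" ..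
  have dd: "distr M (borel \<Otimes>\<^sub>M borel) ?Z = gaussian (t - s) \<Otimes>\<^sub>M gaussian (t - s)"
    by (rule distr_increment_pair) fact+
  have sg: "sets (gaussian (t - s) \<Otimes>\<^sub>M gaussian (t - s)) = sets (borel \<Otimes>\<^sub>M borel)"
    by (intro sets_pair_measure_cong) auto
  have h': "h \<in> borel_measurable (F s \<Otimes>\<^sub>M (gaussian (t - s) \<Otimes>\<^sub>M gaussian (t - s)))"
    using h by (subst measurable_cong_sets[OF sets_pair_measure_cong[OF refl sg] refl])
  have h'': "h \<in> borel_measurable (distr M (F s) (\<lambda>\<omega>. \<omega>) \<Otimes>\<^sub>M (gaussian (t - s) \<Otimes>\<^sub>M gaussian (t - s)))"
    using h by (subst measurable_cong_sets[OF sets_pair_measure_cong[OF _ sg] refl]) auto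
  have "(\<integral>\<^sup>+ \<omega>. h (\<omega>, ?Z \<omega>) \<partial>M) = (\<integral>\<^sup>+ x. h x \<partial>distr M (F s \<Otimes>\<^sub>M (borel \<Otimes>\<^sub>M borel)) (\<lambda>\<omega>. (\<omega>, ?Z \<omega>)))"
    by (rule nn_integral_distr[symmetric]) (use id Z h in \<open>auto intro: measurable_Pair\<close>)
  also have "\<dots> = (\<integral>\<^sup>+ x. h x \<partial>(distr M (F s) (\<lambda>\<omega>. \<omega>) \<Otimes>\<^sub>M (gaussian (t - s) \<Otimes>\<^sub>M gaussian (t - s))))"
    unfolding d[symmetric] dd ..
  also have "\<dots> = (\<integral>\<^sup>+ \<omega>. \<integral>\<^sup>+ z. h (\<omega>, z) \<partial>(gaussian (t - s) \<Otimes>\<^sub>M gaussian (t - s)) \<partial>distr M (F s) (\<lambda>\<omega>. \<omega>))"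
    by (rule GG.P.nn_integral_fst[symmetric, OF h''])
  also have "\<dots> = (\<integral>\<^sup>+ \<omega>. \<integral>\<^sup>+ z. h (\<omega>, z) \<partial>(gaussian (t - s) \<Otimes>\<^sub>M gaussian (t - s)) \<partial>M)"
    by (rule nn_integral_distr[OF id]) (use h'' in \<open>measurable\<close>)
  also have "\<dots> = (\<integral>\<^sup>+ \<omega>. (\<integral>\<^sup>+ b. \<integral>\<^sup>+ w. h (\<omega>, (b, w)) \<partial>gaussian (t - s) \<partial>gaussian (t - s)) \<partial>M)"
  proof (rule nn_integral_cong)
    fix \<omega> assume "\<omega> \<in> space M"
    then have "\<omega> \<in> space (F s)" using assms by (simp add: space_F)
    then have "(\<lambda>z. h (\<omega>, z)) \<in> borel_measurable (gaussian (t - s) \<Otimes>\<^sub>M gaussian (t - s))"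
      using h' by (auto intro: measurable_compose[OF measurable_Pair1'])
    from G.nn_integral_fst[OF this] show "(\<integral>\<^sup>+ z. h (\<omega>, z) \<partial>(gaussian (t - s) \<Otimes>\<^sub>M gaussian (t - s)))
      = (\<integral>\<^sup>+ b. \<integral>\<^sup>+ w. h (\<omega>, (b, w)) \<partial>gaussian (t - s) \<partial>gaussian (t - s))"
      by simp
  qed
  finally show ?thesis .
qed

end

section \<open>Simple integrands\<close>

lemma partition_le:
  fixes \<tau> :: "nat \<Rightarrow> real"
  assumes mono: "\<And>i. i < n \<Longrightarrow> \<tau> i \<le> \<tau> (Suc i)" and "i \<le> k" "k \<le> n"
  shows "\<tau> i \<le> \<tau> k"
  using assms(2,3) by (induction rule: dec_induct) (use mono in \<open>auto intro: order_trans\<close>)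

text \<open>Between two times of cell \<open>j\<close> only the summand of that cell moves: earlier
  cells are complete at both times, and in later cells both arguments of \<open>G\<close> coincide,
  so their increments are 0.\<close>

lemma simple_integral_cell:
  assumes mono: "\<And>i. i < n \<Longrightarrow> \<tau> i \<le> \<tau> (Suc i)" and "j < n" "\<tau> j \<le> u" "u \<le> v" "v \<le> \<tau> (Suc j)"
  shows "simple_integral (n, \<tau>, \<xi>) G v \<omega> = simple_integral (n, \<tau>, \<xi>) G u \<omega> + \<xi> j \<omega> * (G v \<omega> - G u \<omega>)"
proof -
  note le = partition_le[of n \<tau>, OF mono]
  have "simple_integral (n, \<tau>, \<xi>) G v \<omega> - simple_integral (n, \<tau>, \<xi>) G u \<omega>
    = (\<Sum>i<n. \<xi> i \<omega> * (G (min v (\<tau> (Suc i))) \<omega> - G (min v (\<tau> i)) \<omega>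
         - (G (min u (\<tau> (Suc i))) \<omega> - G (min u (\<tau> i)) \<omega>)))"
    by (simp add: simple_integral_def sum_subtractf[symmetric] right_diff_distrib)
  also have "\<dots> = (\<Sum>i<n. if i = j then \<xi> j \<omega> * (G v \<omega> - G u \<omega>) else 0)"
  proof (intro sum.cong refl)
    fix i assume "i \<in> {..<n}"
    then have i: "i < n" by simp
    consider "i = j" | "i < j" | "j < i" by linarith
    then show "\<xi> i \<omega> * (G (min v (\<tau> (Suc i))) \<omega> - G (min v (\<tau> i)) \<omega>
         - (G (min u (\<tau> (Suc i))) \<omega> - G (min u (\<tau> i)) \<omega>)) = (if i = j then \<xi> j \<omega> * (G v \<omega> - G u \<omega>) else 0)"
    proof cases
      case 1
      have "min v (\<tau> (Suc j)) = v" "min u (\<tau> (Suc j)) = u" "min v (\<tau> j) = \<tau> j" "min u (\<tau> j) = \<tau> j"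
        using assms by auto
      then show ?thesis using 1 by simp
    next
      case 2
      then have "\<tau> (Suc i) \<le> u" "\<tau> i \<le> u" using le[of "Suc i" j] le[of i j] assms by auto
      then have "min v (\<tau> (Suc i)) = \<tau> (Suc i)" "min u (\<tau> (Suc i)) = \<tau> (Suc i)" "min v (\<tau> i) = \<tau> i" "min u (\<tau> i) = \<tau> i"
        using \<open>u \<le> v\<close> by auto
      then show ?thesis using 2 by simp
    next
      case 3
      then have "v \<le> \<tau> i" "v \<le> \<tau> (Suc i)" using le[of "Suc j" i] mono[OF i] i assms by (auto intro: order_trans)
      then have "min v (\<tau> (Suc i)) = v" "min u (\<tau> (Suc i)) = u" "min v (\<tau> i) = v" "min u (\<tau> i) = u"
        using \<open>u \<le> v\<close> by auto
      then show ?thesis using 3 by simp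
    qed
  qed
  also have "\<dots> = \<xi> j \<omega> * (G v \<omega> - G u \<omega>)" using assms by simp
  finally show ?thesis by simp
qed

lemma simple_integral_outside:
  assumes mono: "\<And>i. i < n \<Longrightarrow> \<tau> i \<le> \<tau> (Suc i)" and "u \<le> v" and out: "v \<le> \<tau> 0 \<or> \<tau> n \<le> u"
  shows "simple_integral (n, \<tau>, \<xi>) G v \<omega> = simple_integral (n, \<tau>, \<xi>) G u \<omega>"
proof -
  note le = partition_le[of n \<tau>, OF mono]
  show ?thesis
    unfolding simple_integral_def split
  proof (intro sum.cong refl)
    fix i assume "i \<in> {..<n}"
    then have "\<tau> 0 \<le> \<tau> i" "\<tau> i \<le> \<tau> (Suc i)" "\<tau> (Suc i) \<le> \<tau> n" using le by auto
    then have "min v (\<tau> i) = v \<and> min v (\<tau> (Suc i)) = v \<and> min u (\<tau> i) = u \<and> min u (\<tau> (Suc i)) = u \<or>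
        min v (\<tau> i) = \<tau> i \<and> min v (\<tau> (Suc i)) = \<tau> (Suc i) \<and> min u (\<tau> i) = \<tau> i \<and> min u (\<tau> (Suc i)) = \<tau> (Suc i)"
      using out \<open>u \<le> v\<close> by linarith
    then show "\<xi> i \<omega> * (G (min v (\<tau> (Suc i))) \<omega> - G (min v (\<tau> i)) \<omega>)
        = \<xi> i \<omega> * (G (min u (\<tau> (Suc i))) \<omega> - G (min u (\<tau> i)) \<omega>)"
      by auto
  qed
qed

text \<open>One operation serves squaring, clipping and the clipping error. The partition is kept,
  so all of these can be compared cell by cell.\<close>

definition map_integrand :: "(real \<Rightarrow> real) \<Rightarrow> 'a simple_integrand \<Rightarrow> 'a simple_integrand" where
  "map_integrand \<phi> = (\<lambda>(n, \<tau>, \<xi>). (n, \<tau>, \<lambda>i \<omega>. \<phi> (\<xi> i \<omega>)))"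

text \<open>The cells are disjoint, so at most one summand is nonzero and \<phi> acts on it alone;
  \<open>\<phi> 0 = 0\<close> covers the times outside all cells.\<close>

lemma simple_value_map:
  assumes "simple_integrand F S" "\<phi> 0 = 0"
  shows "simple_value (map_integrand \<phi> S) t \<omega> = \<phi> (simple_value S t \<omega>)"
proof -
  obtain n \<tau> \<xi> where S: "S = (n, \<tau>, \<xi>)" by (cases S)
  have mono: "\<And>i. i < n \<Longrightarrow> \<tau> i \<le> \<tau> (Suc i)" using assms by (auto simp: S simple_integrand_def)
  note le = partition_le[of n \<tau>, OF mono]
  show ?thesis
  proof (cases "\<exists>j<n. t \<in> {\<tau> j<..\<tau> (Suc j)}")
    case True
    then obtain j where j: "j < n" "t \<in> {\<tau> j<..\<tau> (Suc j)}" by blast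
    have ind: "indicator {\<tau> i<..\<tau> (Suc i)} t = (if i = j then 1 else 0 :: real)" if "i < n" for i
    proof -
      consider "i = j" | "i < j" | "j < i" by linarith
      then show ?thesis
        by cases (use j that le[of "Suc i" j] le[of "Suc j" i] in auto)
    qed
    have "(\<Sum>i<n. x i * indicator {\<tau> i<..\<tau> (Suc i)} t) = x j" for x :: "nat \<Rightarrow> real"
    proof -
      have "(\<Sum>i<n. x i * indicator {\<tau> i<..\<tau> (Suc i)} t) = (\<Sum>i<n. if i = j then x j else 0)"
        by (intro sum.cong) (auto simp: ind)
      then show ?thesis using j by simp
    qed
    then show ?thesis by (simp add: simple_value_def S map_integrand_def)
  next
    case False
    then have "(\<Sum>i<n. x i * indicator {\<tau> i<..\<tau> (Suc i)} t) = 0" for x :: "nat \<Rightarrow> real"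
      by (intro sum.neutral) auto
    then show ?thesis using assms by (simp add: simple_value_def S map_integrand_def)
  qed
qed

section \<open>Martingale property and isometry for simple integrands\<close>

context two_BMs
begin

abbreviation event_integral :: "('a \<Rightarrow> ennreal) \<Rightarrow> 'a set \<Rightarrow> ennreal" where
  "event_integral f A \<equiv> (\<integral>\<^sup>+ \<omega>. f \<omega> * indicator A \<omega> \<partial>M)"

abbreviation integrand_error :: "(real \<Rightarrow> 'a \<Rightarrow> real) \<Rightarrow> 'a simple_integrand \<Rightarrow> real \<Rightarrow> ennreal" where
  "integrand_error H S T \<equiv>
    (\<integral>\<^sup>+ \<omega>. (\<integral>\<^sup>+ s\<in>{0..T}. ennreal ((simple_value S s \<omega> - H s \<omega>)\<^sup>2) \<partial>lborel) \<partial>M)"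

abbreviation integral_error :: "(real \<Rightarrow> 'a \<Rightarrow> real) \<Rightarrow> 'a simple_integrand \<Rightarrow> real \<Rightarrow> ennreal" where
  "integral_error I S t \<equiv> (\<integral>\<^sup>+ \<omega>. ennreal ((simple_integral S B t \<omega> - I t \<omega>)\<^sup>2) \<partial>M)"

lemma simple_integrand_map:
  assumes "simple_integrand F S" and "\<phi> \<in> borel_measurable borel"
    and bd: "\<And>K. \<exists>L. \<forall>x. \<bar>x\<bar> \<le> K \<longrightarrow> \<bar>\<phi> x\<bar> \<le> L"
  shows "simple_integrand F (map_integrand \<phi> S)"
proof -
  obtain n \<tau> \<xi> where S: "S = (n, \<tau>, \<xi>)" by (cases S)
  have "\<exists>L. \<forall>\<omega>\<in>space (F (\<tau> i)). \<bar>\<phi> (\<xi> i \<omega>)\<bar> \<le> L" if "i < n" for i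
  proof -
    have "\<exists>K. \<forall>\<omega>\<in>space (F (\<tau> i)). \<bar>\<xi> i \<omega>\<bar> \<le> K"
      using assms(1) that by (simp add: S simple_integrand_def)
    then obtain K where "\<forall>\<omega>\<in>space (F (\<tau> i)). \<bar>\<xi> i \<omega>\<bar> \<le> K" ..
    then show ?thesis using bd[of K] by blast
  qed
  then show ?thesis using assms
    by (auto simp: S map_integrand_def simple_integrand_def intro: measurable_compose[OF _ assms(2)])
qed

text \<open>Cutting at the breakpoints reduces a relation between two times to intervals inside one
  cell or outside the partition. The increment rule in \<open>step\<close> covers all \<phi> and
  \<open>G\<close> at once, so that the stochastic integral and its clock move with the same
  \<zeta>; outside the partition \<zeta> is 0, which explains the condition
  \<open>\<phi> 0 = 0\<close>.\<close>

lemma simple_integrand_induct: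
  assumes S: "simple_integrand F S" and uv: "0 \<le> u" "u \<le> v"
    and refl: "\<And>u. 0 \<le> u \<Longrightarrow> P u u"
    and trans: "\<And>u v w. 0 \<le> u \<Longrightarrow> u \<le> v \<Longrightarrow> v \<le> w \<Longrightarrow> P u v \<Longrightarrow> P v w \<Longrightarrow> P u w"
    and step: "\<And>u v \<zeta>. 0 \<le> u \<Longrightarrow> u < v \<Longrightarrow> \<zeta> \<in> borel_measurable (F u) \<Longrightarrow>
       (\<And>\<phi> G \<omega>. \<phi> 0 = 0 \<Longrightarrow> simple_integral (map_integrand \<phi> S) G v \<omega>
          = simple_integral (map_integrand \<phi> S) G u \<omega> + \<phi> (\<zeta> \<omega>) * (G v \<omega> - G u \<omega>)) \<Longrightarrow> P u v"
  shows "P u v"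
proof -
  obtain n \<tau> \<xi> where S': "S = (n, \<tau>, \<xi>)" by (cases S)
  have mono: "\<And>i. i < n \<Longrightarrow> \<tau> i \<le> \<tau> (Suc i)" and \<tau>0: "0 \<le> \<tau> 0"
    and meas: "\<And>i. i < n \<Longrightarrow> \<xi> i \<in> borel_measurable (F (\<tau> i))"
    using S by (auto simp: S' simple_integrand_def)
  note le = partition_le[of n \<tau>, OF mono]
  have out: "P a b" if "0 \<le> a" "a \<le> b" "b \<le> \<tau> 0 \<or> \<tau> n \<le> a" for a b
  proof (cases "a = b")
    case False
    then show ?thesis
      using that simple_integral_outside[of n \<tau> a b, OF mono]
      by (intro step[of a b "\<lambda>_. 0"]) (auto simp: S' map_integrand_def)
  qed (use that refl in auto)
  have cell: "P a b" if "0 \<le> a" "a \<le> b" "j < n" "\<tau> j \<le> a" "b \<le> \<tau> (Suc j)" for a b j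
  proof (cases "a = b")
    case False
    then show ?thesis
      using that simple_integral_cell[of n \<tau> j a b, OF mono] le[of 0 j] \<tau>0
        measurable_F_mono[of "\<tau> j" a, OF _ _ meas[of j]]
      by (intro step[of a b "\<xi> j"]) (auto simp: S' map_integrand_def)
  qed (use that refl in auto)
  \<comment> \<open>Breakpoints pushed into the interval from \<open>u\<close> to \<open>v\<close>:
    consecutive points either coincide or lie in a common cell.\<close>
  define p where "p i = max u (min v (\<tau> i))" for i
  have p0: "0 \<le> p i" "u \<le> p i" "p i \<le> v" for i using uv by (auto simp: p_def)
  have 0: "P u (p 0)"
    using uv p0[of 0] by (cases "p 0 = u") (auto intro!: out refl simp: p_def max_def min_def)
  have "P u (p i)" if "i \<le> n" for i
    using that
  proof (induction i)
    case (Suc i)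
    have pp: "p i \<le> p (Suc i)" using mono[of i] Suc.prems by (auto simp: p_def max_def min_def)
    have "P (p i) (p (Suc i))"
    proof (cases "p i = p (Suc i)")
      case False
      then have "\<tau> i \<le> p i" "p (Suc i) \<le> \<tau> (Suc i)"
        using mono[of i] Suc.prems by (auto simp: p_def max_def min_def split: if_splits)
      then show ?thesis using cell[of "p i" "p (Suc i)" i] Suc.prems pp p0[of i] by auto
    qed (use refl[OF p0(1)[of i]] in simp)
    then show ?case using Suc pp p0 uv by (intro trans[of u "p i" "p (Suc i)"]) auto
  qed (use 0 in simp)
  then have "P u (p n)" by simp
  moreover have "P (p n) v"
    using uv p0[of n] by (cases "p n = v") (auto intro!: out refl simp: p_def max_def min_def split: if_splits)
  ultimately show ?thesis using trans[of u "p n" v] p0 uv by auto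
qed

lemma simple_integral_adapted:
  assumes S: "simple_integrand F S" and G: "\<And>t. 0 \<le> t \<Longrightarrow> G t \<in> borel_measurable (F t)" and "0 \<le> u"
  shows "simple_integral S G u \<in> borel_measurable (F u)"
proof -
  obtain n \<tau> \<xi> where S': "S = (n, \<tau>, \<xi>)" by (cases S)
  have mono: "\<And>i. i < n \<Longrightarrow> \<tau> i \<le> \<tau> (Suc i)" and \<tau>0: "0 \<le> \<tau> 0"
    and meas: "\<And>i. i < n \<Longrightarrow> \<xi> i \<in> borel_measurable (F (\<tau> i))"
    using S by (auto simp: S' simple_integrand_def)
  have pos: "0 \<le> \<tau> i" if "i \<le> n" for i
    using partition_le[of n \<tau> 0 i, OF mono] \<tau>0 that by auto
  have "(\<lambda>\<omega>. \<xi> i \<omega> * (G (min u (\<tau> (Suc i))) \<omega> - G (min u (\<tau> i)) \<omega>)) \<in> borel_measurable (F u)" if i: "i < n" for i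
  proof (cases "\<tau> i \<le> u")
    case True
    have "\<xi> i \<in> borel_measurable (F u)"
      using measurable_F_mono[OF _ True meas[OF i]] pos i by auto
    moreover have "G (min u (\<tau> (Suc i))) \<in> borel_measurable (F u)" "G (min u (\<tau> i)) \<in> borel_measurable (F u)"
      using pos[of i] pos[of "Suc i"] i \<open>0 \<le> u\<close> by (auto intro!: measurable_F_mono[OF _ _ G])
    ultimately show ?thesis by measurable
  next
    case False
    \<comment> \<open>A cell starting after \<open>u\<close> has a zero increment, so its
      coefficient, which is measurable only at a later time, drops out.\<close>
    then have "min u (\<tau> (Suc i)) = u" "min u (\<tau> i) = u" using mono[OF i] by auto
    then show ?thesis by simp
  qed
  then have "(\<lambda>\<omega>. \<Sum>i<n. \<xi> i \<omega> * (G (min u (\<tau> (Suc i))) \<omega> - G (min u (\<tau> i)) \<omega>)) \<in> borel_measurable (F u)"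
    by (intro borel_measurable_sum) auto
  then show ?thesis by (simp add: S' simple_integral_def)
qed

text \<open>The quadratic variation, expressed as the simple integral of the squared integrand
  against time, so that its increments come from the same induction step as those of the
  integral.\<close>

definition clock :: "'a simple_integrand \<Rightarrow> real \<Rightarrow> 'a \<Rightarrow> real" where
  "clock S = simple_integral (map_integrand power2 S) (\<lambda>t _. t)"

text \<open>The stochastic exponential of \<open>- p\<close> times the simple integral plus
  \<open>\<beta> * W\<close>. The parameter \<open>p\<close> stays free because the second-moment
  bound for \<open>p\<close> uses the exponential for \<open>2 * p\<close>.\<close>

definition exp_simple :: "real \<Rightarrow> real \<Rightarrow> 'a simple_integrand \<Rightarrow> real \<Rightarrow> 'a \<Rightarrow> real" where
  "exp_simple p \<beta> S t \<omega> = exp (- p * (simple_integral S B t \<omega> + \<beta> * W t \<omega>)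
      - p\<^sup>2 / 2 * (clock S t \<omega> + \<beta>\<^sup>2 * t))"

lemma simple_integrand_power2: "simple_integrand F S \<Longrightarrow> simple_integrand F (map_integrand power2 S)"
proof (rule simple_integrand_map)
  show "\<exists>L. \<forall>x::real. \<bar>x\<bar> \<le> K \<longrightarrow> \<bar>x\<^sup>2\<bar> \<le> L" for K
    by (rule exI[of _ "K\<^sup>2"]) (auto simp: abs_le_square_iff[symmetric])
qed auto

lemma map_integrand_id: "map_integrand (\<lambda>x. x) S = S"
  by (cases S) (simp add: map_integrand_def)

lemma clock_adapted: "simple_integrand F S \<Longrightarrow> 0 \<le> u \<Longrightarrow> clock S u \<in> borel_measurable (F u)"
  unfolding clock_def by (intro simple_integral_adapted simple_integrand_power2) auto

lemma exp_simple_adapted: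
  assumes "simple_integrand F S" "0 \<le> u"
  shows "exp_simple p \<beta> S u \<in> borel_measurable (F u)"
proof -
  note [measurable] = simple_integral_adapted[OF assms(1) measurable_B assms(2)]
    clock_adapted[OF assms] measurable_W[OF assms(2)]
  show ?thesis unfolding exp_simple_def[abs_def] by measurable
qed

text \<open>Within a cell the integrand is a frozen \<open>F u\<close>-measurable \<zeta>, so the
  ratio of the values at \<open>v\<close> and \<open>u\<close> is a product of two Gaussian
  exponentials with parameters \<open>- p * \<zeta> \<omega>\<close> and
  \<open>- p * \<beta>\<close>. Given the past, each integrates to 1.\<close>

lemma exp_simple_martingale:
  assumes S: "simple_integrand F S" and "0 \<le> u" "u \<le> v" "A \<in> sets (F u)"
  shows "(event_integral (\<lambda>\<omega>. ennreal (exp_simple p \<beta> S v \<omega>)) A)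
       = (event_integral (\<lambda>\<omega>. ennreal (exp_simple p \<beta> S u \<omega>)) A)"
proof -
  let ?P = "\<lambda>u v. \<forall>A\<in>sets (F u). (event_integral (\<lambda>\<omega>. ennreal (exp_simple p \<beta> S v \<omega>)) A)
       = (event_integral (\<lambda>\<omega>. ennreal (exp_simple p \<beta> S u \<omega>)) A)"
  have "?P u v"
  proof (rule simple_integrand_induct[OF S \<open>0 \<le> u\<close> \<open>u \<le> v\<close>])
    fix u v w :: real assume "0 \<le> u" "u \<le> v" "v \<le> w" "?P u v" "?P v w"
    then show "?P u w" using sets_F_mono[of u v] by (simp add: subset_eq)
  next
    fix u v \<zeta> assume uv: "0 \<le> u" "u < v" and \<zeta> [measurable]: "\<zeta> \<in> borel_measurable (F u)"
      and incr: "\<And>\<phi> G \<omega>. \<phi> 0 = 0 \<Longrightarrow> simple_integral (map_integrand \<phi> S) G v \<omega>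
          = simple_integral (map_integrand \<phi> S) G u \<omega> + \<phi> (\<zeta> \<omega>) * (G v \<omega> - G u \<omega>)"
    show "?P u v"
    proof
      fix A assume [measurable]: "A \<in> sets (F u)"
      let ?e = "\<lambda>q x. ennreal (exp (q * x - q\<^sup>2 / 2 * (v - u)))"
      define h where "h = (\<lambda>(\<omega>, (b, w)). (ennreal (exp_simple p \<beta> S u \<omega>) * indicator A \<omega>)
         * (?e (- p * \<zeta> \<omega>) b * ?e (- p * \<beta>) w))"
      note [measurable] = exp_simple_adapted[OF S \<open>0 \<le> u\<close>, of p \<beta>]
      have h: "h \<in> borel_measurable (F u \<Otimes>\<^sub>M (borel \<Otimes>\<^sub>M borel))"
        unfolding h_def by measurable
      have ints: "simple_integral S B v \<omega> = simple_integral S B u \<omega> + \<zeta> \<omega> * (B v \<omega> - B u \<omega>)"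
        "clock S v \<omega> = clock S u \<omega> + (\<zeta> \<omega>)\<^sup>2 * (v - u)" for \<omega>
        using incr[of "\<lambda>x. x" B \<omega>] incr[of power2 "\<lambda>t _. t" \<omega>] by (auto simp: clock_def map_integrand_id)
      have "exp_simple p \<beta> S v \<omega> = exp_simple p \<beta> S u \<omega> * (exp ((- p * \<zeta> \<omega>) * (B v \<omega> - B u \<omega>) - (- p * \<zeta> \<omega>)\<^sup>2 / 2 * (v - u))
         * exp ((- p * \<beta>) * (W v \<omega> - W u \<omega>) - (- p * \<beta>)\<^sup>2 / 2 * (v - u)))" for \<omega>
        unfolding exp_simple_def ints exp_add[symmetric] by (simp add: algebra_simps power_mult_distrib add_divide_distrib diff_divide_distrib)
      then have "(event_integral (\<lambda>\<omega>. ennreal (exp_simple p \<beta> S v \<omega>)) A)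
        = (\<integral>\<^sup>+ \<omega>. h (\<omega>, (B v \<omega> - B u \<omega>, W v \<omega> - W u \<omega>)) \<partial>M)"
        by (auto simp: h_def ennreal_mult exp_simple_def mult_ac intro!: nn_integral_cong)
      also have "\<dots> = (\<integral>\<^sup>+ \<omega>. \<integral>\<^sup>+ b. \<integral>\<^sup>+ w. h (\<omega>, (b, w)) \<partial>gaussian (v - u) \<partial>gaussian (v - u) \<partial>M)"
        by (rule nn_integral_increments[OF uv h])
      also have "\<dots> = (event_integral (\<lambda>\<omega>. ennreal (exp_simple p \<beta> S u \<omega>)) A)"
      proof (rule nn_integral_cong)
        fix \<omega>
        have "(\<integral>\<^sup>+ b. \<integral>\<^sup>+ w. h (\<omega>, (b, w)) \<partial>gaussian (v - u) \<partial>gaussian (v - u))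
          = (ennreal (exp_simple p \<beta> S u \<omega>) * indicator A \<omega>)
             * ((\<integral>\<^sup>+ b. ?e (- p * \<zeta> \<omega>) b \<partial>gaussian (v - u)) * (\<integral>\<^sup>+ w. ?e (- p * \<beta>) w \<partial>gaussian (v - u)))"
          by (simp add: h_def nn_integral_cmult nn_integral_multc)
        also have "\<dots> = ennreal (exp_simple p \<beta> S u \<omega>) * indicator A \<omega>"
          using uv by (subst (1 2) nn_integral_gaussian_exp) auto
        finally show "(\<integral>\<^sup>+ b. \<integral>\<^sup>+ w. h (\<omega>, (b, w)) \<partial>gaussian (v - u) \<partial>gaussian (v - u))
          = ennreal (exp_simple p \<beta> S u \<omega>) * indicator A \<omega>" .
      qed
      finally show "(event_integral (\<lambda>\<omega>. ennreal (exp_simple p \<beta> S v \<omega>)) A)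
       = (event_integral (\<lambda>\<omega>. ennreal (exp_simple p \<beta> S u \<omega>)) A)" .
    qed
  qed auto
  with assms show ?thesis by blast
qed

lemma simple_integral_0:
  assumes "simple_integrand F S"
  shows "simple_integral S G 0 \<omega> = 0"
proof -
  obtain n \<tau> \<xi> where S': "S = (n, \<tau>, \<xi>)" by (cases S)
  have mono: "\<And>i. i < n \<Longrightarrow> \<tau> i \<le> \<tau> (Suc i)" and \<tau>0: "0 \<le> \<tau> 0"
    using assms by (auto simp: S' simple_integrand_def)
  have pos: "0 \<le> \<tau> i" if "i \<le> n" for i
    using partition_le[of n \<tau> 0 i, OF mono] \<tau>0 that by auto
  then have "\<And>i. i < n \<Longrightarrow> min 0 (\<tau> i) = 0 \<and> min 0 (\<tau> (Suc i)) = 0" by (simp add: Suc_leI)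
  then show ?thesis by (auto simp: S' simple_integral_def)
qed

lemma nn_integral_exp_simple:
  assumes S: "simple_integrand F S" and "0 \<le> t"
  shows "(\<integral>\<^sup>+ \<omega>. ennreal (exp_simple p \<beta> S t \<omega>) \<partial>M) = 1"
proof -
  have "space M \<in> sets (F 0)" using sets.top[of "F 0"] by (simp add: space_F)
  from exp_simple_martingale[OF S order_refl \<open>0 \<le> t\<close> this]
  have "(event_integral (\<lambda>\<omega>. ennreal (exp_simple p \<beta> S t \<omega>)) (space M))
      = (event_integral (\<lambda>\<omega>. ennreal (exp_simple p \<beta> S 0 \<omega>)) (space M))" .
  also have "\<dots> = (\<integral>\<^sup>+ \<omega>. 1 \<partial>M)"
    using AE_W simple_integral_0[OF S] simple_integral_0[OF simple_integrand_power2[OF S]]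
    by (intro nn_integral_cong_AE) (auto simp: exp_simple_def clock_def indicator_def)
  also have "\<dots> = 1" by (simp add: emeasure_space_1)
  finally show ?thesis
    by (metis (no_types, lifting) indicator_simps(1) mult.right_neutral nn_integral_cong)
qed

text \<open>One half of the Ito isometry, enough for the estimates below: on a cell the cross term
  has mean 0, and the square of \<zeta> times the elapsed time is the increment of the
  clock.\<close>

lemma simple_isometry:
  assumes S: "simple_integrand F S" and "0 \<le> t"
  shows "(\<integral>\<^sup>+ \<omega>. ennreal ((simple_integral S B t \<omega>)\<^sup>2) \<partial>M) \<le> (\<integral>\<^sup>+ \<omega>. ennreal (clock S t \<omega>) \<partial>M)"
proof -
  let ?I = "\<lambda>t. \<integral>\<^sup>+ \<omega>. ennreal ((simple_integral S B t \<omega>)\<^sup>2) \<partial>M"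
  \<comment> \<open>Monotonicity of the clock is carried through the induction, because its
    differences add up under \<open>ennreal\<close> only when they are nonnegative.\<close>
  let ?P = "\<lambda>u v. (\<forall>\<omega>. clock S u \<omega> \<le> clock S v \<omega>) \<and> ?I v \<le> ?I u + (\<integral>\<^sup>+ \<omega>. ennreal (clock S v \<omega> - clock S u \<omega>) \<partial>M)"
  have "?P 0 t"
  proof (rule simple_integrand_induct[OF S order_refl \<open>0 \<le> t\<close>])
    fix u v w :: real assume uvw: "0 \<le> u" "u \<le> v" "v \<le> w" "?P u v" "?P v w"
    have [measurable]: "clock S u \<in> borel_measurable M" "clock S v \<in> borel_measurable M" "clock S w \<in> borel_measurable M"
      using uvw by (auto intro!: measurable_F_M[OF _ clock_adapted[OF S]])
    have "?I w \<le> ?I u + (\<integral>\<^sup>+ \<omega>. ennreal (clock S v \<omega> - clock S u \<omega>) \<partial>M) + (\<integral>\<^sup>+ \<omega>. ennreal (clock S w \<omega> - clock S v \<omega>) \<partial>M)"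
      using uvw by (meson add_right_mono order_trans)
    also have "\<dots> = ?I u + (\<integral>\<^sup>+ \<omega>. ennreal (clock S v \<omega> - clock S u \<omega>) + ennreal (clock S w \<omega> - clock S v \<omega>) \<partial>M)"
      by (subst nn_integral_add) (auto simp: add.assoc)
    also have "\<dots> = ?I u + (\<integral>\<^sup>+ \<omega>. ennreal (clock S w \<omega> - clock S u \<omega>) \<partial>M)"
      using uvw by (subst ennreal_plus[symmetric]) auto
    finally show "?P u w" using uvw by (auto intro: order_trans)
  next
    fix u v \<zeta> assume uv: "0 \<le> u" "u < v" and \<zeta> [measurable]: "\<zeta> \<in> borel_measurable (F u)"
      and incr: "\<And>\<phi> G \<omega>. \<phi> 0 = 0 \<Longrightarrow> simple_integral (map_integrand \<phi> S) G v \<omega>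
          = simple_integral (map_integrand \<phi> S) G u \<omega> + \<phi> (\<zeta> \<omega>) * (G v \<omega> - G u \<omega>)"
    note [measurable] = simple_integral_adapted[OF S measurable_B \<open>0 \<le> u\<close>]
    have [measurable]: "simple_integral S B u \<in> borel_measurable M" "\<zeta> \<in> borel_measurable M"
      using uv by (auto intro!: measurable_F_M[of u])
    have ints: "simple_integral S B v \<omega> = simple_integral S B u \<omega> + \<zeta> \<omega> * (B v \<omega> - B u \<omega>)"
      "clock S v \<omega> = clock S u \<omega> + (\<zeta> \<omega>)\<^sup>2 * (v - u)" for \<omega>
      using incr[of "\<lambda>x. x" B \<omega>] incr[of power2 "\<lambda>t _. t" \<omega>] by (auto simp: clock_def map_integrand_id)
    define h where "h = (\<lambda>(\<omega>, (b, w :: real)). ennreal ((simple_integral S B u \<omega> + \<zeta> \<omega> * b)\<^sup>2))"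
    have h: "h \<in> borel_measurable (F u \<Otimes>\<^sub>M (borel \<Otimes>\<^sub>M borel))"
      unfolding h_def by measurable
    interpret G: prob_space "gaussian (v - u)" using uv by (intro prob_space_gaussian) simp
    have "?I v = (\<integral>\<^sup>+ \<omega>. h (\<omega>, (B v \<omega> - B u \<omega>, W v \<omega> - W u \<omega>)) \<partial>M)"
      by (simp add: h_def ints)
    also have "\<dots> = (\<integral>\<^sup>+ \<omega>. \<integral>\<^sup>+ b. \<integral>\<^sup>+ w. h (\<omega>, (b, w)) \<partial>gaussian (v - u) \<partial>gaussian (v - u) \<partial>M)"
      by (rule nn_integral_increments[OF uv h])
    also have "\<dots> = (\<integral>\<^sup>+ \<omega>. ennreal ((simple_integral S B u \<omega>)\<^sup>2) + ennreal ((\<zeta> \<omega>)\<^sup>2 * (v - u)) \<partial>M)"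
      using uv G.emeasure_space_1 by (simp add: h_def nn_integral_gaussian_square ennreal_plus[symmetric] del: ennreal_plus)
    also have "\<dots> = ?I u + (\<integral>\<^sup>+ \<omega>. ennreal (clock S v \<omega> - clock S u \<omega>) \<partial>M)"
      by (subst nn_integral_add) (auto simp: ints)
    finally show "?P u v" using uv by (simp add: ints)
  qed auto
  then show ?thesis
    using simple_integral_0[OF S] simple_integral_0[OF simple_integrand_power2[OF S]] by (simp add: clock_def)
qed

text \<open>Cut at \<open>t\<close>, each cell has length
  \<open>min t (\<tau> (Suc i)) - min t (\<tau> i)\<close>, as in the simple integral against time;
  disjointness of the cells lets the square pass inside the sum.\<close>

lemma has_bochner_integral_clock:
  assumes S: "simple_integrand F S" and "0 \<le> t"
  shows "has_bochner_integral lborel (\<lambda>s. indicator {0..t} s * (simple_value S s \<omega>)\<^sup>2) (clock S t \<omega>)"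
proof -
  obtain n \<tau> \<xi> where S': "S = (n, \<tau>, \<xi>)" by (cases S)
  have mono: "\<And>i. i < n \<Longrightarrow> \<tau> i \<le> \<tau> (Suc i)" and \<tau>0: "0 \<le> \<tau> 0"
    using S by (auto simp: S' simple_integrand_def)
  have pos: "0 \<le> \<tau> i" if "i \<le> n" for i
    using partition_le[of n \<tau> 0 i, OF mono] \<tau>0 that by auto
  have "has_bochner_integral lborel (\<lambda>s. \<Sum>i<n. (\<xi> i \<omega>)\<^sup>2 * indicator {min t (\<tau> i)<..min t (\<tau> (Suc i))} s)
     (\<Sum>i<n. (\<xi> i \<omega>)\<^sup>2 * (min t (\<tau> (Suc i)) - min t (\<tau> i)))"
  proof (intro has_bochner_integral_sum has_bochner_integral_mult_right)
    fix i assume "i \<in> {..<n}"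
    then have "min t (\<tau> i) \<le> min t (\<tau> (Suc i))" using mono[of i] by auto
    then show "has_bochner_integral lborel (indicator {min t (\<tau> i)<..min t (\<tau> (Suc i))})
        (min t (\<tau> (Suc i)) - min t (\<tau> i))"
      using has_bochner_integral_real_indicator[of "{min t (\<tau> i)<..min t (\<tau> (Suc i))}" lborel] by simp
  qed
  moreover have "(\<Sum>i<n. (\<xi> i \<omega>)\<^sup>2 * indicator {min t (\<tau> i)<..min t (\<tau> (Suc i))} s)
      = indicator {0..t} s * (simple_value S s \<omega>)\<^sup>2" for s
  proof -
    have e1: "(simple_value S s \<omega>)\<^sup>2 = (\<Sum>i<n. (\<xi> i \<omega>)\<^sup>2 * indicator {\<tau> i<..\<tau> (Suc i)} s)"
      using simple_value_map[OF S, of power2 s \<omega>] by (simp add: S' map_integrand_def simple_value_def)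
    have e2: "indicator {min t (\<tau> i)<..min t (\<tau> (Suc i))} s
        = (indicator {0..t} s * indicator {\<tau> i<..\<tau> (Suc i)} s :: real)" if "i < n" for i
      using pos[of i] that by (auto simp: indicator_def min_def)
    show ?thesis
      unfolding e1 sum_distrib_left by (intro sum.cong refl) (simp only: lessThan_iff e2 mult_ac)
  qed
  ultimately show ?thesis
    by (simp add: clock_def simple_integral_def map_integrand_def S')
qed

lemma simple_value_measurable:
  assumes S: "simple_integrand F S"
  shows "(\<lambda>(s, \<omega>). simple_value S s \<omega>) \<in> borel_measurable (borel \<Otimes>\<^sub>M M)"
proof -
  obtain n \<tau> \<xi> where S': "S = (n, \<tau>, \<xi>)" by (cases S)
  have mono: "\<And>i. i < n \<Longrightarrow> \<tau> i \<le> \<tau> (Suc i)" and \<tau>0: "0 \<le> \<tau> 0"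
    and meas: "\<And>i. i < n \<Longrightarrow> \<xi> i \<in> borel_measurable (F (\<tau> i))"
    using S by (auto simp: S' simple_integrand_def)
  have pos: "0 \<le> \<tau> i" if "i \<le> n" for i
    using partition_le[of n \<tau> 0 i, OF mono] \<tau>0 that by auto
  have "(\<lambda>(s, \<omega>). \<xi> i \<omega> * indicator {\<tau> i<..\<tau> (Suc i)} s) \<in> borel_measurable (borel \<Otimes>\<^sub>M M)" if i: "i < n" for i
  proof -
    have [measurable]: "\<xi> i \<in> borel_measurable M"
      using measurable_F_M[OF _ meas[OF i]] pos[of i] i by auto
    show ?thesis by measurable
  qed
  then have "(\<lambda>x. \<Sum>i<n. (\<lambda>(s, \<omega>). \<xi> i \<omega> * indicator {\<tau> i<..\<tau> (Suc i)} s) x) \<in> borel_measurable (borel \<Otimes>\<^sub>M M)"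
    by (intro borel_measurable_sum) auto
  then show ?thesis by (simp add: S' simple_value_def case_prod_beta')
qed

end

section \<open>Exponential martingales of bounded integrands\<close>

text \<open>Clamping time between 0 and \<open>T\<close> is measurable from
  \<open>borel \<Otimes>\<^sub>M F T\<close> into the predictable sigma-algebra: a generator
  starting before \<open>T\<close> pulls back to a Borel set times a set of \<open>F T\<close>, one
  starting later to the empty set. The indicator hides the clamped values outside the
  interval.\<close>

lemma (in two_BMs) predictable_progressive:
  assumes H: "predictable_process M F H" and "0 \<le> T"
  shows "(\<lambda>(s, \<omega>). indicator {0..T} s * H s \<omega>) \<in> borel_measurable (borel \<Otimes>\<^sub>M F T)"
proof -
  let ?c = "\<lambda>s::real. max 0 (min T s)"
  let ?f = "\<lambda>(s, \<omega>). (?c s, \<omega>)"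
  have "?f \<in> measurable (borel \<Otimes>\<^sub>M F T) (predictable_sigma M F)"
    unfolding predictable_sigma_def
  proof (rule measurable_sigma_sets[OF sets_measure_of])
    show "{{0} \<times> A |A. A \<in> sets (F 0)} \<union> {{s<..t} \<times> A |s t A. 0 \<le> s \<and> s \<le> t \<and> A \<in> sets (F s)} \<subseteq> Pow ({0..} \<times> space M)"
      by (auto dest!: sets.sets_into_space simp: space_F)
    then show "{{0} \<times> A |A. A \<in> sets (F 0)} \<union> {{s<..t} \<times> A |s t A. 0 \<le> s \<and> s \<le> t \<and> A \<in> sets (F s)} \<subseteq> Pow ({0..} \<times> space M)" .
    show "?f \<in> space (borel \<Otimes>\<^sub>M F T) \<rightarrow> {0..} \<times> space M"
      using \<open>0 \<le> T\<close> by (auto simp: space_pair_measure space_F)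
    fix P assume "P \<in> {{0} \<times> A |A. A \<in> sets (F 0)} \<union> {{s<..t} \<times> A |s t A. 0 \<le> s \<and> s \<le> t \<and> A \<in> sets (F s)}"
    then consider A where "P = {0} \<times> A" "A \<in> sets (F 0)"
      | s t A where "P = {s<..t} \<times> A" "0 \<le> s" "s \<le> t" "A \<in> sets (F s)" by blast
    then show "?f -` P \<inter> space (borel \<Otimes>\<^sub>M F T) \<in> sets (borel \<Otimes>\<^sub>M F T)"
    proof cases
      case 1
      then have A: "A \<in> sets (F T)" using sets_F_mono[of 0 T] \<open>0 \<le> T\<close> by auto
      have "?f -` P \<inter> space (borel \<Otimes>\<^sub>M F T) = (?c -` {0}) \<times> A"
        using 1 sets.sets_into_space[OF A] by (auto simp: space_pair_measure)
      moreover have "?c -` {0} \<in> sets borel"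
        using measurable_sets[of ?c borel borel "{0}"] by simp
      ultimately show ?thesis using A by simp
    next
      case 2
      show ?thesis
      proof (cases "s < T")
        case True
        then have A: "A \<in> sets (F T)" using sets_F_mono[of s T] 2 by auto
        have "?f -` P \<inter> space (borel \<Otimes>\<^sub>M F T) = (?c -` {s<..t}) \<times> A"
          using 2 sets.sets_into_space[OF A] by (auto simp: space_pair_measure)
        moreover have "?c -` {s<..t} \<in> sets borel"
          using measurable_sets[of ?c borel borel "{s<..t}"] by simp
        ultimately show ?thesis using A by simp
      next
        case False
        then have "?f -` P \<inter> space (borel \<Otimes>\<^sub>M F T) = {}" using 2 \<open>0 \<le> T\<close> by auto
        then show ?thesis by simp
      qed
    qed
  qed
  then have "(\<lambda>x. case ?f x of (t, \<omega>) \<Rightarrow> H t \<omega>) \<in> borel_measurable (borel \<Otimes>\<^sub>M F T)"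
    using H unfolding predictable_process_def by (rule measurable_compose)
  then have "(\<lambda>x. indicator {0..T} (fst x) * (case ?f x of (t, \<omega>) \<Rightarrow> H t \<omega>)) \<in> borel_measurable (borel \<Otimes>\<^sub>M F T)"
    by measurable
  also have "(\<lambda>x. indicator {0..T} (fst x) * (case ?f x of (t, \<omega>) \<Rightarrow> H t \<omega>)) = (\<lambda>(s, \<omega>). indicator {0..T} s * H s \<omega>)"
    by (auto simp: indicator_def fun_eq_iff min_def max_def)
  finally show ?thesis .
qed

text \<open>Convergence in L1 yields an almost everywhere convergent subsequence. The first terms,
  whose integrals may be infinite, are cut off beforehand to obtain Bochner integrability.\<close>

lemma nn_integral_0_AE_subseq:
  fixes u :: "nat \<Rightarrow> 'a \<Rightarrow> real"
  assumes [measurable]: "\<And>k. u k \<in> borel_measurable M" and pos: "\<And>k x. x \<in> space M \<Longrightarrow> 0 \<le> u k x"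
    and lim: "(\<lambda>k. \<integral>\<^sup>+ x. ennreal (u k x) \<partial>M) \<longlonglongrightarrow> 0"
  shows "\<exists>r::nat\<Rightarrow>nat. strict_mono r \<and> (AE x in M. (\<lambda>k. u (r k) x) \<longlonglongrightarrow> 0)"
proof -
  have "\<forall>\<^sub>F k in sequentially. (\<integral>\<^sup>+ x. ennreal (u k x) \<partial>M) < 1"
    using order_tendstoD(2)[OF lim] by simp
  then obtain N where N: "\<And>k. k \<ge> N \<Longrightarrow> (\<integral>\<^sup>+ x. ennreal (u k x) \<partial>M) < 1"
    by (auto simp: eventually_sequentially)
  have int: "integrable M (u (k + N))" for k
    using N[of "k + N"] pos by (intro integrableI_nonneg) (auto intro: order_less_trans)
  have "ennreal (\<integral>x. norm (u (k + N) x) \<partial>M) = (\<integral>\<^sup>+ x. ennreal (u (k + N) x) \<partial>M)" for k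
    using int[of k] pos by (subst nn_integral_eq_integral) (auto intro!: arg_cong[where f=ennreal] Bochner_Integration.integral_cong)
  moreover have "(\<lambda>k. \<integral>\<^sup>+ x. ennreal (u (k + N) x) \<partial>M) \<longlonglongrightarrow> ennreal 0"
    using LIMSEQ_ignore_initial_segment[OF lim, of N] by simp
  ultimately have "(\<lambda>k. ennreal (\<integral>x. norm (u (k + N) x) \<partial>M)) \<longlonglongrightarrow> ennreal 0" by simp
  then have "(\<lambda>k. \<integral>x. norm (u (k + N) x) \<partial>M) \<longlonglongrightarrow> 0"
    by (subst (asm) tendsto_ennreal_iff) auto
  from tendsto_L1_AE_subseq[OF int this] obtain r where "strict_mono r" "AE x in M. (\<lambda>k. u (r k + N) x) \<longlonglongrightarrow> 0"
    by auto
  then show ?thesis by (intro exI[of _ "\<lambda>k. r k + N"]) (auto simp: strict_mono_def)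
qed

text \<open>A bound on the second moments makes the sequence uniformly integrable:
  \<open>f \<le> min f a + f\<^sup>2 / a\<close> reduces the claim to dominated convergence.\<close>

lemma (in prob_space) nn_integral_L2_bounded_tendsto:
  fixes f :: "nat \<Rightarrow> 'a \<Rightarrow> real"
  assumes [measurable]: "\<And>k. f k \<in> borel_measurable M" "g \<in> borel_measurable M" "A \<in> sets M"
    and pos: "\<And>k x. 0 \<le> f k x" "\<And>x. 0 \<le> g x"
    and lim: "AE x in M. (\<lambda>k. f k x) \<longlonglongrightarrow> g x"
    and bd: "\<And>k. (\<integral>\<^sup>+ x. ennreal ((f k x)\<^sup>2) \<partial>M) \<le> ennreal C"
  shows "(\<lambda>k. \<integral>\<^sup>+ x. ennreal (f k x) * indicator A x \<partial>M) \<longlonglongrightarrow> (\<integral>\<^sup>+ x. ennreal (g x) * indicator A x \<partial>M)"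
proof -
  let ?a = "\<lambda>k. \<integral>\<^sup>+ x. ennreal (f k x) * indicator A x \<partial>M"
  let ?b = "\<integral>\<^sup>+ x. ennreal (g x) * indicator A x \<partial>M"
  \<comment> \<open>Fatou gives the lower half; the moment bound enters in the upper half.\<close>
  have "?b \<le> (\<integral>\<^sup>+ x. liminf (\<lambda>k. ennreal (f k x) * indicator A x) \<partial>M)"
  proof (rule nn_integral_mono_AE, use lim in eventually_elim)
    fix x assume "(\<lambda>k. f k x) \<longlonglongrightarrow> g x"
    then have "(\<lambda>k. ennreal (f k x) * indicator A x) \<longlonglongrightarrow> ennreal (g x) * indicator A x"
      by (auto simp: indicator_def)
    then show "ennreal (g x) * indicator A x \<le> liminf (\<lambda>k. ennreal (f k x) * indicator A x)"
      by (simp add: lim_imp_Liminf)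
  qed
  also have "\<dots> \<le> liminf ?a" by (rule nn_integral_liminf) simp
  finally have low: "?b \<le> liminf ?a" .
  have up: "limsup ?a \<le> ?b"
  proof (rule ennreal_le_epsilon)
    fix e :: real assume "0 < e"
    \<comment> \<open>A truncation level with \<open>C / c \<le> e\<close>; the added 1 keeps it
      positive.\<close>
    define c where "c = (\<bar>C\<bar> + 1) / e"
    have c: "c > 0" "C \<le> c * e" using \<open>0 < e\<close> by (auto simp: c_def)
    have le: "?a k \<le> (\<integral>\<^sup>+ x. ennreal (min (f k x) c * indicator A x) \<partial>M) + ennreal e" for k
    proof -
      have "?a k \<le> (\<integral>\<^sup>+ x. ennreal (min (f k x) c * indicator A x) + ennreal (1 / c) * ennreal ((f k x)\<^sup>2) \<partial>M)"
      proof (rule nn_integral_mono)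
        fix x
        have "f k x \<le> min (f k x) c + 1 / c * (f k x)\<^sup>2"
        proof (cases "f k x \<le> c")
          case False
          then have "c * f k x \<le> (f k x)\<^sup>2" using c pos(1)[of k x] by (simp add: power2_eq_square mult_right_mono)
          then have "f k x \<le> 1 / c * (f k x)\<^sup>2" using c by (simp add: field_simps)
          then show ?thesis using c False by simp
        qed (use c in simp)
        then show "ennreal (f k x) * indicator A x \<le> ennreal (min (f k x) c * indicator A x) + ennreal (1 / c) * ennreal ((f k x)\<^sup>2)"
          using pos(1)[of k x] c by (auto simp: indicator_def ennreal_mult[symmetric] ennreal_plus[symmetric] intro!: ennreal_leI simp del: ennreal_plus)
      qed
      also have "\<dots> = (\<integral>\<^sup>+ x. ennreal (min (f k x) c * indicator A x) \<partial>M) + ennreal (1 / c) * (\<integral>\<^sup>+ x. ennreal ((f k x)\<^sup>2) \<partial>M)"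
        by (simp add: nn_integral_add nn_integral_cmult)
      also have "\<dots> \<le> (\<integral>\<^sup>+ x. ennreal (min (f k x) c * indicator A x) \<partial>M) + ennreal (1 / c) * ennreal C"
        using bd by (intro add_left_mono mult_left_mono) auto
      also have "ennreal (1 / c) * ennreal C \<le> ennreal e"
        using c by (cases "C \<ge> 0") (auto simp: ennreal_mult[symmetric] ennreal_neg field_simps intro!: ennreal_leI)
      finally show ?thesis by (simp add: add_left_mono)
    qed
    have "(\<lambda>k. \<integral>\<^sup>+ x. ennreal (min (f k x) c * indicator A x) \<partial>M) \<longlonglongrightarrow> (\<integral>\<^sup>+ x. ennreal (min (g x) c * indicator A x) \<partial>M)"
    proof (rule nn_integral_dominated_convergence[where w="\<lambda>_. ennreal c"])
      show "(\<integral>\<^sup>+ x. ennreal c \<partial>M) < \<infinity>" by (simp add: emeasure_space_1)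
      show "AE x in M. (\<lambda>k. ennreal (min (f k x) c * indicator A x)) \<longlonglongrightarrow> ennreal (min (g x) c * indicator A x)"
        using lim by eventually_elim (intro tendsto_intros tendsto_ennrealI)
    qed (use c in \<open>auto intro!: AE_I2 ennreal_leI simp: indicator_def\<close>)
    then have "(\<lambda>k. (\<integral>\<^sup>+ x. ennreal (min (f k x) c * indicator A x) \<partial>M) + ennreal e)
       \<longlonglongrightarrow> (\<integral>\<^sup>+ x. ennreal (min (g x) c * indicator A x) \<partial>M) + ennreal e"
      by (intro tendsto_intros)
    then have "limsup (\<lambda>k. (\<integral>\<^sup>+ x. ennreal (min (f k x) c * indicator A x) \<partial>M) + ennreal e)
       = (\<integral>\<^sup>+ x. ennreal (min (g x) c * indicator A x) \<partial>M) + ennreal e"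
      by (simp add: lim_imp_Limsup)
    moreover have "limsup ?a \<le> limsup (\<lambda>k. (\<integral>\<^sup>+ x. ennreal (min (f k x) c * indicator A x) \<partial>M) + ennreal e)"
      using le by (intro Limsup_mono always_eventually) auto
    moreover have "(\<integral>\<^sup>+ x. ennreal (min (g x) c * indicator A x) \<partial>M) \<le> ?b"
      by (intro nn_integral_mono) (auto simp: indicator_def intro!: ennreal_leI)
    ultimately show "limsup ?a \<le> ?b + ennreal e"
      by (metis (no_types, lifting) add_right_mono order_trans)
  qed
  have "liminf ?a \<le> limsup ?a" by (intro Liminf_le_Limsup) simp
  then have "liminf ?a = ?b" "limsup ?a = ?b" using low up by (meson antisym order_trans)+
  then show ?thesis by (subst tendsto_iff_Liminf_eq_Limsup) auto
qed

abbreviation square_integral :: "real \<Rightarrow> (real \<Rightarrow> real) \<Rightarrow> real" where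
  "square_integral t f \<equiv> (LINT x|lborel. indicator {0..t} x * (f x)\<^sup>2)"

text \<open>Uses \<open>\<bar>s\<^sup>2 - h\<^sup>2\<bar> \<le> 2 K \<bar>s - h\<bar>\<close> and \<open>\<bar>s - h\<bar> \<le> \<delta> + (s - h)\<^sup>2 / \<delta>\<close>.\<close>

lemma integral_square_diff_le:
  fixes s h :: "real \<Rightarrow> real"
  assumes ints: "integrable lborel (\<lambda>x. indicator {0..t} x * (s x)\<^sup>2)"
    and ih: "integrable lborel (\<lambda>x. indicator {0..t} x * (h x)\<^sup>2)"
    and id: "integrable lborel (\<lambda>x. indicator {0..t} x * (s x - h x)\<^sup>2)"
    and bd: "\<And>x. x \<in> {0..t} \<Longrightarrow> \<bar>s x\<bar> \<le> K" "\<And>x. x \<in> {0..t} \<Longrightarrow> \<bar>h x\<bar> \<le> K"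
    and "0 \<le> t" "0 < d"
  shows "\<bar>square_integral t s - square_integral t h\<bar>
     \<le> 2 * K * (d * t + square_integral t (\<lambda>x. s x - h x) / d)"
proof -
  have K: "K \<ge> 0" using bd(1)[of 0] \<open>0 \<le> t\<close> by auto
  have ic: "integrable lborel (\<lambda>x. indicator {0..t} x * d)"
    using \<open>0 \<le> t\<close> by (intro integrable_mult_left integrable_real_indicator) auto
  have "\<bar>square_integral t s - square_integral t h\<bar>
     = \<bar>LINT x|lborel. indicator {0..t} x * (s x)\<^sup>2 - indicator {0..t} x * (h x)\<^sup>2\<bar>"
    using ints ih by simp
  also have "\<dots> \<le> (LINT x|lborel. 2 * K * (indicator {0..t} x * d + (indicator {0..t} x * (s x - h x)\<^sup>2) / d))"
  proof (rule integral_abs_bound_integral)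
    show "integrable lborel (\<lambda>x. indicator {0..t} x * (s x)\<^sup>2 - indicator {0..t} x * (h x)\<^sup>2)"
      using ints ih by simp
    show "integrable lborel (\<lambda>x. 2 * K * (indicator {0..t} x * d + (indicator {0..t} x * (s x - h x)\<^sup>2) / d))"
      using ic id by (intro integrable_mult_right Bochner_Integration.integrable_add integrable_divide) auto
    fix x :: real
    show "\<bar>indicator {0..t} x * (s x)\<^sup>2 - indicator {0..t} x * (h x)\<^sup>2\<bar>
        \<le> 2 * K * (indicator {0..t} x * d + (indicator {0..t} x * (s x - h x)\<^sup>2) / d)"
    proof (cases "x \<in> {0..t}")
      case True
      let ?y = "\<bar>s x - h x\<bar>"
      have "\<bar>(s x)\<^sup>2 - (h x)\<^sup>2\<bar> = \<bar>s x + h x\<bar> * ?y"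
        by (simp add: power2_eq_square abs_mult[symmetric] algebra_simps)
      also have "\<dots> \<le> 2 * K * ?y" using bd[OF True] by (intro mult_right_mono) auto
      also have "?y \<le> d + ?y\<^sup>2 / d"
      proof (cases "?y \<le> d")
        case True
        then show ?thesis using \<open>0 < d\<close> by (simp add: add_increasing2)
      next
        case False
        then have "d * ?y \<le> ?y\<^sup>2" unfolding power2_eq_square by (intro mult_right_mono) auto
        then have "?y \<le> ?y\<^sup>2 / d" using \<open>0 < d\<close> by (simp add: field_simps)
        then show ?thesis using \<open>0 < d\<close> by simp
      qed
      finally show ?thesis using True K by (simp add: mult_left_mono)
    qed simp
  qed
  also have "\<dots> = 2 * K * (d * t + square_integral t (\<lambda>x. s x - h x) / d)"
    using ic id \<open>0 \<le> t\<close> by simp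
  finally show ?thesis .
qed

definition clip :: "real \<Rightarrow> real \<Rightarrow> real" where
  "clip K x = max (- K) (min K x)"

lemma clip_measurable [measurable]: "clip K \<in> borel_measurable borel"
  unfolding clip_def by measurable

text \<open>For nonnegative \<open>K\<close>, \<open>clip K\<close> is the nearest-point projection
  onto the interval from \<open>- K\<close> to \<open>K\<close>. It contracts towards
  \<open>h\<close> because it fixes \<open>h\<close>, and its error is at most the distance to
  \<open>h\<close> because no point of the interval is closer to \<open>x\<close>.\<close>

lemma clip_0: "0 \<le> K \<Longrightarrow> clip K 0 = 0"
  and abs_clip_le: "0 \<le> K \<Longrightarrow> \<bar>clip K x\<bar> \<le> K"
  and clip_contraction: "\<bar>h\<bar> \<le> K \<Longrightarrow> \<bar>clip K x - h\<bar> \<le> \<bar>x - h\<bar>"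
  and clip_error: "\<bar>h\<bar> \<le> K \<Longrightarrow> \<bar>x - clip K x\<bar> \<le> \<bar>x - h\<bar>"
  by (auto simp: clip_def)

section \<open>Bounded approximation of the Ito integral\<close>

context two_BMs
begin

lemma simple_integrand_clip: "simple_integrand F S \<Longrightarrow> 0 \<le> K \<Longrightarrow> simple_integrand F (map_integrand (clip K) S)"
  by (rule simple_integrand_map) (auto intro!: exI[of _ K] abs_clip_le)

lemma simple_integrand_clip_error:
  "simple_integrand F S \<Longrightarrow> 0 \<le> K \<Longrightarrow> simple_integrand F (map_integrand (\<lambda>x. x - clip K x) S)"
proof (rule simple_integrand_map)
  show "\<exists>L'. \<forall>x. \<bar>x\<bar> \<le> L \<longrightarrow> \<bar>x - clip K x\<bar> \<le> L'" if "0 \<le> K" for L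
    by (rule exI[of _ L]) (use clip_error[of 0 K] that in \<open>auto intro: order_trans\<close>)
qed auto

lemma simple_integral_diff_map:
  "simple_integral S G t \<omega> - simple_integral (map_integrand \<phi> S) G t \<omega> = simple_integral (map_integrand (\<lambda>x. x - \<phi> x) S) G t \<omega>"
  by (cases S) (simp add: simple_integral_def map_integrand_def sum_subtractf[symmetric] left_diff_distrib)

lemma simple_isometry':
  assumes S: "simple_integrand F S" and "0 \<le> t"
  shows "(\<integral>\<^sup>+ \<omega>. ennreal ((simple_integral S B t \<omega>)\<^sup>2) \<partial>M)
    \<le> (\<integral>\<^sup>+ \<omega>. (\<integral>\<^sup>+s\<in>{0..t}. ennreal ((simple_value S s \<omega>)\<^sup>2) \<partial>lborel) \<partial>M)"
proof -
  have "ennreal (clock S t \<omega>) = (\<integral>\<^sup>+s\<in>{0..t}. ennreal ((simple_value S s \<omega>)\<^sup>2) \<partial>lborel)" for \<omega>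
  proof -
    have "(\<integral>\<^sup>+s\<in>{0..t}. ennreal ((simple_value S s \<omega>)\<^sup>2) \<partial>lborel)
        = (\<integral>\<^sup>+s. ennreal (indicator {0..t} s * (simple_value S s \<omega>)\<^sup>2) \<partial>lborel)"
      by (intro nn_integral_cong) (auto simp: indicator_def)
    also have "\<dots> = ennreal (clock S t \<omega>)"
      using has_bochner_integral_clock[OF assms, of \<omega>] by (subst nn_integral_eq_integral) (auto simp: has_bochner_integral_iff)
    finally show ?thesis ..
  qed
  with simple_isometry[OF assms] show ?thesis by simp
qed

text \<open>Clipping costs nothing: it moves the integrand, and hence by isometry the integral, by no
  more than the distance to the bounded limit.\<close>

lemma ito_integral_bounded_approx:
  assumes I: "ito_integral M F B H I" and K: "0 \<le> K" "\<forall>t\<ge>0. \<forall>\<omega>\<in>space M. \<bar>H t \<omega>\<bar> \<le> K"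
  shows "\<exists>S. (\<forall>k. simple_integrand F (S k)) \<and> (\<forall>k t \<omega>. \<bar>simple_value (S k) t \<omega>\<bar> \<le> K) \<and>
    (\<forall>T\<ge>0. (\<lambda>k. integrand_error H (S k) T) \<longlonglongrightarrow> 0) \<and>
    (\<forall>t\<ge>0. (\<lambda>k. integral_error I (S k) t) \<longlonglongrightarrow> 0)"
proof -
  obtain S where S: "\<And>k. simple_integrand F (S k)" and
    c1: "\<And>T. 0 \<le> T \<Longrightarrow> (\<lambda>k. integrand_error H (S k) T) \<longlonglongrightarrow> 0"
    and c2: "\<And>t. 0 \<le> t \<Longrightarrow> (\<lambda>k. integral_error I (S k) t) \<longlonglongrightarrow> 0"
    and Im: "\<And>t. 0 \<le> t \<Longrightarrow> I t \<in> borel_measurable M"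
    using I unfolding ito_integral_def by blast
  let ?d = "\<lambda>T k. integrand_error H (S k) T"
  let ?S = "\<lambda>k. map_integrand (clip K) (S k)"
  note val = simple_value_map[OF S, where \<phi>="clip K", OF clip_0[OF K(1)]]
  show ?thesis
  proof (intro exI[of _ ?S] conjI allI impI)
    show "simple_integrand F (?S k)" for k using simple_integrand_clip[OF S K(1)] .
    show "\<bar>simple_value (?S k) t \<omega>\<bar> \<le> K" for k t \<omega>
      using abs_clip_le[OF K(1)] by (simp add: val)
    fix T :: real assume T: "0 \<le> T"
    show "(\<lambda>k. integrand_error H (?S k) T) \<longlonglongrightarrow> 0"
    proof (rule tendsto_sandwich[OF _ _ tendsto_const c1[OF T]])
      show "\<forall>\<^sub>F k in sequentially. (integrand_error H (?S k) T) \<le> ?d T k"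
      proof (intro always_eventually allI nn_integral_mono)
        fix k \<omega> s assume "\<omega> \<in> space M"
        then show "ennreal ((simple_value (?S k) s \<omega> - H s \<omega>)\<^sup>2) * indicator {0..T} s
           \<le> ennreal ((simple_value (S k) s \<omega> - H s \<omega>)\<^sup>2) * indicator {0..T} s"
          using clip_contraction[OF K(2)[rule_format, of s \<omega>], of "simple_value (S k) s \<omega>"]
          by (auto simp: indicator_def val abs_le_square_iff[symmetric] intro!: ennreal_leI)
      qed
    qed auto
    have le: "(integral_error I (?S k) T)
       \<le> 2 * ?d T k + 2 * (integral_error I (S k) T)" for k
    proof -
      let ?E = "map_integrand (\<lambda>x. x - clip K x) (S k)"
      have E: "simple_integrand F ?E" by (rule simple_integrand_clip_error[OF S K(1)])
      have [measurable]: "simple_integral (S k) B T \<in> borel_measurable M" "simple_integral ?E B T \<in> borel_measurable M"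
         "I T \<in> borel_measurable M"
        using T S E by (auto intro!: measurable_F_M[OF T] simple_integral_adapted measurable_B Im)
      have "(integral_error I (?S k) T)
        \<le> (\<integral>\<^sup>+\<omega>. 2 * ennreal ((simple_integral ?E B T \<omega>)\<^sup>2) + 2 * ennreal ((simple_integral (S k) B T \<omega> - I T \<omega>)\<^sup>2) \<partial>M)"
      proof (rule nn_integral_mono)
        fix \<omega>
        have sq: "(x - y)\<^sup>2 \<le> 2 * y\<^sup>2 + 2 * x\<^sup>2" for x y :: real
          using zero_le_power2[of "x + y"] by (simp add: power2_eq_square algebra_simps)
        have "(simple_integral (?S k) B T \<omega> - I T \<omega>)\<^sup>2 = ((simple_integral (S k) B T \<omega> - I T \<omega>) - simple_integral ?E B T \<omega>)\<^sup>2"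
          by (simp add: simple_integral_diff_map[symmetric])
        also have "\<dots> \<le> 2 * (simple_integral ?E B T \<omega>)\<^sup>2 + 2 * (simple_integral (S k) B T \<omega> - I T \<omega>)\<^sup>2"
          by (rule sq)
        finally have "ennreal ((simple_integral (?S k) B T \<omega> - I T \<omega>)\<^sup>2)
           \<le> ennreal (2 * (simple_integral ?E B T \<omega>)\<^sup>2 + 2 * (simple_integral (S k) B T \<omega> - I T \<omega>)\<^sup>2)"
          by (rule ennreal_leI)
        then show "ennreal ((simple_integral (?S k) B T \<omega> - I T \<omega>)\<^sup>2)
           \<le> 2 * ennreal ((simple_integral ?E B T \<omega>)\<^sup>2) + 2 * ennreal ((simple_integral (S k) B T \<omega> - I T \<omega>)\<^sup>2)"
          by (simp add: ennreal_mult)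
      qed
      also have "\<dots> = 2 * (\<integral>\<^sup>+\<omega>. ennreal ((simple_integral ?E B T \<omega>)\<^sup>2) \<partial>M) + 2 * (integral_error I (S k) T)"
        by (simp add: nn_integral_add nn_integral_cmult)
      also have "(\<integral>\<^sup>+\<omega>. ennreal ((simple_integral ?E B T \<omega>)\<^sup>2) \<partial>M)
         \<le> (\<integral>\<^sup>+ \<omega>. (\<integral>\<^sup>+s\<in>{0..T}. ennreal ((simple_value ?E s \<omega>)\<^sup>2) \<partial>lborel) \<partial>M)"
        by (rule simple_isometry'[OF E T])
      also have "\<dots> \<le> ?d T k"
      proof (intro nn_integral_mono)
        fix \<omega> s assume "\<omega> \<in> space M"
        then show "ennreal ((simple_value ?E s \<omega>)\<^sup>2) * indicator {0..T} s
           \<le> ennreal ((simple_value (S k) s \<omega> - H s \<omega>)\<^sup>2) * indicator {0..T} s"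
          using clip_error[OF K(2)[rule_format, of s \<omega>], of "simple_value (S k) s \<omega>"]
          by (auto simp: indicator_def simple_value_map[OF S, where \<phi>="\<lambda>x. x - clip K x"] clip_0[OF K(1)] abs_le_square_iff[symmetric] intro!: ennreal_leI)
      qed
      finally show ?thesis by (simp add: mult_left_mono add_right_mono)
    qed
    have "(\<lambda>k. 2 * ?d T k + 2 * (integral_error I (S k) T)) \<longlonglongrightarrow> 2 * 0 + 2 * 0"
      by (intro tendsto_add ennreal_tendsto_cmult c1[OF T] c2[OF T]) auto
    then have lim: "(\<lambda>k. 2 * ?d T k + 2 * (integral_error I (S k) T)) \<longlonglongrightarrow> 0"
      by (simp only: mult_zero_right add_0)
    show "(\<lambda>k. integral_error I (?S k) T) \<longlonglongrightarrow> 0"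
      by (rule tendsto_sandwich[OF _ _ tendsto_const lim]) (rule always_eventually, rule allI, (rule zero_le le))+
  qed
qed

text \<open>Squaring the exponential for \<open>p\<close> gives the exponential for
  \<open>2 * p\<close>, of mean 1, times \<open>exp (p^2 * (clock + \<beta>^2 * t))\<close>. A
  bounded integrand has a bounded clock, so the bound depends on the integrand through
  \<open>K\<close> only.\<close>

lemma exp_simple_L2:
  assumes S: "simple_integrand F S" and K: "\<And>t \<omega>. \<bar>simple_value S t \<omega>\<bar> \<le> K" and "0 \<le> t"
  shows "(\<integral>\<^sup>+ \<omega>. ennreal ((exp_simple p \<beta> S t \<omega>)\<^sup>2) \<partial>M) \<le> ennreal (exp (p\<^sup>2 * (K\<^sup>2 + \<beta>\<^sup>2) * t))"
proof -
  have [measurable]: "exp_simple (2 * p) \<beta> S t \<in> borel_measurable M"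
    by (rule measurable_F_M[OF _ exp_simple_adapted[OF S]]) fact+
  have K2: "clock S t \<omega> \<le> K\<^sup>2 * t" for \<omega>
  proof -
    note hc = has_bochner_integral_clock[OF S \<open>0 \<le> t\<close>, of \<omega>]
    have "clock S t \<omega> = (LINT s|lborel. indicator {0..t} s * (simple_value S s \<omega>)\<^sup>2)"
      using hc by (simp add: has_bochner_integral_iff)
    also have "\<dots> \<le> (LINT s|lborel. indicator {0..t} s * K\<^sup>2)"
    proof (rule integral_mono)
      show "integrable lborel (\<lambda>s. indicator {0..t} s * (simple_value S s \<omega>)\<^sup>2)"
        using hc by (simp add: has_bochner_integral_iff)
      show "integrable lborel (\<lambda>s. indicator {0..t} s * K\<^sup>2)"
        using \<open>0 \<le> t\<close> by (intro integrable_mult_left integrable_real_indicator) auto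
      show "indicator {0..t} s * (simple_value S s \<omega>)\<^sup>2 \<le> indicator {0..t} s * K\<^sup>2" for s
        using K[of s \<omega>] by (auto simp: indicator_def abs_le_square_iff[symmetric])
    qed
    also have "\<dots> = K\<^sup>2 * t" using \<open>0 \<le> t\<close> by simp
    finally show ?thesis .
  qed
  have "(\<integral>\<^sup>+ \<omega>. ennreal ((exp_simple p \<beta> S t \<omega>)\<^sup>2) \<partial>M)
     \<le> (\<integral>\<^sup>+ \<omega>. ennreal (exp (p\<^sup>2 * (K\<^sup>2 + \<beta>\<^sup>2) * t)) * ennreal (exp_simple (2 * p) \<beta> S t \<omega>) \<partial>M)"
  proof (rule nn_integral_mono)
    fix \<omega>
    have "(exp_simple p \<beta> S t \<omega>)\<^sup>2 = exp (p\<^sup>2 * (clock S t \<omega> + \<beta>\<^sup>2 * t)) * exp_simple (2 * p) \<beta> S t \<omega>"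
      unfolding exp_simple_def power2_eq_square[of "exp _"] exp_add[symmetric] by (simp add: algebra_simps power_mult_distrib)
    also have "\<dots> \<le> exp (p\<^sup>2 * (K\<^sup>2 * t + \<beta>\<^sup>2 * t)) * exp_simple (2 * p) \<beta> S t \<omega>"
      using K2[of \<omega>] by (intro mult_right_mono) (auto simp: exp_simple_def intro!: mult_left_mono)
    finally show "ennreal ((exp_simple p \<beta> S t \<omega>)\<^sup>2)
       \<le> ennreal (exp (p\<^sup>2 * (K\<^sup>2 + \<beta>\<^sup>2) * t)) * ennreal (exp_simple (2 * p) \<beta> S t \<omega>)"
      by (subst ennreal_mult[symmetric]) (auto simp: exp_simple_def algebra_simps intro!: ennreal_leI)
  qed
  also have "\<dots> = ennreal (exp (p\<^sup>2 * (K\<^sup>2 + \<beta>\<^sup>2) * t))"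
    by (simp add: nn_integral_cmult nn_integral_exp_simple[OF S \<open>0 \<le> t\<close>])
  finally show ?thesis .
qed

end

lemma integrable_indicator_bounded:
  fixes f :: "real \<Rightarrow> real"
  assumes m: "(\<lambda>s. indicator {0..t} s * f s) \<in> borel_measurable borel" and bd: "\<And>s. s \<in> {0..t} \<Longrightarrow> \<bar>f s\<bar> \<le> K"
  shows "integrable lborel (\<lambda>s. indicator {0..t} s * f s)"
proof (rule Bochner_Integration.integrable_bound)
  show "integrable lborel (\<lambda>s. indicator {0..t} s * K :: real)"
    by (cases "0 \<le> t") (auto intro!: integrable_mult_left integrable_real_indicator)
  show "(\<lambda>s. indicator {0..t} s * f s) \<in> borel_measurable lborel" using m by simp
  show "AE s in lborel. norm (indicator {0..t} s * f s) \<le> norm (indicator {0..t} s * K :: real)"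
  proof (rule AE_I2)
    fix s show "norm (indicator {0..t} s * f s) \<le> norm (indicator {0..t} s * K :: real)"
      using bd[of s] by (auto simp: indicator_def)
  qed
qed

lemma integral_square_tendsto:
  fixes s :: "nat \<Rightarrow> real \<Rightarrow> real"
  assumes "\<And>k. integrable lborel (\<lambda>x. indicator {0..t} x * (s k x)\<^sup>2)"
    and "integrable lborel (\<lambda>x. indicator {0..t} x * (h x)\<^sup>2)"
    and "\<And>k. integrable lborel (\<lambda>x. indicator {0..t} x * (s k x - h x)\<^sup>2)"
    and "\<And>k x. x \<in> {0..t} \<Longrightarrow> \<bar>s k x\<bar> \<le> K" "\<And>x. x \<in> {0..t} \<Longrightarrow> \<bar>h x\<bar> \<le> K"
    and "0 \<le> t" and lim: "(\<lambda>k. square_integral t (\<lambda>x. s k x - h x)) \<longlonglongrightarrow> 0"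
  shows "(\<lambda>k. square_integral t (s k)) \<longlonglongrightarrow> square_integral t h"
proof -
  let ?D = "\<lambda>k. square_integral t (\<lambda>x. s k x - h x)"
  \<comment> \<open>With \<delta> of the order of \<open>sqrt (?D k)\<close> both \<delta> and
    \<open>?D k / \<delta>\<close> tend to 0; the second summand keeps \<delta> positive when
    \<open>?D k\<close> is 0.\<close>
  define \<delta> where "\<delta> k = sqrt (?D k) + 1 / (real k + 1)" for k
  have D: "?D k \<ge> 0" for k by (intro Bochner_Integration.integral_nonneg) auto
  have K: "K \<ge> 0" using assms(5)[of 0] \<open>0 \<le> t\<close> by auto
  have \<delta>: "\<delta> k > 0" "sqrt (?D k) \<le> \<delta> k" for k
    unfolding \<delta>_def using real_sqrt_ge_zero[OF D[of k]] by (auto intro: add_nonneg_pos)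
  have le: "\<bar>square_integral t (s k) - square_integral t h\<bar>
     \<le> 2 * K * (\<delta> k * t + sqrt (?D k))" for k
  proof -
    have "\<bar>square_integral t (s k) - square_integral t h\<bar>
       \<le> 2 * K * (\<delta> k * t + ?D k / \<delta> k)"
      by (rule integral_square_diff_le) (use assms \<delta> in auto)
    also have "?D k = sqrt (?D k) * sqrt (?D k)" using D[of k] by simp
    also have "sqrt (?D k) * sqrt (?D k) \<le> sqrt (?D k) * \<delta> k"
      using \<delta>(2)[of k] D[of k] by (intro mult_left_mono) auto
    finally show ?thesis using \<delta>(1)[of k] K
      by (simp add: divide_right_mono mult_left_mono add_left_mono)
  qed
  have s0: "(\<lambda>k. sqrt (?D k)) \<longlonglongrightarrow> 0" using tendsto_real_sqrt[OF lim] by simp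
  have "(\<lambda>k. 2 * K * (\<delta> k * t + sqrt (?D k))) \<longlonglongrightarrow> 2 * K * ((0 + 0) * t + 0)"
    unfolding \<delta>_def using s0 LIMSEQ_inverse_real_of_nat
    by (intro tendsto_intros) (auto simp: inverse_eq_divide add.commute)
  then have bnd: "(\<lambda>k. 2 * K * (\<delta> k * t + sqrt (?D k))) \<longlonglongrightarrow> 0" by simp
  have "(\<lambda>k. square_integral t (s k) - square_integral t h) \<longlonglongrightarrow> 0"
    by (rule Lim_null_comparison[OF always_eventually bnd]) (rule allI, unfold real_norm_def, rule le)
  then show ?thesis by (simp add: LIM_zero_iff)
qed

lemma tendsto_square_0_cancel:
  fixes f :: "nat \<Rightarrow> real"
  assumes "(\<lambda>k. (f k - l)\<^sup>2) \<longlonglongrightarrow> 0"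
  shows "f \<longlonglongrightarrow> l"
proof -
  have "(\<lambda>k. sqrt ((f k - l)\<^sup>2)) \<longlonglongrightarrow> 0" using tendsto_real_sqrt[OF assms] by simp
  then have "(\<lambda>k. f k - l) \<longlonglongrightarrow> 0" by (simp add: tendsto_rabs_zero_iff)
  then show ?thesis by (simp add: LIM_zero_iff)
qed

section \<open>Passage to the limit and measurability up to null sets\<close>

context two_BMs
begin

text \<open>The stochastic exponential in the limit, with the quadratic variation as a time
  integral. The parameter \<open>p\<close> stays free because survival is estimated with half of
  \<rho>.\<close>

definition exp_mart :: "real \<Rightarrow> real \<Rightarrow> (real \<Rightarrow> 'a \<Rightarrow> real) \<Rightarrow> (real \<Rightarrow> 'a \<Rightarrow> real) \<Rightarrow> real \<Rightarrow> 'a \<Rightarrow> real" where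
  "exp_mart p \<beta> H I t \<omega> = exp (- p * (I t \<omega> + \<beta> * W t \<omega>)
      - p\<^sup>2 / 2 * (square_integral t (\<lambda>s. H s \<omega>) + \<beta>\<^sup>2 * t))"

lemma predictable_measurable:
  assumes "predictable_process M F H" "0 \<le> t"
  shows "(\<lambda>(s, \<omega>). indicator {0..t} s * H s \<omega>) \<in> borel_measurable (borel \<Otimes>\<^sub>M M)"
proof -
  have id: "(\<lambda>x. x) \<in> measurable M (F t)"
    using assms by (intro measurableI) (auto simp: space_F dest: sets.sets_into_space intro: sets_F[THEN subsetD])
  have "(\<lambda>x. (fst x, snd x)) \<in> measurable (borel \<Otimes>\<^sub>M M) (borel \<Otimes>\<^sub>M F t)"
    by (intro measurable_Pair measurable_fst measurable_compose[OF measurable_snd id])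
  from measurable_compose[OF this predictable_progressive[OF assms]] show ?thesis
    by (simp add: case_prod_beta')
qed

lemma exp_mart_measurable:
  assumes I: "ito_integral M F B H I" and "0 \<le> t"
  shows "exp_mart p \<beta> H I t \<in> borel_measurable M"
proof -
  have p: "predictable_process M F H" using I by (simp add: ito_integral_def)
  have [measurable]: "I t \<in> borel_measurable M" "W t \<in> borel_measurable M"
    using I assms by (auto simp: ito_integral_def intro: measurable_W_M)
  note [measurable] = predictable_measurable[OF p \<open>0 \<le> t\<close>]
  have "(\<lambda>\<omega>. LINT s|lborel. (indicator {0..t} s * H s \<omega>)\<^sup>2) \<in> borel_measurable M"
    by measurable
  also have "(\<lambda>\<omega>. LINT s|lborel. (indicator {0..t} s * H s \<omega>)\<^sup>2) = (\<lambda>\<omega>. LINT s|lborel. indicator {0..t} s * (H s \<omega>)\<^sup>2)"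
    by (intro ext Bochner_Integration.integral_cong) (auto simp: indicator_def)
  finally have [measurable]: "(\<lambda>\<omega>. LINT s|lborel. indicator {0..t} s * (H s \<omega>)\<^sup>2) \<in> borel_measurable M" .
  show ?thesis unfolding exp_mart_def[abs_def] by measurable
qed

text \<open>One sequence serves both times, since the martingale identity is transferred for the
  same simple integrand at \<open>u\<close> and at \<open>v\<close>. Almost sure convergence of
  integrals and clocks comes from a subsequence, convergence of expectations from the uniform bound
  of \<open>exp_simple_L2\<close>.\<close>

lemma exp_mart_approx:
  assumes I: "ito_integral M F B H I" and K: "0 \<le> K" "\<forall>t\<ge>0. \<forall>\<omega>\<in>space M. \<bar>H t \<omega>\<bar> \<le> K"
    and uv: "0 \<le> u" "u \<le> v"
  shows "\<exists>S. (\<forall>k. simple_integrand F (S k)) \<and>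
    (\<forall>t\<in>{u, v}. AE \<omega> in M. (\<lambda>k. simple_integral (S k) B t \<omega>) \<longlonglongrightarrow> I t \<omega>) \<and>
    (\<forall>p \<beta>. \<forall>t\<in>{u, v}. \<forall>A\<in>sets M.
      (\<lambda>k. event_integral (\<lambda>\<omega>. ennreal (exp_simple p \<beta> (S k) t \<omega>)) A)
        \<longlonglongrightarrow> (event_integral (\<lambda>\<omega>. ennreal (exp_mart p \<beta> H I t \<omega>)) A))"
proof -
  obtain S where S': "\<forall>k. simple_integrand F (S k)" and SK': "\<forall>k t \<omega>. \<bar>simple_value (S k) t \<omega>\<bar> \<le> K"
    and c1': "\<forall>T\<ge>0. (\<lambda>k. integrand_error H (S k) T) \<longlonglongrightarrow> 0"
    and c2': "\<forall>t\<ge>0. (\<lambda>k. integral_error I (S k) t) \<longlonglongrightarrow> 0"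
    using ito_integral_bounded_approx[OF I K] by (elim exE conjE) (rule that)
  note S = S'[rule_format] and SK = SK'[rule_format] and c1 = c1'[rule_format] and c2 = c2'[rule_format]
  have v: "0 \<le> v" using uv by simp
  have Im: "I t \<in> borel_measurable M" if "0 \<le> t" for t
    using I that by (simp add: ito_integral_def)
  have p: "predictable_process M F H" using I by (simp add: ito_integral_def)
  have Sm [measurable]: "\<And>k. (\<lambda>(s, \<omega>). simple_value (S k) s \<omega>) \<in> borel_measurable (borel \<Otimes>\<^sub>M M)"
    using simple_value_measurable[OF S] .
  have Nm: "simple_integral (S k) B t \<in> borel_measurable M" if "0 \<le> t" for k t
    using that S by (auto intro!: measurable_F_M[of t] simple_integral_adapted measurable_B)
  define D where "D t k \<omega> = square_integral t (\<lambda>s. simple_value (S k) s \<omega> - H s \<omega>)" for t k \<omega>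
  have ints: "integrable lborel (\<lambda>s. indicator {0..t} s * (simple_value (S k) s \<omega>)\<^sup>2)"
    "integrable lborel (\<lambda>s. indicator {0..t} s * (H s \<omega>)\<^sup>2)"
    "integrable lborel (\<lambda>s. indicator {0..t} s * (simple_value (S k) s \<omega> - H s \<omega>)\<^sup>2)"
    if t: "0 \<le> t" and \<omega>: "\<omega> \<in> space M" for t \<omega> k
  proof -
    have 1: "(\<lambda>s. simple_value (S k) s \<omega>) \<in> borel_measurable borel"
      using measurable_compose[OF measurable_Pair2'[OF \<omega>] Sm[of k]] by simp
    have 2: "(\<lambda>s. indicator {0..t} s * H s \<omega>) \<in> borel_measurable borel"
      using measurable_compose[OF measurable_Pair2'[OF \<omega>] predictable_measurable[OF p t]] by simp
    note [measurable] = 1 2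
    have e: "(\<lambda>s. (indicator {0..t} s * H s \<omega>)\<^sup>2) = (\<lambda>s. indicator {0..t} s * (H s \<omega>)\<^sup>2)"
      "(\<lambda>s. (indicator {0..t} s * simple_value (S k) s \<omega> - indicator {0..t} s * H s \<omega>)\<^sup>2)
        = (\<lambda>s. indicator {0..t} s * (simple_value (S k) s \<omega> - H s \<omega>)\<^sup>2)"
      by (auto simp: indicator_def)
    have m: "(\<lambda>s. (indicator {0..t} s * H s \<omega>)\<^sup>2) \<in> borel_measurable borel"
      "(\<lambda>s. (indicator {0..t} s * simple_value (S k) s \<omega> - indicator {0..t} s * H s \<omega>)\<^sup>2) \<in> borel_measurable borel"
      by measurable
    show "integrable lborel (\<lambda>s. indicator {0..t} s * (simple_value (S k) s \<omega>)\<^sup>2)"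
      using has_bochner_integral_clock[OF S t] by (auto simp: has_bochner_integral_iff)
    have HK: "\<bar>H s \<omega>\<bar> \<le> K" if "s \<in> {0..t}" for s using K(2) that \<omega> by auto
    show "integrable lborel (\<lambda>s. indicator {0..t} s * (H s \<omega>)\<^sup>2)"
      using m(1) HK K(1) unfolding e
      by (intro integrable_indicator_bounded[where K="K\<^sup>2"]) (auto simp: abs_le_square_iff[symmetric])
    show "integrable lborel (\<lambda>s. indicator {0..t} s * (simple_value (S k) s \<omega> - H s \<omega>)\<^sup>2)"
    proof (rule integrable_indicator_bounded[where K="(2 * K)\<^sup>2"])
      fix s assume s: "s \<in> {0..t}"
      have "\<bar>simple_value (S k) s \<omega> - H s \<omega>\<bar> \<le> \<bar>2 * K\<bar>"
        using HK[OF s] SK[of k s \<omega>] by linarith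
      then show "\<bar>(simple_value (S k) s \<omega> - H s \<omega>)\<^sup>2\<bar> \<le> (2 * K)\<^sup>2"
        unfolding abs_le_square_iff by simp
    qed (use m(2) in \<open>simp add: e\<close>)
  qed
  have Dnn: "ennreal (D t k \<omega>) = (\<integral>\<^sup>+s\<in>{0..t}. ennreal ((simple_value (S k) s \<omega> - H s \<omega>)\<^sup>2) \<partial>lborel)"
    if "0 \<le> t" "\<omega> \<in> space M" for t k \<omega>
  proof -
    have "(\<integral>\<^sup>+s\<in>{0..t}. ennreal ((simple_value (S k) s \<omega> - H s \<omega>)\<^sup>2) \<partial>lborel)
      = (\<integral>\<^sup>+s. ennreal (indicator {0..t} s * (simple_value (S k) s \<omega> - H s \<omega>)\<^sup>2) \<partial>lborel)"
      by (intro nn_integral_cong) (auto simp: indicator_def)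
    then show ?thesis
      using nn_integral_eq_integral[OF ints(3)[OF that, of k]] by (simp add: D_def)
  qed
  have Dpos: "0 \<le> D t k \<omega>" for t k \<omega> unfolding D_def by (intro Bochner_Integration.integral_nonneg) auto
  have Dm: "D t k \<in> borel_measurable M" if t: "0 \<le> t" for t k
  proof -
    note [measurable] = predictable_measurable[OF p t]
    have "(\<lambda>\<omega>. LINT s|lborel. (indicator {0..t} s * simple_value (S k) s \<omega> - indicator {0..t} s * H s \<omega>)\<^sup>2) \<in> borel_measurable M"
      by measurable
    also have "(\<lambda>\<omega>. LINT s|lborel. (indicator {0..t} s * simple_value (S k) s \<omega> - indicator {0..t} s * H s \<omega>)\<^sup>2) = D t k"
      unfolding D_def by (intro ext Bochner_Integration.integral_cong) (auto simp: indicator_def)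
    finally show ?thesis .
  qed
  \<comment> \<open>One variable collects the errors at both times, so a single subsequence works
    for all of them; the integrand error up to \<open>v\<close> dominates the one up to
    \<open>u\<close>.\<close>
  define g where "g k \<omega> = (simple_integral (S k) B u \<omega> - I u \<omega>)\<^sup>2 + (simple_integral (S k) B v \<omega> - I v \<omega>)\<^sup>2 + D v k \<omega>" for k \<omega>
  note [measurable] = Dm[OF v] Nm[OF uv(1)] Nm[OF v] Im[OF uv(1)] Im[OF v]
  have "(\<integral>\<^sup>+ \<omega>. ennreal (g k \<omega>) \<partial>M) = (integral_error I (S k) u)
     + (integral_error I (S k) v)
     + (integrand_error H (S k) v)" for k
  proof -
    have "(\<integral>\<^sup>+ \<omega>. ennreal (g k \<omega>) \<partial>M) = (integral_error I (S k) u)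
     + (integral_error I (S k) v) + (\<integral>\<^sup>+ \<omega>. ennreal (D v k \<omega>) \<partial>M)"
      by (simp add: g_def Dpos nn_integral_add)
    also have "(\<integral>\<^sup>+ \<omega>. ennreal (D v k \<omega>) \<partial>M)
       = (integrand_error H (S k) v)"
      by (intro nn_integral_cong Dnn[OF v])
    finally show ?thesis .
  qed
  moreover have "(\<lambda>k. (integral_error I (S k) u)
     + (integral_error I (S k) v)
     + (integrand_error H (S k) v)) \<longlonglongrightarrow> 0 + 0 + 0"
    by (intro tendsto_add c1 c2 uv(1) v)
  ultimately have lim: "(\<lambda>k. \<integral>\<^sup>+ \<omega>. ennreal (g k \<omega>) \<partial>M) \<longlonglongrightarrow> 0" by simp
  have "\<exists>r::nat\<Rightarrow>nat. strict_mono r \<and> (AE \<omega> in M. (\<lambda>k. g (r k) \<omega>) \<longlonglongrightarrow> 0)"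
    by (rule nn_integral_0_AE_subseq[OF _ _ lim]) (auto simp: g_def[abs_def] Dpos)
  then obtain r where r: "AE \<omega> in M. (\<lambda>k. g (r k) \<omega>) \<longlonglongrightarrow> 0" by blast
  have conv: "AE \<omega> in M. (\<lambda>k. simple_integral (S (r k)) B t \<omega>) \<longlonglongrightarrow> I t \<omega>
      \<and> (\<lambda>k. clock (S (r k)) t \<omega>) \<longlonglongrightarrow> square_integral t (\<lambda>s. H s \<omega>)" if t: "t \<in> {u, v}" for t
    using r AE_space
  proof eventually_elim
    fix \<omega> assume g0: "(\<lambda>k. g (r k) \<omega>) \<longlonglongrightarrow> 0" and \<omega>: "\<omega> \<in> space M"
    have t0: "0 \<le> t" "t \<le> v" using t uv by auto
    have "(\<lambda>k. (simple_integral (S (r k)) B t \<omega> - I t \<omega>)\<^sup>2) \<longlonglongrightarrow> 0"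
      by (rule tendsto_sandwich[OF _ _ tendsto_const g0]) (use t Dpos in \<open>auto simp: g_def intro!: always_eventually add_nonneg_nonneg\<close>)
    then have 1: "(\<lambda>k. simple_integral (S (r k)) B t \<omega>) \<longlonglongrightarrow> I t \<omega>" by (rule tendsto_square_0_cancel)
    have "D t k \<omega> \<le> g k \<omega>" for k
    proof -
      have "D t k \<omega> \<le> D v k \<omega>" unfolding D_def
        by (intro integral_mono ints \<omega> v t0) (use t0 in \<open>auto simp: indicator_def\<close>)
      then show ?thesis by (auto simp: g_def intro: add_increasing)
    qed
    then have "(\<lambda>k. D t (r k) \<omega>) \<longlonglongrightarrow> 0"
      by (intro tendsto_sandwich[OF _ _ tendsto_const g0]) (auto simp: Dpos intro!: always_eventually)
    then have "(\<lambda>k. square_integral t (\<lambda>s. simple_value (S (r k)) s \<omega>)) \<longlonglongrightarrow> square_integral t (\<lambda>s. H s \<omega>)"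
      using K(2) \<omega> unfolding D_def
      by (intro integral_square_tendsto[where K=K] ints t0 SK \<omega>) auto
    moreover have "square_integral t (\<lambda>s. simple_value (S k) s \<omega>) = clock (S k) t \<omega>" for k
      using has_bochner_integral_clock[OF S t0(1)] by (simp add: has_bochner_integral_iff)
    ultimately show "(\<lambda>k. simple_integral (S (r k)) B t \<omega>) \<longlonglongrightarrow> I t \<omega>
      \<and> (\<lambda>k. clock (S (r k)) t \<omega>) \<longlonglongrightarrow> square_integral t (\<lambda>s. H s \<omega>)"
      using 1 by simp
  qed
  show ?thesis
  proof (intro exI[of _ "\<lambda>k. S (r k)"] conjI allI ballI)
    show "simple_integrand F (S (r k))" for k by (rule S)
    show "AE \<omega> in M. (\<lambda>k. simple_integral (S (r k)) B t \<omega>) \<longlonglongrightarrow> I t \<omega>" if "t \<in> {u, v}" for t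
      using conv[OF that] by auto
    fix p \<beta> t A assume t: "t \<in> {u, v}" and A: "A \<in> sets M"
    have t0: "0 \<le> t" using t uv by auto
    show "(\<lambda>k. event_integral (\<lambda>\<omega>. ennreal (exp_simple p \<beta> (S (r k)) t \<omega>)) A)
        \<longlonglongrightarrow> (event_integral (\<lambda>\<omega>. ennreal (exp_mart p \<beta> H I t \<omega>)) A)"
    proof (rule nn_integral_L2_bounded_tendsto[OF _ exp_mart_measurable[OF I t0] A])
      show "exp_simple p \<beta> (S (r k)) t \<in> borel_measurable M" for k
        by (rule measurable_F_M[OF t0 exp_simple_adapted[OF S t0]])
      show "AE \<omega> in M. (\<lambda>k. exp_simple p \<beta> (S (r k)) t \<omega>) \<longlonglongrightarrow> exp_mart p \<beta> H I t \<omega>"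
        using conv[OF t] unfolding exp_simple_def exp_mart_def
        by eventually_elim (intro tendsto_intros, auto)
      show "(\<integral>\<^sup>+ \<omega>. ennreal ((exp_simple p \<beta> (S (r k)) t \<omega>)\<^sup>2) \<partial>M) \<le> ennreal (exp (p\<^sup>2 * (K\<^sup>2 + \<beta>\<^sup>2) * t))" for k
        by (rule exp_simple_L2[OF S SK t0])
    qed (auto simp: exp_simple_def exp_mart_def)
  qed
qed

text \<open>The Ito integral is adapted only in this sense.\<close>

definition known :: "real \<Rightarrow> 'a set \<Rightarrow> bool" where
  "known t A \<longleftrightarrow> A \<in> sets M \<and> (\<exists>A'\<in>sets (F t). AE \<omega> in M. \<omega> \<in> A \<longleftrightarrow> \<omega> \<in> A')"

lemma known_sets: "known t A \<Longrightarrow> A \<in> sets M"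
  by (simp add: known_def)

lemma known_mono: "known s A \<Longrightarrow> 0 \<le> s \<Longrightarrow> s \<le> t \<Longrightarrow> known t A"
  unfolding known_def using sets_F_mono by blast

lemma known_space: "0 \<le> t \<Longrightarrow> known t (space M)"
  unfolding known_def using sets.top[of "F t"] by (auto simp: space_F intro!: bexI[of _ "space M"])

lemma known_Int:
  assumes "known t A" "known t C"
  shows "known t (A \<inter> C)"
proof -
  obtain A' C' where *: "A' \<in> sets (F t)" "AE \<omega> in M. \<omega> \<in> A \<longleftrightarrow> \<omega> \<in> A'"
     "C' \<in> sets (F t)" "AE \<omega> in M. \<omega> \<in> C \<longleftrightarrow> \<omega> \<in> C'" using assms by (auto simp: known_def)
  have "AE \<omega> in M. \<omega> \<in> A \<inter> C \<longleftrightarrow> \<omega> \<in> A' \<inter> C'" using *(2,4) by eventually_elim auto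
  with * assms show ?thesis unfolding known_def by blast
qed

lemma known_Diff:
  assumes "known t A" "known t C"
  shows "known t (A - C)"
proof -
  obtain A' C' where *: "A' \<in> sets (F t)" "AE \<omega> in M. \<omega> \<in> A \<longleftrightarrow> \<omega> \<in> A'"
     "C' \<in> sets (F t)" "AE \<omega> in M. \<omega> \<in> C \<longleftrightarrow> \<omega> \<in> C'" using assms by (auto simp: known_def)
  have "AE \<omega> in M. \<omega> \<in> A - C \<longleftrightarrow> \<omega> \<in> A' - C'" using *(2,4) by eventually_elim auto
  with * assms show ?thesis unfolding known_def by blast
qed

text \<open>\<open>A\<close> may be replaced by an event of \<open>F u\<close> that differs by a
  null set; the identity then holds for every approximating simple integrand and survives the
  limit.\<close>

lemma exp_mart_martingale:
  assumes I: "ito_integral M F B H I" and K: "0 \<le> K" "\<forall>t\<ge>0. \<forall>\<omega>\<in>space M. \<bar>H t \<omega>\<bar> \<le> K"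
    and uv: "0 \<le> u" "u \<le> v" and A: "known u A"
  shows "(event_integral (\<lambda>\<omega>. ennreal (exp_mart p \<beta> H I v \<omega>)) A)
       = (event_integral (\<lambda>\<omega>. ennreal (exp_mart p \<beta> H I u \<omega>)) A)"
proof -
  obtain A' where A': "A' \<in> sets (F u)" "AE \<omega> in M. \<omega> \<in> A \<longleftrightarrow> \<omega> \<in> A'"
    using A by (auto simp: known_def)
  have sub: "(\<integral>\<^sup>+ \<omega>. f \<omega> * indicator A \<omega> \<partial>M) = (\<integral>\<^sup>+ \<omega>. f \<omega> * indicator A' \<omega> \<partial>M)" for f :: "'a \<Rightarrow> ennreal"
    by (rule nn_integral_cong_AE) (use A'(2) in eventually_elim, auto simp: indicator_def)
  have A'M: "A' \<in> sets M" using A' sets_F uv by blast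
  obtain S where S': "\<forall>k. simple_integrand F (S k)" and
    lim1: "\<forall>s\<in>{u, v}. AE \<omega> in M. (\<lambda>k. simple_integral (S k) B s \<omega>) \<longlonglongrightarrow> I s \<omega>" and
    lim': "\<forall>p \<beta>. \<forall>s\<in>{u, v}. \<forall>A\<in>sets M.
      (\<lambda>k. event_integral (\<lambda>\<omega>. ennreal (exp_simple p \<beta> (S k) s \<omega>)) A)
        \<longlonglongrightarrow> (event_integral (\<lambda>\<omega>. ennreal (exp_mart p \<beta> H I s \<omega>)) A)"
    using exp_mart_approx[OF I K uv] by (elim exE conjE) (rule that)
  note S = S'[rule_format] and lim = lim'[rule_format]
  \<comment> \<open>For every \<open>k\<close> the integrals at \<open>u\<close> and
    \<open>v\<close> agree, so the sequence for \<open>v\<close> converges to the limit for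
    \<open>u\<close>.\<close>
  have "(\<lambda>k. event_integral (\<lambda>\<omega>. ennreal (exp_simple p \<beta> (S k) v \<omega>)) A')
        \<longlonglongrightarrow> (event_integral (\<lambda>\<omega>. ennreal (exp_mart p \<beta> H I u \<omega>)) A')"
    using lim[OF _ A'M, where s=u and p=p and \<beta>=\<beta>] exp_simple_martingale[OF S uv A'(1)] by simp
  then show ?thesis
    unfolding sub using lim[OF _ A'M, where s=v and p=p and \<beta>=\<beta>] LIMSEQ_unique by blast
qed

lemma nn_integral_exp_mart:
  assumes I: "ito_integral M F B H I" and K: "0 \<le> K" "\<forall>t\<ge>0. \<forall>\<omega>\<in>space M. \<bar>H t \<omega>\<bar> \<le> K"
    and t: "0 \<le> t"
  shows "(\<integral>\<^sup>+ \<omega>. ennreal (exp_mart p \<beta> H I t \<omega>) \<partial>M) = 1"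
proof -
  obtain S where S': "\<forall>k. simple_integrand F (S k)" and
    lim1: "\<forall>s\<in>{t, t}. AE \<omega> in M. (\<lambda>k. simple_integral (S k) B s \<omega>) \<longlonglongrightarrow> I s \<omega>" and
    lim': "\<forall>p \<beta>. \<forall>s\<in>{t, t}. \<forall>A\<in>sets M.
      (\<lambda>k. event_integral (\<lambda>\<omega>. ennreal (exp_simple p \<beta> (S k) s \<omega>)) A)
        \<longlonglongrightarrow> (event_integral (\<lambda>\<omega>. ennreal (exp_mart p \<beta> H I s \<omega>)) A)"
    using exp_mart_approx[OF I K t order_refl] by (elim exE conjE) (rule that)
  note S = S'[rule_format] and lim = lim'[rule_format]
  have ind: "(\<integral>\<^sup>+ \<omega>. f \<omega> * indicator (space M) \<omega> \<partial>M) = (\<integral>\<^sup>+ \<omega>. f \<omega> \<partial>M)" for f :: "'a \<Rightarrow> ennreal"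
    by (intro nn_integral_cong) simp
  have "(\<lambda>k. 1) \<longlonglongrightarrow> (\<integral>\<^sup>+ \<omega>. ennreal (exp_mart p \<beta> H I t \<omega>) \<partial>M)"
    using lim[where s=t and A="space M" and p=p and \<beta>=\<beta>] by (simp add: ind nn_integral_exp_simple[OF S t])
  then show ?thesis by (simp add: LIMSEQ_const_iff)
qed

text \<open>The pointwise \<open>lim\<close> of the adapted simple integrals is
  \<open>F t\<close>-measurable on the whole space and agrees with \<open>I t\<close> wherever they
  converge to it, hence almost surely.\<close>

lemma ito_integral_version:
  assumes I: "ito_integral M F B H I" and K: "0 \<le> K" "\<forall>t\<ge>0. \<forall>\<omega>\<in>space M. \<bar>H t \<omega>\<bar> \<le> K"
    and t: "0 \<le> t"
  obtains J where "J \<in> borel_measurable (F t)" "AE \<omega> in M. I t \<omega> = J \<omega>"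
proof -
  obtain S where S': "\<forall>k. simple_integrand F (S k)" and
    lim1: "\<forall>s\<in>{t, t}. AE \<omega> in M. (\<lambda>k. simple_integral (S k) B s \<omega>) \<longlonglongrightarrow> I s \<omega>" and
    lim': "\<forall>p \<beta>. \<forall>s\<in>{t, t}. \<forall>A\<in>sets M.
      (\<lambda>k. event_integral (\<lambda>\<omega>. ennreal (exp_simple p \<beta> (S k) s \<omega>)) A)
        \<longlonglongrightarrow> (event_integral (\<lambda>\<omega>. ennreal (exp_mart p \<beta> H I s \<omega>)) A)"
    using exp_mart_approx[OF I K t order_refl] by (elim exE conjE) (rule that)
  note S = S'[rule_format] and lim = lim'[rule_format]
  show ?thesis
  proof
    show "(\<lambda>\<omega>. lim (\<lambda>k. simple_integral (S k) B t \<omega>)) \<in> borel_measurable (F t)"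
      by (intro borel_measurable_lim_metric simple_integral_adapted S measurable_B t)
    show "AE \<omega> in M. I t \<omega> = lim (\<lambda>k. simple_integral (S k) B t \<omega>)"
      using lim1 by (auto elim!: eventually_mono simp: limI)
  qed
qed

lemma known_less:
  assumes "Z \<in> borel_measurable M" "Z' \<in> borel_measurable (F t)" "AE \<omega> in M. Z \<omega> = Z' \<omega>" "0 \<le> t"
  shows "known t {\<omega>\<in>space M. Z \<omega> < (y::real)}"
proof -
  have "{\<omega>\<in>space (F t). Z' \<omega> < y} \<in> sets (F t)" using assms(2) by measurable
  moreover have "AE \<omega> in M. \<omega> \<in> {\<omega>\<in>space M. Z \<omega> < y} \<longleftrightarrow> \<omega> \<in> {\<omega>\<in>space (F t). Z' \<omega> < y}"
    using assms(3) AE_space by eventually_elim (use assms in \<open>auto simp: space_F\<close>)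
  moreover have "{\<omega>\<in>space M. Z \<omega> < y} \<in> sets M" using assms(1) by measurable
  ultimately show ?thesis unfolding known_def by blast
qed

end

section \<open>Ruin probabilities\<close>

context two_BMs
begin

text \<open>What is known at an earlier grid time stays known, so first passage at step
  \<open>n\<close> and absence of passage up to step \<open>n\<close> are both decided at time
  \<open>\<tau> n\<close>.\<close>

lemma first_passage_known:
  fixes \<tau> :: "nat \<Rightarrow> real"
  assumes "\<And>j. 0 \<le> \<tau> j" "mono \<tau>" "\<And>j. known (\<tau> j) (b j)"
  shows "known (\<tau> n) (b n - (\<Union>i<n. b i))" "known (\<tau> n) (space M - (\<Union>i\<le>n. b i))"
proof -
  have *: "known (\<tau> n) (A - (\<Union>i<k. b i))" if "known (\<tau> n) A" "k \<le> Suc n" for A k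
    using that(2)
  proof (induction k)
    case (Suc k)
    then have "known (\<tau> n) (b k)"
      using assms known_mono[of "\<tau> k" "b k" "\<tau> n"] by (auto simp: mono_def)
    moreover have "known (\<tau> n) (A - (\<Union>i<k. b i))" using Suc by simp
    ultimately have "known (\<tau> n) ((A - (\<Union>i<k. b i)) - b k)" by (rule known_Diff[rotated])
    also have "(A - (\<Union>i<k. b i)) - b k = A - (\<Union>i<Suc k. b i)" by (auto simp: less_Suc_eq)
    finally show ?case .
  qed (use that in simp)
  show "known (\<tau> n) (b n - (\<Union>i<n. b i))" by (rule *) (use assms in auto)
  show "known (\<tau> n) (space M - (\<Union>i\<le>n. b i))"
    unfolding lessThan_Suc_atMost[symmetric] by (rule *) (use assms known_space in auto)
qed

text \<open>Optional stopping at the first passage or at step \<open>n\<close>, whichever comes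
  first. In the induction the martingale moves from \<open>\<tau> n\<close> to
  \<open>\<tau> (Suc n)\<close> on the event of no passage so far, and that event is then split by
  \<open>b (Suc n)\<close>.\<close>

lemma first_passage_identity:
  fixes \<tau> :: "nat \<Rightarrow> real"
  assumes Zm: "\<And>t. 0 \<le> t \<Longrightarrow> Z t \<in> borel_measurable M"
    and mart: "\<And>u v A. 0 \<le> u \<Longrightarrow> u \<le> v \<Longrightarrow> known u A \<Longrightarrow>
      event_integral (Z v) A = event_integral (Z u) A"
    and \<tau>: "\<And>j. 0 \<le> \<tau> j" "mono \<tau>" and b: "\<And>j. known (\<tau> j) (b j)"
  shows "(\<integral>\<^sup>+ \<omega>. Z (\<tau> 0) \<omega> \<partial>M) = (\<Sum>j\<le>n. event_integral (Z (\<tau> j)) (b j - (\<Union>i<j. b i)))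
      + (event_integral (Z (\<tau> n)) (space M - (\<Union>i\<le>n. b i)))"
proof -
  note kn = first_passage_known[of \<tau> b, OF \<tau> b]
  note [measurable] = Zm[OF \<tau>(1)] known_sets[OF b]
  have split: "(event_integral (Z (\<tau> k)) A) = (event_integral (Z (\<tau> k)) (b k \<inter> A))
      + (event_integral (Z (\<tau> k)) (A - b k))" if [measurable]: "A \<in> sets M" for A k
  proof -
    have "(event_integral (Z (\<tau> k)) A) = (\<integral>\<^sup>+ \<omega>. Z (\<tau> k) \<omega> * indicator (b k \<inter> A) \<omega>
      + Z (\<tau> k) \<omega> * indicator (A - b k) \<omega> \<partial>M)"
      by (intro nn_integral_cong) (auto simp: indicator_def)
    then show ?thesis by (simp add: nn_integral_add)
  qed
  show ?thesis
  proof (induction n)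
    case 0
    have "(\<integral>\<^sup>+ \<omega>. Z (\<tau> 0) \<omega> \<partial>M) = (event_integral (Z (\<tau> 0)) (space M))"
      by (intro nn_integral_cong) simp
    also note split[of "space M" 0]
    also have "b 0 \<inter> space M = b 0" using sets.sets_into_space[OF known_sets[OF b]] by auto
    finally show ?case by simp
  next
    case (Suc n)
    have "(event_integral (Z (\<tau> n)) (space M - (\<Union>i\<le>n. b i)))
       = (event_integral (Z (\<tau> (Suc n))) (space M - (\<Union>i\<le>n. b i)))"
      using \<tau> kn by (intro mart[symmetric]) (auto simp: mono_def)
    also note split[OF known_sets[OF kn(2)]]
    also have "b (Suc n) \<inter> (space M - (\<Union>i\<le>n. b i)) = b (Suc n) - (\<Union>i<Suc n. b i)"
      using sets.sets_into_space[OF known_sets[OF b[of "Suc n"]]] by (auto simp: less_Suc_eq_le)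
    also have "(space M - (\<Union>i\<le>n. b i)) - b (Suc n) = space M - (\<Union>i\<le>Suc n. b i)"
      by (auto simp: le_Suc_eq)
    finally show ?case unfolding Suc.IH by (simp add: add.assoc)
  qed
qed

lemma disjoint_first_passage: "disjoint_family_on (\<lambda>j. b j - (\<Union>i<j. b i)) A" for b :: "nat \<Rightarrow> 'b set"
  unfolding disjoint_family_on_def
proof (intro ballI impI)
  fix m n :: nat assume "m \<noteq> n"
  then show "(b m - (\<Union>i<m. b i)) \<inter> (b n - (\<Union>i<n. b i)) = {}"
    by (cases m n rule: linorder_cases) auto
qed

text \<open>Being negative is an open condition, so by continuity it also holds at a nearby dyadic
  time. The index bound \<open>4 ^ m\<close> lets the mesh \<open>1 / 2 ^ m\<close> and the horizon
  \<open>2 ^ m\<close> improve together while each \<open>m\<close> uses finitely many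
  times.\<close>

lemma ruin_event_sets:
  assumes Xm: "\<And>t. 0 \<le> t \<Longrightarrow> X t \<in> borel_measurable M"
    and Xc: "\<And>\<omega>. \<omega> \<in> space M \<Longrightarrow> continuous_on {0..} (\<lambda>t. X t \<omega> :: real)"
  shows "{\<omega>\<in>space M. \<exists>t\<ge>0. X t \<omega> < 0}
      = (\<Union>m. \<Union>j\<le>4 ^ m. {\<omega>\<in>space M. X (real j / 2 ^ m) \<omega> < 0})" (is "?R = ?U")
    "{\<omega>\<in>space M. \<exists>t\<ge>0. X t \<omega> < 0} \<in> sets M"
proof -
  show *: "?R = ?U"
  proof (intro equalityI subsetI)
    fix \<omega> assume "\<omega> \<in> ?R"
    then obtain t where \<omega>: "\<omega> \<in> space M" and t: "0 \<le> t" "X t \<omega> < 0" by auto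
    obtain d where d: "d > 0" "\<And>s. s \<in> {0..} \<Longrightarrow> dist s t < d \<Longrightarrow> dist (X s \<omega>) (X t \<omega>) < - X t \<omega>"
      using Xc[OF \<omega>, unfolded continuous_on_iff, rule_format, of t "- X t \<omega>"] t by auto
    obtain m1 :: nat where m1: "1 / d < 2 ^ m1" using real_arch_pow[of 2 "1 / d"] by auto
    obtain m2 :: nat where m2: "t < 2 ^ m2" using real_arch_pow[of 2 t] by auto
    define m where "m = max m1 m2"
    have "(2::real) ^ m1 \<le> 2 ^ m" "(2::real) ^ m2 \<le> 2 ^ m"
      by (auto simp: m_def intro!: power_increasing)
    then have m: "1 / d < 2 ^ m" "t < 2 ^ m" using m1 m2 by linarith+
    define j where "j = nat \<lfloor>t * 2 ^ m\<rfloor>"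
    have j: "real j \<le> t * 2 ^ m" "t * 2 ^ m < real j + 1"
      using t by (auto simp: j_def)
    have "real j < 2 ^ m * 2 ^ m" using j(1) m(2) by (meson le_less_trans mult_strict_right_mono zero_less_numeral zero_less_power)
    also have "(2::real) ^ m * 2 ^ m = real (4 ^ m)" by (simp add: power_mult_distrib[symmetric])
    finally have j4: "j \<le> 4 ^ m" by linarith
    have "real j / 2 ^ m \<le> t" "t < real j / 2 ^ m + 1 / 2 ^ m"
      using j by (auto simp: field_simps)
    moreover have "1 / 2 ^ m < d" using m(1) d(1) by (simp add: field_simps)
    ultimately have "dist (real j / 2 ^ m) t < d" by (simp add: dist_real_def)
    then have "dist (X (real j / 2 ^ m) \<omega>) (X t \<omega>) < - X t \<omega>" by (intro d(2)) auto
    then have "X (real j / 2 ^ m) \<omega> < 0" by (auto simp: dist_real_def abs_if split: if_splits)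
    then show "\<omega> \<in> ?U" using \<omega> j4 by blast
  next
    fix \<omega> assume "\<omega> \<in> ?U"
    then obtain m j where "\<omega> \<in> space M" "X (real j / 2 ^ m) \<omega> < 0" by auto
    then show "\<omega> \<in> ?R"
      by (auto intro!: exI[of _ "real j / 2 ^ m"])
  qed
  have [measurable]: "X (real j / 2 ^ m) \<in> borel_measurable M" for j m by (rule Xm) simp
  show "?R \<in> sets M" unfolding * by measurable
qed

text \<open>Stopping the martingale at the first grid time below zero; the grid ruin events increase
  to the ruin event.\<close>

lemma ruin_upper_bound:
  assumes Zm: "\<And>t. 0 \<le> t \<Longrightarrow> Z t \<in> borel_measurable M"
    and mart: "\<And>u v A. 0 \<le> u \<Longrightarrow> u \<le> v \<Longrightarrow> known u A \<Longrightarrow>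
      event_integral (Z v) A = event_integral (Z u) A"
    and one: "\<And>t. 0 \<le> t \<Longrightarrow> (\<integral>\<^sup>+ \<omega>. Z t \<omega> \<partial>M) = 1"
    and Xm: "\<And>t. 0 \<le> t \<Longrightarrow> X t \<in> borel_measurable M"
    and Xc: "\<And>\<omega>. \<omega> \<in> space M \<Longrightarrow> continuous_on {0..} (\<lambda>t. X t \<omega> :: real)"
    and Xk: "\<And>t y. 0 \<le> t \<Longrightarrow> known t {\<omega>\<in>space M. X t \<omega> < y}"
    and ge: "\<And>t. 0 \<le> t \<Longrightarrow> AE \<omega> in M. Z t \<omega> \<ge> ennreal (exp (\<rho> * x) * exp (- \<rho> * X t \<omega>))"
    and "\<rho> > 0"
  shows "prob {\<omega>\<in>space M. \<exists>t\<ge>0. X t \<omega> < 0} \<le> exp (- \<rho> * x)"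
proof -
  let ?G = "\<lambda>m. \<Union>j\<le>4 ^ m. {\<omega>\<in>space M. X (real j / 2 ^ m) \<omega> < 0}"
  have G_bound: "prob (?G m) \<le> exp (- \<rho> * x)" for m
  proof -
    define \<tau> where "\<tau> j = real j / 2 ^ m" for j
    define b where "b j = {\<omega>\<in>space M. X (\<tau> j) \<omega> < 0}" for j
    have \<tau>: "0 \<le> \<tau> j" "mono \<tau>" for j by (auto simp: \<tau>_def mono_def divide_right_mono)
    have b: "known (\<tau> j) (b j)" for j unfolding b_def by (rule Xk[OF \<tau>(1)])
    let ?D = "\<lambda>j. b j - (\<Union>i<j. b i)"
    have D: "?D j \<in> sets M" for j by (rule known_sets[OF first_passage_known(1)[of \<tau> b, OF \<tau> b]])
    have GD: "?G m = (\<Union>j\<le>4 ^ m. ?D j)"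
    proof -
      have "?G m = (\<Union>j\<le>4 ^ m. b j)" by (simp add: b_def \<tau>_def)
      also have "\<dots> = (\<Union>j\<le>4 ^ m. ?D j)"
      proof (intro equalityI subsetI)
        fix \<omega> assume "\<omega> \<in> (\<Union>j\<le>4 ^ m. b j)"
        then obtain j where j: "j \<le> 4 ^ m" "\<omega> \<in> b j" by auto
        define i where "i = (LEAST i. \<omega> \<in> b i)"
        have "\<omega> \<in> b i" "i \<le> j" "\<And>k. k < i \<Longrightarrow> \<omega> \<notin> b k"
          unfolding i_def using j by (auto intro: LeastI Least_le dest: not_less_Least)
        with j show "\<omega> \<in> (\<Union>j\<le>4 ^ m. ?D j)" by (auto intro!: bexI[of _ i])
      qed auto
      finally show ?thesis .
    qed
    \<comment> \<open>At a first passage \<open>X\<close> is negative, so \<open>Z\<close> is at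
      least \<open>exp (\<rho> * x)\<close> there.\<close>
    have "ennreal (exp (\<rho> * x)) * emeasure M (?D j) \<le> (event_integral (Z (\<tau> j)) (?D j))" for j
    proof -
      have "ennreal (exp (\<rho> * x)) * emeasure M (?D j) = (\<integral>\<^sup>+ \<omega>. ennreal (exp (\<rho> * x)) * indicator (?D j) \<omega> \<partial>M)"
        using D by (subst nn_integral_cmult_indicator) auto
      also have "\<dots> \<le> (event_integral (Z (\<tau> j)) (?D j))"
      proof (rule nn_integral_mono_AE, use ge[OF \<tau>(1)[of j]] in eventually_elim)
        fix \<omega> assume Z: "Z (\<tau> j) \<omega> \<ge> ennreal (exp (\<rho> * x) * exp (- \<rho> * X (\<tau> j) \<omega>))"
        show "ennreal (exp (\<rho> * x)) * indicator (?D j) \<omega> \<le> Z (\<tau> j) \<omega> * indicator (?D j) \<omega>"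
        proof (cases "\<omega> \<in> ?D j")
          case True
          then have "X (\<tau> j) \<omega> < 0" by (auto simp: b_def)
          then have "1 \<le> exp (- \<rho> * X (\<tau> j) \<omega>)" using \<open>\<rho> > 0\<close> by (simp add: mult_nonneg_nonpos)
          then have "exp (\<rho> * x) \<le> exp (\<rho> * x) * exp (- \<rho> * X (\<tau> j) \<omega>)" by simp
          then have "ennreal (exp (\<rho> * x)) \<le> Z (\<tau> j) \<omega>" by (rule order_trans[OF ennreal_leI Z])
          then show ?thesis using True by simp
        qed simp
      qed
      finally show ?thesis .
    qed
    then have "(\<Sum>j\<le>4 ^ m. ennreal (exp (\<rho> * x)) * emeasure M (?D j))
       \<le> (\<Sum>j\<le>4 ^ m. event_integral (Z (\<tau> j)) (?D j))" by (intro sum_mono)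
    \<comment> \<open>The share of the survivors in the stopping identity is nonnegative and is
      dropped.\<close>
    also have "\<dots> \<le> (\<integral>\<^sup>+ \<omega>. Z (\<tau> 0) \<omega> \<partial>M)"
      by (rule le_iff_add[THEN iffD2, OF exI, OF first_passage_identity[of Z \<tau> b "4 ^ m", OF Zm mart \<tau> b]])
    also have "\<dots> = 1" by (rule one[OF \<tau>(1)])
    also have "(\<Sum>j\<le>4 ^ m. ennreal (exp (\<rho> * x)) * emeasure M (?D j)) = ennreal (exp (\<rho> * x)) * emeasure M (?G m)"
      unfolding GD sum_distrib_left[symmetric] using D disjoint_first_passage[of b "{..4 ^ m}"]
      by (subst sum_emeasure) auto
    finally have "ennreal (exp (\<rho> * x) * prob (?G m)) \<le> ennreal 1"
      by (simp add: emeasure_eq_measure ennreal_mult)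
    then have "exp (\<rho> * x) * prob (?G m) \<le> 1" by (subst (asm) ennreal_le_iff) auto
    then show ?thesis by (simp add: exp_minus field_simps)
  qed
  have [measurable]: "X (real j / 2 ^ m) \<in> borel_measurable M" for j m by (rule Xm) simp
  have "incseq ?G"
  proof (rule incseq_SucI)
    fix m show "?G m \<subseteq> ?G (Suc m)"
    proof
      fix \<omega> assume "\<omega> \<in> ?G m"
      then obtain j where "j \<le> 4 ^ m" "\<omega> \<in> space M" "X (real j / 2 ^ m) \<omega> < 0" by auto
      \<comment> \<open>Grid point \<open>j\<close> of level \<open>m\<close> is grid point
        \<open>2 * j\<close> of the next level, and
        \<open>2 * 4 ^ m \<le> 4 ^ Suc m\<close>.\<close>
      moreover have "real (2 * j) / 2 ^ Suc m = real j / 2 ^ m" by simp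
      ultimately show "\<omega> \<in> ?G (Suc m)" by (intro UN_I[of "2 * j"]) auto
    qed
  qed
  then have "(\<lambda>m. prob (?G m)) \<longlonglongrightarrow> prob (\<Union>m. ?G m)"
    by (intro finite_Lim_measure_incseq) auto
  then have "prob (\<Union>m. ?G m) \<le> exp (- \<rho> * x)"
    by (rule LIMSEQ_le_const2) (use G_bound in auto)
  then show ?thesis using ruin_event_sets(1)[of X, OF Xm Xc] by simp
qed

text \<open>On the event of overshooting below \<open>- e\<close> the martingale is moved forward to the horizon
  \<open>T\<close>; there dominated convergence applies, since by path continuity the overshoot disappears
  as the grid is refined.\<close>

lemma ruin_lower_bound:
  assumes Zm: "\<And>t. 0 \<le> t \<Longrightarrow> Z t \<in> borel_measurable M"
    and mart: "\<And>u v A. 0 \<le> u \<Longrightarrow> u \<le> v \<Longrightarrow> known u A \<Longrightarrow>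
      event_integral (Z v) A = event_integral (Z u) A"
    and one: "\<And>t. 0 \<le> t \<Longrightarrow> (\<integral>\<^sup>+ \<omega>. Z t \<omega> \<partial>M) = 1"
    and Xm: "\<And>t. 0 \<le> t \<Longrightarrow> X t \<in> borel_measurable M"
    and Xc: "\<And>\<omega>. \<omega> \<in> space M \<Longrightarrow> continuous_on {0..} (\<lambda>t. X t \<omega> :: real)"
    and Xk: "\<And>t y. 0 \<le> t \<Longrightarrow> known t {\<omega>\<in>space M. X t \<omega> < y}"
    and X0: "AE \<omega> in M. X 0 \<omega> = x" and "0 \<le> x"
    and le: "\<And>t. 0 \<le> t \<Longrightarrow> AE \<omega> in M. Z t \<omega> \<le> ennreal (exp (\<rho> * x) * exp (- \<rho> * X t \<omega>))"
    and surv: "\<And>t. 0 \<le> t \<Longrightarrow> (event_integral (Z t) {\<omega>. 0 \<le> X t \<omega>}) \<le> ennreal (C * exp (- \<gamma> * t))"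
    and "\<rho> > 0" "\<gamma> > 0" "C \<ge> 0"
  shows "exp (- \<rho> * x) \<le> prob {\<omega>\<in>space M. \<exists>t\<ge>0. X t \<omega> < 0}"
proof -
  let ?R = "{\<omega>\<in>space M. \<exists>t\<ge>0. X t \<omega> < 0}"
  note Rm = ruin_event_sets(2)[of X, OF Xm Xc]
  have T_bound: "1 \<le> exp (\<rho> * x + \<rho> * e) * prob ?R + C * exp (- \<gamma> * T)" if e: "e > 0" and T: "T > 0" for e T
  proof -
    \<comment> \<open>\<open>Suc n\<close> steps of equal length; the last grid point is exactly the
      horizon \<open>T\<close>.\<close>
    define \<tau> where "\<tau> n j = T * real j / real (Suc n)" for n j
    define b where "b n j = {\<omega>\<in>space M. X (\<tau> n j) \<omega> < 0}" for n j
    define D where "D n j = b n j - (\<Union>i<j. b n i)" for n j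
    \<comment> \<open>First passage at step \<open>j\<close> that lands more than \<open>e\<close>
      below zero, where the comparison with \<open>exp (- \<rho> * X)\<close> gives no uniform bound
      on \<open>Z\<close>.\<close>
    define OV where "OV n j = D n j \<inter> {\<omega>\<in>space M. X (\<tau> n j) \<omega> < - e}" for n j
    define A where "A n = (\<Union>j\<le>Suc n. OV n j)" for n
    have \<tau>: "0 \<le> \<tau> n j" "mono (\<tau> n)" for n j
      using T by (auto simp: \<tau>_def mono_def intro!: divide_right_mono mult_left_mono)
    have \<tau>T: "\<tau> n j \<le> T" if "j \<le> Suc n" for n j
      using mult_left_mono[of "real j" "real (Suc n)" T] that T by (simp add: \<tau>_def pos_divide_le_eq)
    have \<tau>_end: "\<tau> n (Suc n) = T" for n by (simp add: \<tau>_def)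
    have b: "known (\<tau> n j) (b n j)" for n j unfolding b_def by (rule Xk[OF \<tau>(1)])
    have Dk: "known (\<tau> n j) (D n j)" for n j
      unfolding D_def by (rule first_passage_known(1)[of "\<tau> n" "b n", OF \<tau> b])
    have OVk: "known (\<tau> n j) (OV n j)" for n j
      unfolding OV_def by (intro known_Int Dk Xk \<tau>)
    note [measurable] = known_sets[OF OVk] known_sets[OF Dk] Zm[OF \<tau>(1)] Zm[of T]
    have A_sets [measurable]: "A n \<in> sets M" for n unfolding A_def by measurable
    \<comment> \<open>The total mass 1 is divided among first passages landing at \<open>- e\<close>
      or above, where \<open>Z\<close> is at most \<open>exp (\<rho> * x + \<rho> * e)\<close>,
      deeper first passages, and survival at the grid times up to \<open>T\<close>.\<close>
    have ineq: "1 \<le> ennreal (exp (\<rho> * x + \<rho> * e)) * emeasure M ?R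
         + (event_integral (Z T) (A n)) + ennreal (C * exp (- \<gamma> * T))" for n
    proof -
      have disj: "disjoint_family_on (D n) J" for J unfolding D_def by (rule disjoint_first_passage)
      then have disjO: "disjoint_family_on (OV n) J" for J
        unfolding OV_def disjoint_family_on_def by blast
      have piece: "(event_integral (Z (\<tau> n j)) (D n j))
         \<le> ennreal (exp (\<rho> * x + \<rho> * e)) * emeasure M (D n j) + (event_integral (Z T) (OV n j))"
        if j: "j \<le> Suc n" for j
      proof -
        have "(event_integral (Z (\<tau> n j)) (D n j))
          \<le> (\<integral>\<^sup>+ \<omega>. ennreal (exp (\<rho> * x + \<rho> * e)) * indicator (D n j) \<omega> + Z (\<tau> n j) \<omega> * indicator (OV n j) \<omega> \<partial>M)"
        proof (rule nn_integral_mono_AE, use le[OF \<tau>(1)[of n j]] AE_space in eventually_elim)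
          fix \<omega> assume Z: "Z (\<tau> n j) \<omega> \<le> ennreal (exp (\<rho> * x) * exp (- \<rho> * X (\<tau> n j) \<omega>))" and \<omega>: "\<omega> \<in> space M"
          show "Z (\<tau> n j) \<omega> * indicator (D n j) \<omega> \<le>
            ennreal (exp (\<rho> * x + \<rho> * e)) * indicator (D n j) \<omega> + Z (\<tau> n j) \<omega> * indicator (OV n j) \<omega>"
          proof (cases "\<omega> \<in> D n j - OV n j")
            case True
            then have "- \<rho> * X (\<tau> n j) \<omega> \<le> \<rho> * e"
              using \<omega> \<open>\<rho> > 0\<close> mult_left_mono[of "- X (\<tau> n j) \<omega>" e \<rho>] by (auto simp: OV_def)
            then have "exp (\<rho> * x) * exp (- \<rho> * X (\<tau> n j) \<omega>) \<le> exp (\<rho> * x + \<rho> * e)"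
              unfolding exp_add[symmetric] by simp
            then have "Z (\<tau> n j) \<omega> \<le> ennreal (exp (\<rho> * x + \<rho> * e))" using Z by (meson ennreal_leI order_trans)
            then show ?thesis using True by simp
          qed (auto simp: indicator_def OV_def)
        qed
        also have "\<dots> = ennreal (exp (\<rho> * x + \<rho> * e)) * emeasure M (D n j) + (event_integral (Z (\<tau> n j)) (OV n j))"
          by (simp add: nn_integral_add nn_integral_cmult_indicator)
        also have "(event_integral (Z (\<tau> n j)) (OV n j)) = (event_integral (Z T) (OV n j))"
          by (rule mart[symmetric, OF \<tau>(1) \<tau>T[OF j] OVk])
        finally show ?thesis .
      qed
      have "1 = (\<Sum>j\<le>Suc n. event_integral (Z (\<tau> n j)) (D n j))
        + (event_integral (Z T) (space M - (\<Union>i\<le>Suc n. b n i)))"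
        using first_passage_identity[of Z "\<tau> n" "b n" "Suc n", OF Zm mart \<tau> b] one[OF \<tau>(1)[of n 0]]
        unfolding D_def \<tau>_end by simp
      also have "(event_integral (Z T) (space M - (\<Union>i\<le>Suc n. b n i)))
         \<le> (event_integral (Z T) {\<omega>. 0 \<le> X T \<omega>})"
      proof (rule nn_integral_mono)
        fix \<omega>
        have "X T \<omega> \<ge> 0" if "\<omega> \<in> space M - (\<Union>i\<le>Suc n. b n i)"
        proof -
          have "\<omega> \<in> space M" "\<omega> \<notin> b n (Suc n)" using that by auto
          then show ?thesis by (simp add: b_def \<tau>_end)
        qed
        then show "Z T \<omega> * indicator (space M - (\<Union>i\<le>Suc n. b n i)) \<omega> \<le> Z T \<omega> * indicator {\<omega>. 0 \<le> X T \<omega>} \<omega>"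
          by (auto simp: indicator_def)
      qed
      also have "\<dots> \<le> ennreal (C * exp (- \<gamma> * T))" using surv[of T] T by simp
      also have "(\<Sum>j\<le>Suc n. event_integral (Z (\<tau> n j)) (D n j))
        \<le> (\<Sum>j\<le>Suc n. ennreal (exp (\<rho> * x + \<rho> * e)) * emeasure M (D n j) + (event_integral (Z T) (OV n j)))"
        by (intro sum_mono piece) simp
      also have "\<dots> = ennreal (exp (\<rho> * x + \<rho> * e)) * emeasure M (\<Union>j\<le>Suc n. D n j) + (event_integral (Z T) (A n))"
      proof -
        have "(\<Sum>j\<le>Suc n. emeasure M (D n j)) = emeasure M (\<Union>j\<le>Suc n. D n j)"
          by (rule sum_emeasure) (auto simp: disj)
        moreover have "(\<Sum>j\<le>Suc n. event_integral (Z T) (OV n j)) = (event_integral (Z T) (A n))"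
        proof -
          have "(\<Sum>j\<le>Suc n. event_integral (Z T) (OV n j)) = (\<integral>\<^sup>+ \<omega>. (\<Sum>j\<le>Suc n. Z T \<omega> * indicator (OV n j) \<omega>) \<partial>M)"
            using T by (intro nn_integral_sum[symmetric]) auto
          also have "\<dots> = (event_integral (Z T) (A n))"
            unfolding A_def by (subst indicator_UN_disjoint[OF finite_atMost disjO]) (simp only: sum_distrib_left)
          finally show ?thesis .
        qed
        ultimately show ?thesis by (simp only: sum.distrib sum_distrib_left[symmetric])
      qed
      also have "emeasure M (\<Union>j\<le>Suc n. D n j) \<le> emeasure M ?R"
        by (rule emeasure_mono[OF _ Rm]) (use \<tau>(1) in \<open>auto simp: D_def b_def\<close>)
      finally show ?thesis by (simp add: mult_left_mono add_right_mono)
    qed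
    have lim: "(\<lambda>n. event_integral (Z T) (A n)) \<longlonglongrightarrow> (\<integral>\<^sup>+ \<omega>. 0 \<partial>M)"
    proof (rule nn_integral_dominated_convergence[where w="Z T"])
      show "(\<integral>\<^sup>+ \<omega>. Z T \<omega> \<partial>M) < \<infinity>" using one[of T] T by simp
      show "AE \<omega> in M. (\<lambda>n. Z T \<omega> * indicator (A n) \<omega>) \<longlonglongrightarrow> 0"
        using X0 AE_space
      proof eventually_elim
        fix \<omega> assume x0: "X 0 \<omega> = x" and \<omega>: "\<omega> \<in> space M"
        have "uniformly_continuous_on {0..T} (\<lambda>t. X t \<omega>)"
          using Xc[OF \<omega>] by (intro compact_uniformly_continuous) (auto intro: continuous_on_subset)
        then obtain d where d: "d > 0" "\<And>s t. s \<in> {0..T} \<Longrightarrow> t \<in> {0..T} \<Longrightarrow> dist t s < d \<Longrightarrow> dist (X t \<omega>) (X s \<omega>) < e"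
          using e unfolding uniformly_continuous_on_def by metis
        obtain N :: nat where N: "T / d < real N" using reals_Archimedean2 by blast
        have "\<omega> \<notin> A n" if "n \<ge> N" for n
        proof
          assume "\<omega> \<in> A n"
          then obtain j where j: "j \<le> Suc n" "\<omega> \<in> D n j" "X (\<tau> n j) \<omega> < - e"
            by (auto simp: A_def OV_def)
          show False
          proof (cases j)
            \<comment> \<open>There is no overshoot at time 0, since the surplus starts at
              \<open>x \<ge> 0\<close>.\<close>
            case 0
            then show ?thesis using j x0 \<open>0 \<le> x\<close> e by (simp add: \<tau>_def)
          next
            case (Suc i)
            \<comment> \<open>Before the first passage the surplus is nonnegative, so it would have
              to fall by more than \<open>e\<close> within one grid step, against uniform
              continuity.\<close>
            then have "\<omega> \<notin> b n i" using j by (auto simp: D_def)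
            then have "X (\<tau> n i) \<omega> \<ge> 0" using \<omega> by (auto simp: b_def)
            moreover have "\<tau> n j - \<tau> n i = T / real (Suc n)"
              unfolding \<tau>_def diff_divide_distrib[symmetric] by (simp add: Suc algebra_simps)
            moreover have "T / real (Suc n) < d" "0 < T / real (Suc n)"
            proof -
              have "T < d * real N" using N d(1) by (simp add: field_simps)
              also have "\<dots> \<le> d * real (Suc n)" using d(1) that by (intro mult_left_mono) auto
              finally show "T / real (Suc n) < d" by (simp add: field_simps)
            qed (use T in simp)
            moreover have "\<tau> n j \<in> {0..T}" "\<tau> n i \<in> {0..T}" using \<tau> \<tau>T j Suc by auto
            ultimately show False using d(2)[of "\<tau> n i" "\<tau> n j"] j(3) e by (auto simp: dist_real_def)
          qed
        qed
        then have "\<forall>\<^sub>F n in sequentially. Z T \<omega> * indicator (A n) \<omega> = 0"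
          unfolding eventually_sequentially by (intro exI[of _ N]) auto
        then show "(\<lambda>n. Z T \<omega> * indicator (A n) \<omega>) \<longlonglongrightarrow> 0" by (rule tendsto_eventually)
      qed
    qed (use T in \<open>auto simp: indicator_def\<close>)
    have "(\<lambda>n. ennreal (exp (\<rho> * x + \<rho> * e)) * emeasure M ?R
         + (event_integral (Z T) (A n)) + ennreal (C * exp (- \<gamma> * T)))
       \<longlonglongrightarrow> ennreal (exp (\<rho> * x + \<rho> * e)) * emeasure M ?R + (\<integral>\<^sup>+ \<omega>. 0 \<partial>M) + ennreal (C * exp (- \<gamma> * T))"
      by (intro tendsto_add tendsto_const lim)
    then have "1 \<le> ennreal (exp (\<rho> * x + \<rho> * e)) * emeasure M ?R + (\<integral>\<^sup>+ \<omega>. 0 \<partial>M) + ennreal (C * exp (- \<gamma> * T))"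
      by (rule LIMSEQ_le_const) (use ineq in auto)
    then have "ennreal 1 \<le> ennreal (exp (\<rho> * x + \<rho> * e) * prob ?R + C * exp (- \<gamma> * T))"
      using \<open>C \<ge> 0\<close> by (simp add: emeasure_eq_measure ennreal_mult)
    then show ?thesis using \<open>C \<ge> 0\<close> by (subst (asm) ennreal_le_iff) auto
  qed
  \<comment> \<open>Letting \<open>T\<close> tend to infinity removes the survivors; letting
    \<open>e\<close> tend to 0 afterwards removes the allowance for overshoot.\<close>
  have e_bound: "1 \<le> exp (\<rho> * x + \<rho> * e) * prob ?R" if "e > 0" for e
  proof -
    have "((\<lambda>T. exp (\<rho> * x + \<rho> * e) * prob ?R + C * exp (- \<gamma> * T)) \<longlongrightarrow> exp (\<rho> * x + \<rho> * e) * prob ?R + C * 0) at_top"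
    proof (intro tendsto_intros)
      show "((\<lambda>T. exp (- \<gamma> * T)) \<longlongrightarrow> 0) at_top"
        using \<open>\<gamma> > 0\<close>
        by (intro filterlim_compose[OF exp_at_bot] filterlim_tendsto_neg_mult_at_bot[OF tendsto_const _ filterlim_ident]) simp
    qed
    then have "1 \<le> exp (\<rho> * x + \<rho> * e) * prob ?R + C * 0"
      by (rule tendsto_lowerbound) (use T_bound[OF that] in \<open>auto intro!: eventually_mono[OF eventually_gt_at_top[of 0]]\<close>)
    then show ?thesis by simp
  qed
  have "((\<lambda>e. exp (\<rho> * x + \<rho> * e) * prob ?R) \<longlongrightarrow> exp (\<rho> * x + \<rho> * 0) * prob ?R) (at_right 0)"
    by (intro tendsto_intros)
  then have "1 \<le> exp (\<rho> * x + \<rho> * 0) * prob ?R"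
    by (rule tendsto_lowerbound) (use e_bound in \<open>auto intro!: eventually_mono[OF eventually_at_right_less[of 0]]\<close>)
  then show ?thesis by (simp add: exp_minus field_simps)
qed

end

text \<open>The infimum of an empty set of times is infinite, so finiteness of the ruin time
  expresses that some time with negative surplus exists.\<close>

lemma ruin_prob_eq: "ruin_prob M X = measure M {\<omega>\<in>space M. \<exists>t\<ge>0. X t \<omega> < 0}"
proof -
  have "ruin_time X \<omega> < \<infinity> \<longleftrightarrow> (\<exists>t\<ge>0. X t \<omega> < 0)" for \<omega>
    unfolding ruin_time_def INF_less_iff by auto
  then show ?thesis unfolding ruin_prob_def by simp
qed

section \<open>Comparison of the surplus with the exponential martingale\<close>

context two_BMs
begin

text \<open>Ito's formula is not needed: the exponential martingale of the noise is compared with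
  \<open>exp (- \<rho> * X)\<close> directly, and its square root is the martingale for \<open>\<rho> / 2\<close> times a decaying factor.\<close>

lemma surplus_ruin_bounds:
  fixes X :: "real \<Rightarrow> 'a \<Rightarrow> real"
  assumes Xm: "\<And>t. 0 \<le> t \<Longrightarrow> X t \<in> borel_measurable M"
    and Xc: "\<And>\<omega>. \<omega> \<in> space M \<Longrightarrow> continuous_on {0..} (\<lambda>t. X t \<omega>)"
    and a: "predictable_process M F a" and I: "ito_integral M F B H I"
    and X: "AE \<omega> in M. \<forall>t\<ge>0. X t \<omega> = x + (LBINT s:{0..t}. a s \<omega>) + I t \<omega> + \<beta> * W t \<omega>"
    and K: "0 \<le> K" "\<forall>t\<ge>0. \<forall>\<omega>\<in>space M. \<bar>H t \<omega>\<bar> \<le> K"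
    and L: "\<forall>t\<ge>0. \<forall>\<omega>\<in>space M. \<bar>a t \<omega>\<bar> \<le> L"
    and "\<rho> > 0" "\<beta> > 0" "0 \<le> x"
    and le: "\<forall>t\<ge>0. \<forall>\<omega>\<in>space M. a t \<omega> \<le> \<rho> / 2 * ((H t \<omega>)\<^sup>2 + \<beta>\<^sup>2)"
  shows "exp (- \<rho> * x) \<le> ruin_prob M X"
    and "(\<forall>t\<ge>0. \<forall>\<omega>\<in>space M. a t \<omega> = \<rho> / 2 * ((H t \<omega>)\<^sup>2 + \<beta>\<^sup>2)) \<Longrightarrow> ruin_prob M X \<le> exp (- \<rho> * x)"
proof -
  have p: "predictable_process M F H" using I by (simp add: ito_integral_def)
  define A where "A t \<omega> = (LINT s|lborel. indicator {0..t} s * a s \<omega>)" for t \<omega>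
  define Q where "Q t \<omega> = square_integral t (\<lambda>s. H s \<omega>)" for t \<omega>
  have X': "AE \<omega> in M. X t \<omega> = x + A t \<omega> + I t \<omega> + \<beta> * W t \<omega>" if "0 \<le> t" for t
    using X by eventually_elim (use that in \<open>simp add: A_def set_lebesgue_integral_def\<close>)
  have ints: "integrable lborel (\<lambda>s. indicator {0..t} s * a s \<omega>)"
      "integrable lborel (\<lambda>s. indicator {0..t} s * (H s \<omega>)\<^sup>2)"
    if t: "0 \<le> t" and \<omega>: "\<omega> \<in> space M" for t \<omega>
  proof -
    have 1: "(\<lambda>s. indicator {0..t} s * a s \<omega>) \<in> borel_measurable borel"
      using measurable_compose[OF measurable_Pair2'[OF \<omega>] predictable_measurable[OF a t]] by simp
    have 2: "(\<lambda>s. indicator {0..t} s * H s \<omega>) \<in> borel_measurable borel"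
      using measurable_compose[OF measurable_Pair2'[OF \<omega>] predictable_measurable[OF p t]] by simp
    then have "(\<lambda>s. (indicator {0..t} s * H s \<omega>)\<^sup>2) \<in> borel_measurable borel" by measurable
    also have "(\<lambda>s. (indicator {0..t} s * H s \<omega>)\<^sup>2) = (\<lambda>s. indicator {0..t} s * (H s \<omega>)\<^sup>2)"
      by (auto simp: indicator_def)
    finally have 3: "(\<lambda>s. indicator {0..t} s * (H s \<omega>)\<^sup>2) \<in> borel_measurable borel" .
    show "integrable lborel (\<lambda>s. indicator {0..t} s * a s \<omega>)"
      using 1 by (rule integrable_indicator_bounded[where K=L]) (use L \<omega> in auto)
    show "integrable lborel (\<lambda>s. indicator {0..t} s * (H s \<omega>)\<^sup>2)"
      using 3
    proof (rule integrable_indicator_bounded[where K="K\<^sup>2"])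
      fix s assume "s \<in> {0..t}"
      then have "\<bar>H s \<omega>\<bar> \<le> \<bar>K\<bar>" using K \<omega> by fastforce
      then show "\<bar>(H s \<omega>)\<^sup>2\<bar> \<le> K\<^sup>2" unfolding abs_le_square_iff by simp
    qed
  qed
  have bound_int: "has_bochner_integral lborel (\<lambda>s. \<rho> / 2 * (indicator {0..t} s * (H s \<omega>)\<^sup>2 + \<beta>\<^sup>2 * indicator {0..t} s))
      (\<rho> / 2 * (Q t \<omega> + \<beta>\<^sup>2 * t))" if t: "0 \<le> t" and \<omega>: "\<omega> \<in> space M" for t \<omega>
  proof (intro has_bochner_integral_mult_right has_bochner_integral_add)
    show "has_bochner_integral lborel (\<lambda>s. indicator {0..t} s * (H s \<omega>)\<^sup>2) (Q t \<omega>)"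
      using ints(2)[OF that] by (simp add: Q_def has_bochner_integral_iff)
    show "has_bochner_integral lborel (indicator {0..t}) t"
      using has_bochner_integral_real_indicator[of "{0..t}" lborel] t by simp
  qed
  have AQ: "A t \<omega> \<le> \<rho> / 2 * (Q t \<omega> + \<beta>\<^sup>2 * t)" if t: "0 \<le> t" and \<omega>: "\<omega> \<in> space M" for t \<omega>
  proof -
    have "A t \<omega> \<le> (LINT s|lborel. \<rho> / 2 * (indicator {0..t} s * (H s \<omega>)\<^sup>2 + \<beta>\<^sup>2 * indicator {0..t} s))"
      unfolding A_def
    proof (rule integral_mono[OF ints(1)[OF that]])
      show "integrable lborel (\<lambda>s. \<rho> / 2 * (indicator {0..t} s * (H s \<omega>)\<^sup>2 + \<beta>\<^sup>2 * indicator {0..t} s))"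
        using bound_int[OF that] by (simp add: has_bochner_integral_iff)
      show "indicator {0..t} s * a s \<omega> \<le> \<rho> / 2 * (indicator {0..t} s * (H s \<omega>)\<^sup>2 + \<beta>\<^sup>2 * indicator {0..t} s)" for s
        using le[rule_format, OF _ \<omega>, of s] by (simp add: indicator_def)
    qed
    then show ?thesis unfolding has_bochner_integral_integral_eq[OF bound_int[OF that]] .
  qed
  have Q0: "0 \<le> Q t \<omega>" for t \<omega> unfolding Q_def by (intro Bochner_Integration.integral_nonneg) auto
  define Z where "Z t \<omega> = ennreal (exp_mart \<rho> \<beta> H I t \<omega>)" for t \<omega>
  have em: "exp_mart q \<beta> H I t \<omega> = exp (- q * (I t \<omega> + \<beta> * W t \<omega>) - q\<^sup>2 / 2 * (Q t \<omega> + \<beta>\<^sup>2 * t))" for q t \<omega>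
    by (simp add: exp_mart_def Q_def)
  \<comment> \<open>The noise \<open>I + \<beta> * W\<close> is \<open>X - x - A\<close>, inserted
    into the exponent. The last factor alone carries the comparison of drift and volatility.\<close>
  have emX: "exp_mart \<rho> \<beta> H I t \<omega> = exp (\<rho> * x) * exp (- \<rho> * X t \<omega>) * exp (\<rho> * (A t \<omega> - \<rho> / 2 * (Q t \<omega> + \<beta>\<^sup>2 * t)))"
    if "X t \<omega> = x + A t \<omega> + I t \<omega> + \<beta> * W t \<omega>" for t \<omega>
    unfolding em exp_add[symmetric] that by (simp add: algebra_simps power2_eq_square)
  \<comment> \<open>\<open>I\<close> is given through limits in the mean, so its initial value is
    read off from the simple integrals, which vanish at time 0.\<close>
  have I0: "AE \<omega> in M. I 0 \<omega> = 0"
  proof -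
    obtain S where S: "\<forall>k. simple_integrand F (S k)" and
      lim: "\<forall>s\<in>{0, 0}. AE \<omega> in M. (\<lambda>k. simple_integral (S k) B s \<omega>) \<longlonglongrightarrow> I s \<omega>"
      using exp_mart_approx[OF I K order_refl order_refl] by (elim exE conjE) (rule that)
    from lim have "AE \<omega> in M. (\<lambda>k. simple_integral (S k) B 0 \<omega>) \<longlonglongrightarrow> I 0 \<omega>" by simp
    then show ?thesis
      by eventually_elim (use simple_integral_0[OF S[rule_format]] in \<open>simp add: LIMSEQ_const_iff\<close>)
  qed
  have X0: "AE \<omega> in M. X 0 \<omega> = x"
  proof -
    have "A 0 \<omega> = 0" for \<omega>
    proof -
      have "AE s in lborel. indicator {0..0} s * a s \<omega> = 0"
        using AE_lborel_singleton[of "0::real"] by eventually_elim (auto simp: indicator_def)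
      then show ?thesis unfolding A_def by (rule integral_eq_zero_AE)
    qed
    note A0 = this
    show ?thesis using X'[OF order_refl] I0 AE_W by eventually_elim (simp add: A0)
  qed
  \<comment> \<open>The integrated drift and \<open>W t\<close> are \<open>F t\<close>-measurable;
    the Ito integral becomes so after a change on a null set.\<close>
  have Xk: "known t {\<omega>\<in>space M. X t \<omega> < y}" if t: "0 \<le> t" for t y
  proof -
    obtain J where J: "J \<in> borel_measurable (F t)" "AE \<omega> in M. I t \<omega> = J \<omega>"
      by (rule ito_integral_version[OF I K t])
    note [measurable] = J(1) measurable_W[OF t] predictable_progressive[OF a t]
    have "(\<lambda>\<omega>. A t \<omega>) \<in> borel_measurable (F t)" unfolding A_def by measurable
    then have "(\<lambda>\<omega>. x + A t \<omega> + J \<omega> + \<beta> * W t \<omega>) \<in> borel_measurable (F t)" by measurable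
    moreover have "AE \<omega> in M. X t \<omega> = x + A t \<omega> + J \<omega> + \<beta> * W t \<omega>"
      using X'[OF t] J(2) by eventually_elim simp
    ultimately show ?thesis using known_less[OF Xm[OF t]] t by blast
  qed
  have Zm: "Z t \<in> borel_measurable M" if "0 \<le> t" for t
    using exp_mart_measurable[OF I that, of \<rho> \<beta>] unfolding Z_def[abs_def] by measurable
  have mart: "event_integral (Z v) A = event_integral (Z u) A"
    if "0 \<le> u" "u \<le> v" "known u A" for u v A
    unfolding Z_def by (rule exp_mart_martingale[OF I K that])
  have one: "(\<integral>\<^sup>+ \<omega>. Z t \<omega> \<partial>M) = 1" if "0 \<le> t" for t
    unfolding Z_def by (rule nn_integral_exp_mart[OF I K that])
  have Zle: "AE \<omega> in M. Z t \<omega> \<le> ennreal (exp (\<rho> * x) * exp (- \<rho> * X t \<omega>))" if t: "0 \<le> t" for t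
    using X'[OF t] AE_space
  proof eventually_elim
    fix \<omega> assume X: "X t \<omega> = x + A t \<omega> + I t \<omega> + \<beta> * W t \<omega>" and \<omega>: "\<omega> \<in> space M"
    have "exp (\<rho> * (A t \<omega> - \<rho> / 2 * (Q t \<omega> + \<beta>\<^sup>2 * t))) \<le> 1"
      using AQ[OF t \<omega>] \<open>\<rho> > 0\<close> by (simp add: mult_nonneg_nonpos)
    then have "exp_mart \<rho> \<beta> H I t \<omega> \<le> exp (\<rho> * x) * exp (- \<rho> * X t \<omega>) * 1"
      unfolding emX[OF X] by (intro mult_left_mono) auto
    then show "Z t \<omega> \<le> ennreal (exp (\<rho> * x) * exp (- \<rho> * X t \<omega>))"
      unfolding Z_def by (intro ennreal_leI) simp
  qed
  have surv: "(event_integral (Z t) {\<omega>. 0 \<le> X t \<omega>}) \<le> ennreal (exp (\<rho> * x / 2) * exp (- (\<rho>\<^sup>2 * \<beta>\<^sup>2 / 8) * t))"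
    if t: "0 \<le> t" for t
  proof -
    \<comment> \<open>On \<open>0 \<le> X t \<omega>\<close> the martingale is at most
      \<open>exp (\<rho> * x)\<close>, hence at most \<open>exp (\<rho> * x / 2)\<close> times its
      square root. The square root is the exponential martingale for \<open>\<rho> / 2\<close> times
      \<open>exp (- \<rho>^2 / 8 * q)\<close>, and \<open>q \<ge> \<beta>^2 * t\<close> gives the
      rate.\<close>
    let ?c = "exp (\<rho> * x / 2) * exp (- (\<rho>\<^sup>2 * \<beta>\<^sup>2 / 8) * t)"
    have "(event_integral (Z t) {\<omega>. 0 \<le> X t \<omega>}) \<le> (\<integral>\<^sup>+ \<omega>. ennreal ?c * ennreal (exp_mart (\<rho> / 2) \<beta> H I t \<omega>) \<partial>M)"
    proof (rule nn_integral_mono_AE, use Zle[OF t] in eventually_elim)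
      fix \<omega> assume Z: "Z t \<omega> \<le> ennreal (exp (\<rho> * x) * exp (- \<rho> * X t \<omega>))"
      show "Z t \<omega> * indicator {\<omega>. 0 \<le> X t \<omega>} \<omega> \<le> ennreal ?c * ennreal (exp_mart (\<rho> / 2) \<beta> H I t \<omega>)"
      proof (cases "0 \<le> X t \<omega>")
        case True
        define N where "N = I t \<omega> + \<beta> * W t \<omega>"
        define q where "q = Q t \<omega> + \<beta>\<^sup>2 * t"
        have "exp_mart \<rho> \<beta> H I t \<omega> \<le> exp (\<rho> * x + - \<rho> * X t \<omega>)"
          using Z unfolding Z_def exp_add[symmetric] by (subst (asm) ennreal_le_iff) auto
        also have "\<dots> \<le> exp (\<rho> * x)" using True \<open>\<rho> > 0\<close> by simp
        finally have "- \<rho> * N - \<rho>\<^sup>2 / 2 * q \<le> \<rho> * x" unfolding em N_def q_def by simp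
        then have h: "- \<rho> * N / 2 - \<rho>\<^sup>2 / 4 * q \<le> \<rho> * x / 2" by (simp add: mult.commute)
        have "\<rho>\<^sup>2 * (\<beta>\<^sup>2 * t) \<le> \<rho>\<^sup>2 * q" unfolding q_def using Q0 by (intro mult_left_mono) auto
        with h have "- \<rho> * N - \<rho>\<^sup>2 / 2 * q \<le> \<rho> * x / 2 - (\<rho>\<^sup>2 * \<beta>\<^sup>2 / 8) * t + (- (\<rho> / 2) * N - (\<rho> / 2)\<^sup>2 / 2 * q)"
          by (simp add: power_divide field_simps)
        then have "exp_mart \<rho> \<beta> H I t \<omega> \<le> ?c * exp_mart (\<rho> / 2) \<beta> H I t \<omega>"
          unfolding em N_def q_def exp_add[symmetric] by (subst exp_le_cancel_iff) (simp add: algebra_simps)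
        then show ?thesis using True
          by (simp add: Z_def ennreal_mult[symmetric] em ennreal_leI)
      qed simp
    qed
    also have "\<dots> = ennreal ?c * (\<integral>\<^sup>+ \<omega>. ennreal (exp_mart (\<rho> / 2) \<beta> H I t \<omega>) \<partial>M)"
      using exp_mart_measurable[OF I t] by (intro nn_integral_cmult) measurable
    also have "\<dots> = ennreal ?c" using nn_integral_exp_mart[OF I K t] by simp
    finally show ?thesis .
  qed
  show "exp (- \<rho> * x) \<le> ruin_prob M X"
    unfolding ruin_prob_eq
    by (rule ruin_lower_bound[OF Zm mart one Xm Xc Xk X0 \<open>0 \<le> x\<close> Zle surv])
       (use \<open>\<rho> > 0\<close> \<open>\<beta> > 0\<close> in auto)
  show "ruin_prob M X \<le> exp (- \<rho> * x)"
    if eq: "\<forall>t\<ge>0. \<forall>\<omega>\<in>space M. a t \<omega> = \<rho> / 2 * ((H t \<omega>)\<^sup>2 + \<beta>\<^sup>2)"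
    unfolding ruin_prob_eq
  proof (rule ruin_upper_bound[OF Zm mart one Xm Xc Xk _ \<open>\<rho> > 0\<close>])
    fix t :: real assume t: "0 \<le> t"
    show "AE \<omega> in M. Z t \<omega> \<ge> ennreal (exp (\<rho> * x) * exp (- \<rho> * X t \<omega>))"
      using X'[OF t] AE_space
    proof eventually_elim
      fix \<omega> assume X: "X t \<omega> = x + A t \<omega> + I t \<omega> + \<beta> * W t \<omega>" and \<omega>: "\<omega> \<in> space M"
      have "A t \<omega> = (LINT s|lborel. \<rho> / 2 * (indicator {0..t} s * (H s \<omega>)\<^sup>2 + \<beta>\<^sup>2 * indicator {0..t} s))"
        unfolding A_def using eq \<omega> by (intro Bochner_Integration.integral_cong) (auto simp: indicator_def)
      then have "A t \<omega> = \<rho> / 2 * (Q t \<omega> + \<beta>\<^sup>2 * t)"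
        unfolding has_bochner_integral_integral_eq[OF bound_int[OF t \<omega>]] .
      then show "Z t \<omega> \<ge> ennreal (exp (\<rho> * x) * exp (- \<rho> * X t \<omega>))"
        unfolding Z_def emX[OF X] by (simp del: eq_divide_eq_numeral1)
    qed
  qed
qed

text \<open>A simple integrand equal to \<open>v\<close> after time 0 and up to \<open>k\<close>
  agrees with the constant on \<open>{0..t}\<close> once \<open>t \<le> k\<close>, except at the
  null point 0; moreover \<open>B 0 = 0\<close> almost surely. So both errors vanish from some
  \<open>k\<close> on.\<close>

lemma ito_integral_const: "ito_integral M F B (\<lambda>t \<omega>. v) (\<lambda>t \<omega>. v * B t \<omega>)"
proof -
  define S :: "nat \<Rightarrow> 'a simple_integrand" where "S k = (Suc 0, (\<lambda>i. real i * real k), (\<lambda>i \<omega>. v))" for k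
  have S: "simple_integrand F (S k)" for k
    by (auto simp: S_def simple_integrand_def)
  have val: "simple_value (S k) s \<omega> = v * indicator {0<..real k} s" for k s \<omega>
    unfolding simple_value_def S_def split lessThan_Suc lessThan_0 by (subst sum.insert) simp_all
  have int: "simple_integral (S k) B t \<omega> = v * (B t \<omega> - B 0 \<omega>)" if "0 \<le> t" "t \<le> real k" for k t \<omega>
    using that by (simp add: simple_integral_def S_def lessThan_Suc)
  show ?thesis
    unfolding ito_integral_def
  proof (intro conjI allI impI exI[of _ S])
    show "predictable_process M F (\<lambda>t \<omega>. v)" by (simp add: predictable_process_def)
    show "(\<integral>\<^sup>+\<omega>. (\<integral>\<^sup>+s\<in>{0..T}. ennreal (v\<^sup>2) \<partial>lborel) \<partial>M) < \<infinity>" if "0 \<le> T" for T :: real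
      using that by (subst nn_integral_cmult_indicator)
        (auto simp add: emeasure_space_1 ennreal_mult_less_top)
    show "(\<lambda>\<omega>. v * B t \<omega>) \<in> borel_measurable M" if "0 \<le> t" for t
      using measurable_B_M[OF that] by measurable
    show "AE \<omega> in M. continuous_on {0..} (\<lambda>t. v * B t \<omega>)"
      using AE_B by eventually_elim (auto intro: continuous_intros)
    show "simple_integrand F (S k)" for k by (rule S)
    show "(\<lambda>k. \<integral>\<^sup>+\<omega>. (\<integral>\<^sup>+s\<in>{0..T}. ennreal ((simple_value (S k) s \<omega> - v)\<^sup>2) \<partial>lborel) \<partial>M) \<longlonglongrightarrow> 0"
      if "0 \<le> T" for T
    proof (rule tendsto_eventually)
      have "(\<integral>\<^sup>+s\<in>{0..T}. ennreal ((simple_value (S k) s \<omega> - v)\<^sup>2) \<partial>lborel) = 0" if "T \<le> real k" for k \<omega>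
      proof -
        have "(\<integral>\<^sup>+s\<in>{0..T}. ennreal ((simple_value (S k) s \<omega> - v)\<^sup>2) \<partial>lborel) = (\<integral>\<^sup>+(s::real). 0 \<partial>lborel)"
          using AE_lborel_singleton[of "0::real"] that
          by (intro nn_integral_cong_AE) (auto elim!: eventually_mono simp: val indicator_def)
        then show ?thesis by simp
      qed
      moreover obtain N where "T \<le> real N" using real_arch_simple by blast
      ultimately show "\<forall>\<^sub>F k in sequentially. (\<integral>\<^sup>+\<omega>. (\<integral>\<^sup>+s\<in>{0..T}. ennreal ((simple_value (S k) s \<omega> - v)\<^sup>2) \<partial>lborel) \<partial>M) = 0"
        by (auto simp: eventually_sequentially intro!: exI[of _ N])
    qed
    show "(\<lambda>k. \<integral>\<^sup>+\<omega>. ennreal ((simple_integral (S k) B t \<omega> - v * B t \<omega>)\<^sup>2) \<partial>M) \<longlonglongrightarrow> 0" if "0 \<le> t" for t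
    proof (rule tendsto_eventually)
      have "(\<integral>\<^sup>+\<omega>. ennreal ((simple_integral (S k) B t \<omega> - v * B t \<omega>)\<^sup>2) \<partial>M) = 0" if "t \<le> real k" for k
      proof -
        have "(\<integral>\<^sup>+\<omega>. ennreal ((simple_integral (S k) B t \<omega> - v * B t \<omega>)\<^sup>2) \<partial>M) = (\<integral>\<^sup>+\<omega>. 0 \<partial>M)"
          using AE_B by (intro nn_integral_cong_AE, eventually_elim) (simp add: int \<open>0 \<le> t\<close> that)
        then show ?thesis by simp
      qed
      moreover obtain N where "t \<le> real N" using real_arch_simple by blast
      ultimately show "\<forall>\<^sub>F k in sequentially. (\<integral>\<^sup>+\<omega>. ennreal ((simple_integral (S k) B t \<omega> - v * B t \<omega>)\<^sup>2) \<partial>M) = 0"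
        by (auto simp: eventually_sequentially intro!: exI[of _ N])
    qed
  qed
qed

text \<open>With constant coefficients the equation is solved explicitly by a linear drift plus
  multiples of \<open>B\<close> and \<open>W\<close>.\<close>

lemma controlled_surplus_const:
  "\<exists>X. controlled_surplus M F B W D l \<beta> \<kappa> \<theta> \<eta> (\<lambda>t \<omega>. r) x X"
proof -
  let ?a = "drift D l \<kappa> \<theta> \<eta> r" and ?v = "volatility D l r"
  obtain N where N: "N \<in> sets M" "emeasure M N = 0"
    "\<And>\<omega>. \<omega> \<in> space M \<Longrightarrow> \<omega> \<notin> N \<Longrightarrow> continuous_on {0..} (\<lambda>t. B t \<omega>) \<and> continuous_on {0..} (\<lambda>t. W t \<omega>)"
  proof -
    have "AE \<omega> in M. continuous_on {0..} (\<lambda>t. B t \<omega>) \<and> continuous_on {0..} (\<lambda>t. W t \<omega>)"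
      using AE_B AE_W by eventually_elim auto
    then show ?thesis by (rule AE_E) (use that in blast)
  qed
  \<comment> \<open>The Brownian paths are continuous only almost surely, whereas
    \<open>controlled_surplus\<close> asks for continuity at every outcome; on the exceptional null
    set the path is set to 0.\<close>
  define X where "X t \<omega> = (if \<omega> \<in> N then 0 else x + ?a * t + ?v * B t \<omega> + \<beta> * W t \<omega>)" for t \<omega>
  have "controlled_surplus M F B W D l \<beta> \<kappa> \<theta> \<eta> (\<lambda>t \<omega>. r) x X"
    unfolding controlled_surplus_def
  proof (intro conjI allI impI ballI exI[of _ "\<lambda>t \<omega>. ?v * B t \<omega>"])
    show "X t \<in> borel_measurable M" if "0 \<le> t" for t
    proof -
      note [measurable] = N(1) measurable_B_M[OF that] measurable_W_M[OF that]
      show ?thesis unfolding X_def[abs_def] by measurable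
    qed
    show "continuous_on {0..} (\<lambda>t. X t \<omega>)" if "\<omega> \<in> space M" for \<omega>
      using N(3)[OF that] by (cases "\<omega> \<in> N") (auto simp: X_def intro!: continuous_intros)
    show "predictable_process M F (\<lambda>t \<omega>. ?a)" by (simp add: predictable_process_def)
    show "ito_integral M F B (\<lambda>t \<omega>. ?v) (\<lambda>t \<omega>. ?v * B t \<omega>)" by (rule ito_integral_const)
    have "AE \<omega> in M. \<omega> \<notin> N" using N by (intro AE_not_in) auto
    then show "AE \<omega> in M. \<forall>t\<ge>0. X t \<omega> = x + (LBINT s:{0..t}. ?a) + ?v * B t \<omega> + \<beta> * W t \<omega>"
      by eventually_elim (simp add: X_def set_lebesgue_integral_def)
  qed
  then show ?thesis by blast
qed

end

text \<open>Existence of a surplus under \<open>R_D\<close> belongs to the conclusion: it shows that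
  the infimum in \<open>min_ruin_prob\<close> is over a nonempty set and is attained. The lower
  bound on ruin holds for every admissible strategy, the matching upper bound for
  \<open>R_D\<close>.\<close>

theorem theorem3p1:
  fixes M :: "'a measure" and F :: "real \<Rightarrow> 'a measure"
    and B W :: "real \<Rightarrow> 'a \<Rightarrow> real"
    and N :: "'b measure" and Y :: "'b \<Rightarrow> real" and D :: "real measure"
    and l \<beta> c \<theta> \<eta> \<mu> sigma_sq \<kappa> :: real
  assumes "l > 0" and "\<beta> > 0" and "\<theta> \<ge> 0" and "\<eta> \<ge> 0"
    and "prob_space N" and "Y \<in> borel_measurable N"
    and "AE \<omega> in N. Y \<omega> > 0"
    and "D = distr N borel Y"
    and "cdf D 0 = 0" and "\<And>y. y > 0 \<Longrightarrow> 0 < cdf D y \<and> cdf D y < 1"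
    and "\<exists>\<delta>>0. \<forall>s. \<bar>s\<bar> < \<delta> \<longrightarrow> integrable N (\<lambda>\<omega>. exp (s * Y \<omega>))"
    and "\<mu> = (LINT \<omega>|N. Y \<omega>)" and "sigma_sq = (LINT \<omega>|N. (Y \<omega>)\<^sup>2)"
    and "c > l * \<mu>"
    and "\<kappa> = (1 + \<theta>) * l * \<mu> + \<eta> / 2 * l * sigma_sq - c" and "\<kappa> > 0"
    and "filtered_space M F" and "independent_BMs M F B W"
  shows "(\<exists>!\<alpha>. \<alpha> > \<eta> \<and> adjustment_eq D l \<beta> c \<theta> \<eta> \<mu> \<alpha>) \<and>
    (\<forall>\<alpha>. \<alpha> > \<eta> \<and> adjustment_eq D l \<beta> c \<theta> \<eta> \<mu> \<alpha> \<longrightarrow>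
      admissible M F D l c \<theta> \<eta> (\<lambda>t \<omega>. R_D \<theta> \<eta> \<alpha>) \<and>
      (\<forall>x\<ge>0.
        (\<exists>X. controlled_surplus M F B W D l \<beta> \<kappa> \<theta> \<eta> (\<lambda>t \<omega>. R_D \<theta> \<eta> \<alpha>) x X) \<and>
        (\<forall>X. controlled_surplus M F B W D l \<beta> \<kappa> \<theta> \<eta> (\<lambda>t \<omega>. R_D \<theta> \<eta> \<alpha>) x X \<longrightarrow>
           ruin_prob M X = min_ruin_prob M F B W D l \<beta> c \<kappa> \<theta> \<eta> x) \<and>
        min_ruin_prob M F B W D l \<beta> c \<kappa> \<theta> \<eta> x = exp (- (\<alpha> - \<eta>) * x)))"
proof -
  interpret N: prob_space N by fact
  note [measurable] = \<open>Y \<in> borel_measurable N\<close>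
  obtain \<delta> where \<delta>: "\<delta> > 0" "\<And>s. \<bar>s\<bar> < \<delta> \<Longrightarrow> integrable N (\<lambda>\<omega>. exp (s * Y \<omega>))"
    using assms(11) by blast
  \<comment> \<open>A positive point of the interval on which the moment generating function is
    finite; the exponential there dominates \<open>Y\<close> and its square.\<close>
  define s where "s = \<delta> / 2"
  have s: "s > 0" "integrable N (\<lambda>\<omega>. exp (s * Y \<omega>))" using \<delta>(1) \<delta>(2)[of s] by (auto simp: s_def)
  have iY: "integrable N Y"
  proof (rule Bochner_Integration.integrable_bound)
    show "integrable N (\<lambda>\<omega>. 1 / s * exp (s * Y \<omega>))" using s by simp
    show "AE \<omega> in N. norm (Y \<omega>) \<le> norm (1 / s * exp (s * Y \<omega>))"
      using assms(7)
    proof eventually_elim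
      fix \<omega> assume "0 < Y \<omega>"
      moreover have "s * Y \<omega> \<le> exp (s * Y \<omega>)" using exp_ge_add_one_self[of "s * Y \<omega>"] by linarith
      ultimately show "norm (Y \<omega>) \<le> norm (1 / s * exp (s * Y \<omega>))" using s by (simp add: field_simps)
    qed
  qed simp
  have iY2: "integrable N (\<lambda>\<omega>. (Y \<omega>)\<^sup>2)"
  proof (rule Bochner_Integration.integrable_bound)
    show "integrable N (\<lambda>\<omega>. 2 / s\<^sup>2 * exp (s * Y \<omega>))" using s by simp
    show "AE \<omega> in N. norm ((Y \<omega>)\<^sup>2) \<le> norm (2 / s\<^sup>2 * exp (s * Y \<omega>))"
      using assms(7)
    proof eventually_elim
      fix \<omega> assume Y: "0 < Y \<omega>"
      have "(s * Y \<omega>)\<^sup>2 / 2 \<le> exp (s * Y \<omega>)"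
        using exp_lower_Taylor_quadratic[of "s * Y \<omega>"] s Y mult_pos_pos[of s "Y \<omega>"] by linarith
      then have "(Y \<omega>)\<^sup>2 \<le> 2 / s\<^sup>2 * exp (s * Y \<omega>)" using s by (simp add: field_simps power_mult_distrib)
      then show "norm ((Y \<omega>)\<^sup>2) \<le> norm (2 / s\<^sup>2 * exp (s * Y \<omega>))" by simp
    qed
  qed simp
  interpret claim_law D
  proof (intro claim_law.intro claim_law_axioms.intro)
    show "real_distribution D" using assms(8) by simp
    show "AE y in D. 0 < y" using assms(7) unfolding assms(8) by (subst AE_distr_iff) auto
    show "integrable D (\<lambda>y. y)" using iY unfolding assms(8) by (subst integrable_distr_eq) auto
    show "integrable D (\<lambda>y. y\<^sup>2)" using iY2 unfolding assms(8) by (subst integrable_distr_eq) auto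
  qed
  have \<mu>: "\<mu> = (LINT y|D. y)" using assms(12) unfolding assms(8) by (subst integral_distr) auto
  have sigma: "sigma_sq = (LINT y|D. y\<^sup>2)" using assms(13) unfolding assms(8) by (subst integral_distr) auto
  have \<kappa>: "\<kappa> = (1 + \<theta>) * l * (LINT y|D. y) + \<eta> / 2 * l * (LINT y|D. y\<^sup>2) - c"
    using assms(15) unfolding \<mu> sigma .
  interpret BM: two_BMs M F B W
    using assms(17,18) by (auto simp: two_BMs_def two_BMs_axioms_def filtered_space_def)
  show ?thesis
  proof (intro conjI allI impI)
    show "\<exists>!\<alpha>. \<alpha> > \<eta> \<and> adjustment_eq D l \<beta> c \<theta> \<eta> \<mu> \<alpha>"
      by (rule adjustment_ex1) (use assms in auto)
  next
    fix \<alpha> assume "\<alpha> > \<eta> \<and> adjustment_eq D l \<beta> c \<theta> \<eta> \<mu> \<alpha>"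
    then have \<alpha>: "\<eta> < \<alpha>" and adj: "adjustment_eq D l \<beta> c \<theta> \<eta> (LINT y|D. y) \<alpha>" using \<mu> by auto
    define \<rho> where "\<rho> = \<alpha> - \<eta>"
    have \<rho>: "\<rho> > 0" using \<alpha> by (simp add: \<rho>_def)
    have \<alpha>0: "\<alpha> > 0" using \<alpha> assms(4) by simp
    note ret = retention_R_D[OF \<alpha>0 assms(3,4)]
    note ham = drift_hamiltonian[OF assms(3,4,1) \<alpha> adj \<kappa>, folded \<rho>_def]
    \<comment> \<open>The volatility under full retention, which bounds all others because
      \<open>r y \<le> y\<close>.\<close>
    define K where "K = sqrt (l * (LINT y|D. y\<^sup>2))"
    have vol: "0 \<le> volatility D l r" "volatility D l r \<le> K" if "retention r" for r
      using retention_means(2,4)[OF that] assms(1) by (auto simp: volatility_def K_def)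
    \<comment> \<open>Covers both the lower bound \<open>- \<kappa>\<close> of the drift and its
      upper bound from the Hamilton-Jacobi-Bellman inequality; both summands are
      nonnegative.\<close>
    define L where "L = \<kappa> + \<rho> / 2 * (K\<^sup>2 + \<beta>\<^sup>2)"
    have dr: "\<bar>drift D l \<kappa> \<theta> \<eta> r\<bar> \<le> L" if r: "retention r" for r
    proof -
      have "(volatility D l r)\<^sup>2 \<le> K\<^sup>2" using vol[OF r] by (intro power_mono)
      then have "\<rho> / 2 * ((volatility D l r)\<^sup>2 + \<beta>\<^sup>2) \<le> \<rho> / 2 * (K\<^sup>2 + \<beta>\<^sup>2)"
        using \<rho> by (intro mult_left_mono) auto
      moreover have "0 \<le> \<rho> / 2 * (K\<^sup>2 + \<beta>\<^sup>2)" using \<rho> by simp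
      ultimately show ?thesis
        using ham(2)[OF r] drift_bounded[OF r assms(1,3,4), of \<kappa>] assms(16) unfolding L_def by linarith
    qed
    have ret_adm: "\<forall>t\<ge>0. \<forall>\<omega>\<in>space M. retention (R t \<omega>)" if "admissible M F D l c \<theta> \<eta> R" for R
      using that by (auto simp: admissible_def retention_def)
    have lower: "exp (- \<rho> * x) \<le> ruin_prob M X"
      and upper: "(\<forall>t\<ge>0. \<forall>\<omega>\<in>space M. R t \<omega> = R_D \<theta> \<eta> \<alpha>) \<Longrightarrow> ruin_prob M X \<le> exp (- \<rho> * x)"
      if adm: "admissible M F D l c \<theta> \<eta> R" and X: "controlled_surplus M F B W D l \<beta> \<kappa> \<theta> \<eta> R x X" and "0 \<le> x" for R x X
    proof -
      obtain I where I: "ito_integral M F B (\<lambda>t \<omega>. volatility D l (R t \<omega>)) I"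
        and XI: "AE \<omega> in M. \<forall>t\<ge>0. X t \<omega> = x + (LBINT s:{0..t}. drift D l \<kappa> \<theta> \<eta> (R s \<omega>)) + I t \<omega> + \<beta> * W t \<omega>"
        using X unfolding controlled_surplus_def by blast
      have Xm: "\<And>t. 0 \<le> t \<Longrightarrow> X t \<in> borel_measurable M"
        and Xc: "\<And>\<omega>. \<omega> \<in> space M \<Longrightarrow> continuous_on {0..} (\<lambda>t. X t \<omega>)"
        and a: "predictable_process M F (\<lambda>t \<omega>. drift D l \<kappa> \<theta> \<eta> (R t \<omega>))"
        using X unfolding controlled_surplus_def by blast+
      have 0: "0 \<le> K" using vol[OF ret] by simp
      have 1: "\<forall>t\<ge>0. \<forall>\<omega>\<in>space M. \<bar>volatility D l (R t \<omega>)\<bar> \<le> K"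
        using ret_adm[OF adm] vol by simp
      have 2: "\<forall>t\<ge>0. \<forall>\<omega>\<in>space M. \<bar>drift D l \<kappa> \<theta> \<eta> (R t \<omega>)\<bar> \<le> L"
        using ret_adm[OF adm] dr by simp
      have 3: "\<forall>t\<ge>0. \<forall>\<omega>\<in>space M. drift D l \<kappa> \<theta> \<eta> (R t \<omega>) \<le> \<rho> / 2 * ((volatility D l (R t \<omega>))\<^sup>2 + \<beta>\<^sup>2)"
        using ret_adm[OF adm] ham(2) by simp
      show "exp (- \<rho> * x) \<le> ruin_prob M X"
        by (rule BM.surplus_ruin_bounds(1)[OF Xm Xc a I XI 0 1 2 \<rho> assms(2) \<open>0 \<le> x\<close> 3])
      assume R: "\<forall>t\<ge>0. \<forall>\<omega>\<in>space M. R t \<omega> = R_D \<theta> \<eta> \<alpha>"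
      have 4: "\<forall>t\<ge>0. \<forall>\<omega>\<in>space M. drift D l \<kappa> \<theta> \<eta> (R t \<omega>) = \<rho> / 2 * ((volatility D l (R t \<omega>))\<^sup>2 + \<beta>\<^sup>2)"
      proof (intro allI impI ballI)
        fix t :: real and \<omega> assume "0 \<le> t" "\<omega> \<in> space M"
        then have "R t \<omega> = R_D \<theta> \<eta> \<alpha>" using R by blast
        then show "drift D l \<kappa> \<theta> \<eta> (R t \<omega>) = \<rho> / 2 * ((volatility D l (R t \<omega>))\<^sup>2 + \<beta>\<^sup>2)"
          using ham(1) by (simp only:)
      qed
      show "ruin_prob M X \<le> exp (- \<rho> * x)"
        by (rule BM.surplus_ruin_bounds(2)[OF Xm Xc a I XI 0 1 2 \<rho> assms(2) \<open>0 \<le> x\<close> 3 4])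
    qed
    show adm: "admissible M F D l c \<theta> \<eta> (\<lambda>t \<omega>. R_D \<theta> \<eta> \<alpha>)"
    proof -
      \<comment> \<open>The premium margin is the drift, and for \<open>R_D\<close> the drift is
        half of \<rho> times the total variance rate, which is positive because of
        \<open>\<beta>\<close>.\<close>
      have "0 < \<rho> / 2 * ((volatility D l (R_D \<theta> \<eta> \<alpha>))\<^sup>2 + \<beta>\<^sup>2)"
        using \<rho> assms(2) by (intro mult_pos_pos add_nonneg_pos) auto
      then have "c - reins_premium D l \<theta> \<eta> (R_D \<theta> \<eta> \<alpha>) - l * claim_mean D (R_D \<theta> \<eta> \<alpha>) > 0"
        unfolding premium_condition[OF ret \<kappa>] ham(1) .
      then show ?thesis
        using ret by (simp add: admissible_def retention_def predictable_process_def)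
    qed
    fix x :: real assume x: "0 \<le> x"
    show ex: "\<exists>X. controlled_surplus M F B W D l \<beta> \<kappa> \<theta> \<eta> (\<lambda>t \<omega>. R_D \<theta> \<eta> \<alpha>) x X"
      by (rule BM.controlled_surplus_const)
    have opt: "ruin_prob M X = exp (- \<rho> * x)"
      if "controlled_surplus M F B W D l \<beta> \<kappa> \<theta> \<eta> (\<lambda>t \<omega>. R_D \<theta> \<eta> \<alpha>) x X" for X
      using lower[OF adm that x] upper[OF adm that x] by simp
    let ?P = "{ruin_prob M X |R X. admissible M F D l c \<theta> \<eta> R \<and> controlled_surplus M F B W D l \<beta> \<kappa> \<theta> \<eta> R x X}"
    have min: "min_ruin_prob M F B W D l \<beta> c \<kappa> \<theta> \<eta> x = exp (- \<rho> * x)"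
      unfolding min_ruin_prob_def
    proof (rule cInf_eq_minimum)
      show "exp (- \<rho> * x) \<in> ?P" using ex adm opt by force
      show "exp (- \<rho> * x) \<le> p" if "p \<in> ?P" for p using that lower x by blast
    qed
    then show "min_ruin_prob M F B W D l \<beta> c \<kappa> \<theta> \<eta> x = exp (- (\<alpha> - \<eta>) * x)" by (simp add: \<rho>_def)
    show "ruin_prob M X = min_ruin_prob M F B W D l \<beta> c \<kappa> \<theta> \<eta> x"
      if "controlled_surplus M F B W D l \<beta> \<kappa> \<theta> \<eta> (\<lambda>t \<omega>. R_D \<theta> \<eta> \<alpha>) x X" for X
      using opt[OF that] min by simp
  qed
qed

end
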